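(* Let $\mathcal{C}$ be a Cartesian reverse derivative category such that $\mathrm{Lin}(\mathcal{C})$ has finite limits. Then there is a hypergraph category $\mathbf{Dynam}_{\mathcal{C}}$ defined by the following data. (i) Objects are the objects of $\mathcal{C}$. (ii) Morphisms $X\to Y$ are isomorphism classes of open dynamical systems with domain boundary $X$ and codomain boundary $Y$. (iii) The composite of $(X\xleftarrow{l_1}N\xrightarrow{r_1}Y,\ v\in D(N))$ and $(Y\xleftarrow{l_2}M\xrightarrow{r_2}Z,\ w\in D(M))$ is the span $X\xleftarrow{l_1\circ b_0}N\times_YM\xrightarrow{r_2\circ b_1}Z$, where $N\xleftarrow{b_0}N\times_YM\xrightarrow{b_1}M$ is the pullback of $r_1$ and $l_2$ in $\mathrm{Lin}(\mathcal{C})$, together with the system given by $$\{*\}\cong\{*\}\times\{*\}\xrightarrow{v\times w}D(N)\times D(M)\xrightarrow{\varphi_{N,M}}D(N\times M)\xrightarrow{D(\langle b_0,b_1\rangle)}D(N\times_YM),$$ where $\langle b_0,b_1\rangle\colon N\times_YM\to N\times M$ is the pairing. (iv) The identity on $X$ is the span $X=X=X$ with decoration $\{*\}\xrightarrow{\varphi_0}D( * )\xrightarrow{D(!)}D(X)$. (v) The monoidal product on objects is their product in $\mathcal{C}$, and the monoidal product of $(X\leftarrow N\to Y,v)$ and $(W\leftarrow M\to Z,w)$ is $(X\times W\leftarrow N\times M\to Y\times Z,\ \varphi_{N,M}(v,w))$. (vi) The hypergraph (Frobenius) maps are those of $\mathrm{Span}(\mathrm{Lin}(\mathcal{C}))$,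 decorated with the identity decoration.
   Context: Composition is written in classical order: $(g\circ f)(x)=g(f(x))$. A Cartesian left-additive category is a category $\mathcal{C}$ with finite products ($\times$, terminal object $*$, unique maps $!_X\colon X\to *$) in which every hom-set $\mathcal{C}(X,Y)$ is a commutative monoid with operation $+$ and identity $0_{X,Y}$, such that (LA.1) $(f+g)\circ h=f\circ h+g\circ h$ and $0_{Y,Z}\circ h=0_{X,Z}$ for all $h\colon X\to Y$, $f,g\colon Y\to Z$; (LA.2) for every projection $\pi_i\colon Y\to Z$ and $f,g\colon X\to Y$, $\pi_i\circ(f+g)=\pi_i\circ f+\pi_i\circ g$ and $\pi_i\circ 0_{X,Y}=0_{X,Z}$. Write $\iota_0:=\langle\mathrm{id},0\rangle$, $\iota_1:=\langle 0,\mathrm{id}\rangle$ for the injections into a product. A Cartesian reverse derivative category (CRDC) is a Cartesian left-additive category with a combinator $\mathbf{R}$ sending each $f\colon X\to Y$ to $\mathbf{R}[f]\colon X\times Y\to X$ such that, writing $\mathbf{D}[f]:=\pi_1\circ\mathbf{R}[\mathbf{R}[f]]\circ(\langle\mathrm{id}_X,0_{X,Y}\rangle\times\mathrm{id}_X)\colon X\times X\to Y$: (RD.1) $\mathbf{R}[f+g]=\mathbf{R}[f]+\mathbf{R}[g]$, $\mathbf{R}[0]=0$; (RD.2) $\mathbf{R}[f]\circ\langle a,b+c\rangle=\mathbf{R}[f]\circ\langle a,b\rangle+\mathbf{R}[f]\circ\langle a,c\rangle$ and $\mathbf{R}[f]\circ\langle a,0\rangle=0$; (RD.3) $\mathbf{R}[\mathrm{id}]=\pi_1$,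 $\mathbf{R}[\pi_0]=\iota_0\circ\pi_1$, $\mathbf{R}[\pi_1]=\iota_1\circ\pi_1$; (RD.4) $\mathbf{R}[\langle f,g\rangle]=\mathbf{R}[f]\circ(\mathrm{id}\times\pi_0)+\mathbf{R}[g]\circ(\mathrm{id}\times\pi_1)$ and $\mathbf{R}[!_X]=0$; (RD.5) $\mathbf{R}[g\circ f]=\mathbf{R}[f]\circ(\mathrm{id}\times\mathbf{R}[g])\circ\langle\pi_0,\langle f\circ\pi_0,\pi_1\rangle\rangle$; (RD.6) $\mathbf{D}[\mathbf{R}[f]]\circ\langle\mathrm{id}\times\pi_0,0\times\pi_1\rangle=\mathbf{R}[f]\circ(\mathrm{id}\times\pi_1)$ as maps $X\times(Y\times Y)\to X$; (RD.7) $\mathbf{D}[\mathbf{D}[f]]=\mathbf{D}[\mathbf{D}[f]]\circ\langle\pi_0\times\pi_0,\pi_1\times\pi_1\rangle$. A morphism $f$ of a CRDC is a linear map if $\mathbf{D}[f]=f\circ\pi_1$. $\mathrm{Lin}(\mathcal{C})$ is the subcategory with the same objects as $\mathcal{C}$ and the linear maps as morphisms; its monoidal product $\times$ is the product of $\mathcal{C}$. For linear $f\colon X\to Y$, $f^\dagger:=\mathbf{R}[f]\circ\langle 0_{Y,X},\mathrm{id}_Y\rangle\colon Y\to X$. It is known (Cockett et al., Proposition 24 of "Reverse derivative categories") that with this operation $\mathrm{Lin}(\mathcal{C})$ is a $\dagger$-category with finite $\dagger$-biproducts, that $\mathbf{R}[f]=f^\dagger\circ\pi_1$ for linear $f$,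 and that $(f+g)^\dagger=f^\dagger+g^\dagger$. The lax symmetric monoidal functor $D=D_{\mathcal{C}}\colon(\mathrm{Lin}(\mathcal{C})^{\mathrm{op}},\times)\to(\mathbf{Set},\times)$ is: $D(X)=\mathcal{C}(X,X)$; $D(\phi)(v)=\phi^\dagger\circ v\circ\phi$ for $\phi\colon X\to Y$ linear and $v\colon Y\to Y$; $\varphi_{X,Y}(v,w)=\pi_0^\dagger\circ v\circ\pi_0+\pi_1^\dagger\circ w\circ\pi_1$; $\varphi_0\colon\{*\}\to D( * )$ is the unique map to the singleton $\mathcal{C}( *,* )$. An open dynamical system with domain boundary $X$ and codomain boundary $Y$ is a span $X\xleftarrow{l}N\xrightarrow{r}Y$ in $\mathrm{Lin}(\mathcal{C})$ together with a morphism $v\colon N\to N$ in $\mathcal{C}$. An isomorphism from $(X\leftarrow N\to Y,v)$ to $(X\leftarrow N'\to Y,v')$ is an isomorphism $n\colon N\to N'$ in $\mathrm{Lin}(\mathcal{C})$ commuting with the legs and with $D(n)(v')=v$. A hypergraph category is a symmetric monoidal category in which every object is equipped with a special commutative Frobenius monoid structure (commutative monoid $(\mu,\eta)$ and cocommutative comonoid $(\delta,\epsilon)$ satisfying the Frobenius law and $\mu\circ\delta=\mathrm{id}$), compatibly with the monoidal product. In $\mathrm{Span}(\mathrm{Lin}(\mathcal{C}))$ the structure on $X$ is: $\mu=(X\times X\xleftarrow{\Delta}X=X)$, $\eta=( *\xleftarrow{!}X=X)$, $\delta=(X=X\xrightarrow{\Delta}X\times X)$, $\epsilon=(X=X\xrightarrow{!}*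 )$, with $\Delta=\langle\mathrm{id},\mathrm{id}\rangle$. The identity decoration on an apex $N$ is the element $\{*\}\xrightarrow{\varphi_0}D( * )\xrightarrow{D(!)}D(N)$. *)

theory Defs
  imports Main
begin

section \<open>Categories and finite limits\<close>

record ('o, 'm) cat =
  obj :: "'o set"
  hom :: "'o \<Rightarrow> 'o \<Rightarrow> 'm set"
  ident :: "'o \<Rightarrow> 'm" (\<open>\<iota>\<index>\<close>)
  cmp :: "'m \<Rightarrow> 'm \<Rightarrow> 'm" (infixl \<open>\<cdot>\<index>\<close> 70)

text \<open>Composition is in classical order. Hom-sets are pairwise disjoint, so that composition
  (and later the sum, the pairing and the reverse derivative) need not be indexed by objects.\<close>

locale category =
  fixes C :: "('o, 'm, 's) cat_scheme" (structure)
  assumes hom_obj: "f \<in> hom C X Y \<Longrightarrow> X \<in> obj C \<and> Y \<in> obj C"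
    and hom_disjoint: "f \<in> hom C X Y \<Longrightarrow> f \<in> hom C X' Y' \<Longrightarrow> X = X' \<and> Y = Y'"
    and ident_hom: "X \<in> obj C \<Longrightarrow> \<iota> X \<in> hom C X X"
    and cmp_hom: "f \<in> hom C X Y \<Longrightarrow> g \<in> hom C Y Z \<Longrightarrow> g \<cdot> f \<in> hom C X Z"
    and cmp_ident: "f \<in> hom C X Y \<Longrightarrow> f \<cdot> \<iota> X = f"
    and ident_cmp: "f \<in> hom C X Y \<Longrightarrow> \<iota> Y \<cdot> f = f"
    and cmp_assoc: "f \<in> hom C W X \<Longrightarrow> g \<in> hom C X Y \<Longrightarrow> h \<in> hom C Y Z \<Longrightarrow>
      (h \<cdot> g) \<cdot> f = h \<cdot> (g \<cdot> f)"

context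
  fixes C :: "('o, 'm, 's) cat_scheme" (structure)
begin

definition is_inverse :: "'o \<Rightarrow> 'o \<Rightarrow> 'm \<Rightarrow> 'm \<Rightarrow> bool" where
  "is_inverse X Y f g \<longleftrightarrow>
     f \<in> hom C X Y \<and> g \<in> hom C Y X \<and> g \<cdot> f = \<iota> X \<and> f \<cdot> g = \<iota> Y"

definition is_iso :: "'o \<Rightarrow> 'o \<Rightarrow> 'm \<Rightarrow> bool" where
  "is_iso X Y f \<longleftrightarrow> (\<exists>g. is_inverse X Y f g)"

definition inv_arr :: "'o \<Rightarrow> 'o \<Rightarrow> 'm \<Rightarrow> 'm" where
  "inv_arr X Y f = (THE g. is_inverse X Y f g)"

definition is_pullback ::
  "'o \<Rightarrow> 'o \<Rightarrow> 'o \<Rightarrow> 'm \<Rightarrow> 'm \<Rightarrow> 'o \<Rightarrow> 'm \<Rightarrow> 'm \<Rightarrow> bool" where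
  "is_pullback N Y M f g P b0 b1 \<longleftrightarrow>
     f \<in> hom C N Y \<and> g \<in> hom C M Y \<and> b0 \<in> hom C P N \<and> b1 \<in> hom C P M \<and> f \<cdot> b0 = g \<cdot> b1 \<and>
     (\<forall>Q c0 c1. c0 \<in> hom C Q N \<and> c1 \<in> hom C Q M \<and> f \<cdot> c0 = g \<cdot> c1 \<longrightarrow>
        (\<exists>!u. u \<in> hom C Q P \<and> b0 \<cdot> u = c0 \<and> b1 \<cdot> u = c1))"

definition is_functor ::
  "('i, 'j, 't) cat_scheme \<Rightarrow> ('i \<Rightarrow> 'o) \<Rightarrow> ('j \<Rightarrow> 'm) \<Rightarrow> bool" where
  "is_functor J Fo Fm \<longleftrightarrow>
     (\<forall>i\<in>obj J. Fo i \<in> obj C \<and> Fm (ident J i) = \<iota> (Fo i)) \<and>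
     (\<forall>i j. \<forall>a\<in>hom J i j. Fm a \<in> hom C (Fo i) (Fo j)) \<and>
     (\<forall>i j k. \<forall>a\<in>hom J i j. \<forall>b\<in>hom J j k. Fm (cmp J b a) = Fm b \<cdot> Fm a)"

definition is_cone ::
  "('i, 'j, 't) cat_scheme \<Rightarrow> ('i \<Rightarrow> 'o) \<Rightarrow> ('j \<Rightarrow> 'm) \<Rightarrow> 'o \<Rightarrow> ('i \<Rightarrow> 'm) \<Rightarrow> bool" where
  "is_cone J Fo Fm L p \<longleftrightarrow>
     L \<in> obj C \<and> (\<forall>i\<in>obj J. p i \<in> hom C L (Fo i)) \<and>
     (\<forall>i j. \<forall>a\<in>hom J i j. Fm a \<cdot> p i = p j)"

definition is_limit ::
  "('i, 'j, 't) cat_scheme \<Rightarrow> ('i \<Rightarrow> 'o) \<Rightarrow> ('j \<Rightarrow> 'm) \<Rightarrow> 'o \<Rightarrow> ('i \<Rightarrow> 'm) \<Rightarrow> bool" where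
  "is_limit J Fo Fm L p \<longleftrightarrow>
     is_cone J Fo Fm L p \<and>
     (\<forall>K q. is_cone J Fo Fm K q \<longrightarrow>
        (\<exists>!u. u \<in> hom C K L \<and> (\<forall>i\<in>obj J. p i \<cdot> u = q i)))"

text \<open>Every finite category is isomorphic to one whose objects and morphisms are natural numbers,
  so it suffices to take such categories as the shapes of finite diagrams.\<close>

definition has_finite_limits :: bool where
  "has_finite_limits \<longleftrightarrow>
     (\<forall>(J :: (nat, nat) cat) Fo Fm.
        category J \<and> finite (obj J) \<and> (\<forall>i j. finite (hom J i j)) \<and> is_functor J Fo Fm \<longrightarrow>
        (\<exists>L p. is_limit J Fo Fm L p))"

end


section \<open>Hypergraph categories\<close>

record ('o, 'm) sm_cat = "('o, 'm) cat" +
  tob :: "'o \<Rightarrow> 'o \<Rightarrow> 'o" (infixr \<open>\<oplus>\<index>\<close> 75)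
  tar :: "'m \<Rightarrow> 'm \<Rightarrow> 'm" (infixr \<open>\<otimes>\<index>\<close> 75)
  munit :: "'o" (\<open>\<I>\<index>\<close>)
  assoc :: "'o \<Rightarrow> 'o \<Rightarrow> 'o \<Rightarrow> 'm" (\<open>\<alpha>\<index>\<close>)
  lunit :: "'o \<Rightarrow> 'm" (\<open>\<lambda>\<^sub>m\<index>\<close>)
  runit :: "'o \<Rightarrow> 'm" (\<open>\<rho>\<^sub>m\<index>\<close>)
  braid :: "'o \<Rightarrow> 'o \<Rightarrow> 'm" (\<open>\<sigma>\<index>\<close>)

text \<open>The monoidal product is written \<open>\<oplus>\<close> on objects and \<open>\<otimes>\<close> on morphisms.\<close>

locale symmetric_monoidal_category = category C
  for C :: "('o, 'm, 's) sm_cat_scheme" (structure) +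
  assumes munit_obj: "\<I> \<in> obj C"
    and tob_obj: "X \<in> obj C \<Longrightarrow> Y \<in> obj C \<Longrightarrow> X \<oplus> Y \<in> obj C"
    and tar_hom: "f \<in> hom C X Y \<Longrightarrow> g \<in> hom C W Z \<Longrightarrow> f \<otimes> g \<in> hom C (X \<oplus> W) (Y \<oplus> Z)"
    and tar_ident: "X \<in> obj C \<Longrightarrow> Y \<in> obj C \<Longrightarrow> \<iota> X \<otimes> \<iota> Y = \<iota> (X \<oplus> Y)"
    and tar_cmp: "f \<in> hom C X Y \<Longrightarrow> g \<in> hom C Y Z \<Longrightarrow> f' \<in> hom C X' Y' \<Longrightarrow> g' \<in> hom C Y' Z' \<Longrightarrow>
      (g \<cdot> f) \<otimes> (g' \<cdot> f') = (g \<otimes> g') \<cdot> (f \<otimes> f')"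
    and assoc_iso: "X \<in> obj C \<Longrightarrow> Y \<in> obj C \<Longrightarrow> Z \<in> obj C \<Longrightarrow>
      is_iso C ((X \<oplus> Y) \<oplus> Z) (X \<oplus> (Y \<oplus> Z)) (\<alpha> X Y Z)"
    and assoc_natural: "f \<in> hom C X X' \<Longrightarrow> g \<in> hom C Y Y' \<Longrightarrow> h \<in> hom C Z Z' \<Longrightarrow>
      \<alpha> X' Y' Z' \<cdot> ((f \<otimes> g) \<otimes> h) = (f \<otimes> (g \<otimes> h)) \<cdot> \<alpha> X Y Z"
    and lunit_iso: "X \<in> obj C \<Longrightarrow> is_iso C (\<I> \<oplus> X) X (\<lambda>\<^sub>m X)"
    and lunit_natural: "f \<in> hom C X Y \<Longrightarrow> \<lambda>\<^sub>m Y \<cdot> (\<iota> \<I> \<otimes> f) = f \<cdot> \<lambda>\<^sub>m X"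
    and runit_iso: "X \<in> obj C \<Longrightarrow> is_iso C (X \<oplus> \<I>) X (\<rho>\<^sub>m X)"
    and runit_natural: "f \<in> hom C X Y \<Longrightarrow> \<rho>\<^sub>m Y \<cdot> (f \<otimes> \<iota> \<I>) = f \<cdot> \<rho>\<^sub>m X"
    and pentagon: "W \<in> obj C \<Longrightarrow> X \<in> obj C \<Longrightarrow> Y \<in> obj C \<Longrightarrow> Z \<in> obj C \<Longrightarrow>
      \<alpha> W X (Y \<oplus> Z) \<cdot> \<alpha> (W \<oplus> X) Y Z =
      (\<iota> W \<otimes> \<alpha> X Y Z) \<cdot> \<alpha> W (X \<oplus> Y) Z \<cdot> (\<alpha> W X Y \<otimes> \<iota> Z)"
    and triangle: "X \<in> obj C \<Longrightarrow> Y \<in> obj C \<Longrightarrow>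
      (\<iota> X \<otimes> \<lambda>\<^sub>m Y) \<cdot> \<alpha> X \<I> Y = \<rho>\<^sub>m X \<otimes> \<iota> Y"
    and braid_hom: "X \<in> obj C \<Longrightarrow> Y \<in> obj C \<Longrightarrow> \<sigma> X Y \<in> hom C (X \<oplus> Y) (Y \<oplus> X)"
    and braid_natural: "f \<in> hom C X X' \<Longrightarrow> g \<in> hom C Y Y' \<Longrightarrow>
      \<sigma> X' Y' \<cdot> (f \<otimes> g) = (g \<otimes> f) \<cdot> \<sigma> X Y"
    and symmetry: "X \<in> obj C \<Longrightarrow> Y \<in> obj C \<Longrightarrow> \<sigma> Y X \<cdot> \<sigma> X Y = \<iota> (X \<oplus> Y)"
    and hexagon: "X \<in> obj C \<Longrightarrow> Y \<in> obj C \<Longrightarrow> Z \<in> obj C \<Longrightarrow>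
      \<alpha> Y Z X \<cdot> \<sigma> X (Y \<oplus> Z) \<cdot> \<alpha> X Y Z =
      (\<iota> Y \<otimes> \<sigma> X Z) \<cdot> \<alpha> Y X Z \<cdot> (\<sigma> X Y \<otimes> \<iota> Z)"

context
  fixes C :: "('o, 'm, 's) sm_cat_scheme" (structure)
begin

definition assoc_inv :: "'o \<Rightarrow> 'o \<Rightarrow> 'o \<Rightarrow> 'm" where
  "assoc_inv X Y Z = inv_arr C ((X \<oplus> Y) \<oplus> Z) (X \<oplus> (Y \<oplus> Z)) (\<alpha> X Y Z)"

text \<open>The canonical map from \<open>(W \<oplus> X) \<oplus> (Y \<oplus> Z)\<close> to \<open>(W \<oplus> Y) \<oplus> (X \<oplus> Z)\<close>.\<close>

definition mid_swap :: "'o \<Rightarrow> 'o \<Rightarrow> 'o \<Rightarrow> 'o \<Rightarrow> 'm" where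
  "mid_swap W X Y Z =
     assoc_inv W Y (X \<oplus> Z) \<cdot>
     (\<iota> W \<otimes> (\<alpha> Y X Z \<cdot> (\<sigma> X Y \<otimes> \<iota> Z) \<cdot> assoc_inv X Y Z)) \<cdot>
     \<alpha> W X (Y \<oplus> Z)"

end

record ('o, 'm) hyp_cat = "('o, 'm) sm_cat" +
  mult :: "'o \<Rightarrow> 'm" (\<open>\<mu>\<index>\<close>)
  munt :: "'o \<Rightarrow> 'm" (\<open>\<eta>\<index>\<close>)
  comult :: "'o \<Rightarrow> 'm" (\<open>\<delta>\<index>\<close>)
  counit :: "'o \<Rightarrow> 'm" (\<open>\<epsilon>\<index>\<close>)

text \<open>Compatibility with the monoidal product includes the nullary case: the structure on \<open>\<I>\<close> is
  the one given by the unitors and identities.\<close>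

locale hypergraph_category = symmetric_monoidal_category C
  for C :: "('o, 'm, 's) hyp_cat_scheme" (structure) +
  assumes mult_hom: "X \<in> obj C \<Longrightarrow> \<mu> X \<in> hom C (X \<oplus> X) X"
    and munt_hom: "X \<in> obj C \<Longrightarrow> \<eta> X \<in> hom C \<I> X"
    and comult_hom: "X \<in> obj C \<Longrightarrow> \<delta> X \<in> hom C X (X \<oplus> X)"
    and counit_hom: "X \<in> obj C \<Longrightarrow> \<epsilon> X \<in> hom C X \<I>"
    and mult_assoc: "X \<in> obj C \<Longrightarrow> \<mu> X \<cdot> (\<mu> X \<otimes> \<iota> X) = \<mu> X \<cdot> (\<iota> X \<otimes> \<mu> X) \<cdot> \<alpha> X X X"
    and mult_lunit: "X \<in> obj C \<Longrightarrow> \<mu> X \<cdot> (\<eta> X \<otimes> \<iota> X) = \<lambda>\<^sub>m X"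
    and mult_runit: "X \<in> obj C \<Longrightarrow> \<mu> X \<cdot> (\<iota> X \<otimes> \<eta> X) = \<rho>\<^sub>m X"
    and mult_comm: "X \<in> obj C \<Longrightarrow> \<mu> X \<cdot> \<sigma> X X = \<mu> X"
    and comult_coassoc: "X \<in> obj C \<Longrightarrow>
      \<alpha> X X X \<cdot> (\<delta> X \<otimes> \<iota> X) \<cdot> \<delta> X = (\<iota> X \<otimes> \<delta> X) \<cdot> \<delta> X"
    and comult_lcounit: "X \<in> obj C \<Longrightarrow> \<lambda>\<^sub>m X \<cdot> (\<epsilon> X \<otimes> \<iota> X) \<cdot> \<delta> X = \<iota> X"
    and comult_rcounit: "X \<in> obj C \<Longrightarrow> \<rho>\<^sub>m X \<cdot> (\<iota> X \<otimes> \<epsilon> X) \<cdot> \<delta> X = \<iota> X"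
    and comult_cocomm: "X \<in> obj C \<Longrightarrow> \<sigma> X X \<cdot> \<delta> X = \<delta> X"
    and frobenius_left: "X \<in> obj C \<Longrightarrow>
      (\<iota> X \<otimes> \<mu> X) \<cdot> \<alpha> X X X \<cdot> (\<delta> X \<otimes> \<iota> X) = \<delta> X \<cdot> \<mu> X"
    and frobenius_right: "X \<in> obj C \<Longrightarrow>
      (\<mu> X \<otimes> \<iota> X) \<cdot> assoc_inv C X X X \<cdot> (\<iota> X \<otimes> \<delta> X) = \<delta> X \<cdot> \<mu> X"
    and special: "X \<in> obj C \<Longrightarrow> \<mu> X \<cdot> \<delta> X = \<iota> X"
    and mult_tensor: "X \<in> obj C \<Longrightarrow> Y \<in> obj C \<Longrightarrow>
      \<mu> (X \<oplus> Y) = (\<mu> X \<otimes> \<mu> Y) \<cdot> mid_swap C X Y X Y"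
    and munt_tensor: "X \<in> obj C \<Longrightarrow> Y \<in> obj C \<Longrightarrow>
      \<eta> (X \<oplus> Y) = (\<eta> X \<otimes> \<eta> Y) \<cdot> inv_arr C (\<I> \<oplus> \<I>) \<I> (\<lambda>\<^sub>m \<I>)"
    and comult_tensor: "X \<in> obj C \<Longrightarrow> Y \<in> obj C \<Longrightarrow>
      \<delta> (X \<oplus> Y) = mid_swap C X X Y Y \<cdot> (\<delta> X \<otimes> \<delta> Y)"
    and counit_tensor: "X \<in> obj C \<Longrightarrow> Y \<in> obj C \<Longrightarrow>
      \<epsilon> (X \<oplus> Y) = \<lambda>\<^sub>m \<I> \<cdot> (\<epsilon> X \<otimes> \<epsilon> Y)"
    and mult_munit: "\<mu> \<I> = \<lambda>\<^sub>m \<I>"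
    and munt_munit: "\<eta> \<I> = \<iota> \<I>"
    and comult_munit: "\<delta> \<I> = inv_arr C (\<I> \<oplus> \<I>) \<I> (\<lambda>\<^sub>m \<I>)"
    and counit_munit: "\<epsilon> \<I> = \<iota> \<I>"


section \<open>Cartesian reverse derivative categories\<close>

record ('o, 'm) cart_cat = "('o, 'm) cat" +
  one :: "'o" (\<open>\<star>\<index>\<close>)
  bang :: "'o \<Rightarrow> 'm" (\<open>!\<index>\<close>)
  pob :: "'o \<Rightarrow> 'o \<Rightarrow> 'o" (infixr \<open>\<odot>\<index>\<close> 75)
  pr0 :: "'o \<Rightarrow> 'o \<Rightarrow> 'm" (\<open>\<pi>\<^sub>0\<index>\<close>)
  pr1 :: "'o \<Rightarrow> 'o \<Rightarrow> 'm" (\<open>\<pi>\<^sub>1\<index>\<close>)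
  pairing :: "'m \<Rightarrow> 'm \<Rightarrow> 'm" (\<open>\<langle>_, _\<rangle>\<index>\<close>)

locale cartesian_category = category C
  for C :: "('o, 'm, 's) cart_cat_scheme" (structure) +
  assumes one_obj: "\<star> \<in> obj C"
    and bang_hom: "X \<in> obj C \<Longrightarrow> ! X \<in> hom C X \<star>"
    and bang_unique: "f \<in> hom C X \<star> \<Longrightarrow> f = ! X"
    and pob_obj: "X \<in> obj C \<Longrightarrow> Y \<in> obj C \<Longrightarrow> X \<odot> Y \<in> obj C"
    and pr0_hom: "X \<in> obj C \<Longrightarrow> Y \<in> obj C \<Longrightarrow> \<pi>\<^sub>0 X Y \<in> hom C (X \<odot> Y) X"
    and pr1_hom: "X \<in> obj C \<Longrightarrow> Y \<in> obj C \<Longrightarrow> \<pi>\<^sub>1 X Y \<in> hom C (X \<odot> Y) Y"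
    and pairing_hom: "f \<in> hom C Z X \<Longrightarrow> g \<in> hom C Z Y \<Longrightarrow> \<langle>f, g\<rangle> \<in> hom C Z (X \<odot> Y)"
    and pr0_pairing: "f \<in> hom C Z X \<Longrightarrow> g \<in> hom C Z Y \<Longrightarrow> \<pi>\<^sub>0 X Y \<cdot> \<langle>f, g\<rangle> = f"
    and pr1_pairing: "f \<in> hom C Z X \<Longrightarrow> g \<in> hom C Z Y \<Longrightarrow> \<pi>\<^sub>1 X Y \<cdot> \<langle>f, g\<rangle> = g"
    and pairing_unique: "X \<in> obj C \<Longrightarrow> Y \<in> obj C \<Longrightarrow> h \<in> hom C Z (X \<odot> Y) \<Longrightarrow>
      \<langle>\<pi>\<^sub>0 X Y \<cdot> h, \<pi>\<^sub>1 X Y \<cdot> h\<rangle> = h"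

text \<open>\<open>pmap C X Y f g\<close> is \<open>f \<times> g\<close>, where \<open>X\<close> and \<open>Y\<close> are the domains of \<open>f\<close> and \<open>g\<close>.\<close>

definition pmap :: "('o, 'm, 's) cart_cat_scheme \<Rightarrow> 'o \<Rightarrow> 'o \<Rightarrow> 'm \<Rightarrow> 'm \<Rightarrow> 'm" where
  "pmap C X Y f g = \<langle>f \<cdot>\<^bsub>C\<^esub> \<pi>\<^sub>0\<^bsub>C\<^esub> X Y, g \<cdot>\<^bsub>C\<^esub> \<pi>\<^sub>1\<^bsub>C\<^esub> X Y\<rangle>\<^bsub>C\<^esub>"

record ('o, 'm) cla_cat = "('o, 'm) cart_cat" +
  zer :: "'o \<Rightarrow> 'o \<Rightarrow> 'm" (\<open>\<zero>\<index>\<close>)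
  add :: "'m \<Rightarrow> 'm \<Rightarrow> 'm" (infixl \<open>\<boxplus>\<index>\<close> 65)

locale cartesian_left_additive_category = cartesian_category C
  for C :: "('o, 'm, 's) cla_cat_scheme" (structure) +
  assumes zer_hom: "X \<in> obj C \<Longrightarrow> Y \<in> obj C \<Longrightarrow> \<zero> X Y \<in> hom C X Y"
    and add_hom: "f \<in> hom C X Y \<Longrightarrow> g \<in> hom C X Y \<Longrightarrow> f \<boxplus> g \<in> hom C X Y"
    and add_assoc: "f \<in> hom C X Y \<Longrightarrow> g \<in> hom C X Y \<Longrightarrow> h \<in> hom C X Y \<Longrightarrow>
      (f \<boxplus> g) \<boxplus> h = f \<boxplus> (g \<boxplus> h)"
    and add_comm: "f \<in> hom C X Y \<Longrightarrow> g \<in> hom C X Y \<Longrightarrow> f \<boxplus> g = g \<boxplus> f"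
    and zer_add: "f \<in> hom C X Y \<Longrightarrow> \<zero> X Y \<boxplus> f = f"
    and LA1_add: "h \<in> hom C X Y \<Longrightarrow> f \<in> hom C Y Z \<Longrightarrow> g \<in> hom C Y Z \<Longrightarrow>
      (f \<boxplus> g) \<cdot> h = (f \<cdot> h) \<boxplus> (g \<cdot> h)"
    and LA1_zer: "h \<in> hom C X Y \<Longrightarrow> Z \<in> obj C \<Longrightarrow> \<zero> Y Z \<cdot> h = \<zero> X Z"
    and LA2_pr0_add: "Y \<in> obj C \<Longrightarrow> Z \<in> obj C \<Longrightarrow> f \<in> hom C X (Y \<odot> Z) \<Longrightarrow> g \<in> hom C X (Y \<odot> Z) \<Longrightarrow>
      \<pi>\<^sub>0 Y Z \<cdot> (f \<boxplus> g) = (\<pi>\<^sub>0 Y Z \<cdot> f) \<boxplus> (\<pi>\<^sub>0 Y Z \<cdot> g)"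
    and LA2_pr1_add: "Y \<in> obj C \<Longrightarrow> Z \<in> obj C \<Longrightarrow> f \<in> hom C X (Y \<odot> Z) \<Longrightarrow> g \<in> hom C X (Y \<odot> Z) \<Longrightarrow>
      \<pi>\<^sub>1 Y Z \<cdot> (f \<boxplus> g) = (\<pi>\<^sub>1 Y Z \<cdot> f) \<boxplus> (\<pi>\<^sub>1 Y Z \<cdot> g)"
    and LA2_pr0_zer: "X \<in> obj C \<Longrightarrow> Y \<in> obj C \<Longrightarrow> Z \<in> obj C \<Longrightarrow>
      \<pi>\<^sub>0 Y Z \<cdot> \<zero> X (Y \<odot> Z) = \<zero> X Y"
    and LA2_pr1_zer: "X \<in> obj C \<Longrightarrow> Y \<in> obj C \<Longrightarrow> Z \<in> obj C \<Longrightarrow>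
      \<pi>\<^sub>1 Y Z \<cdot> \<zero> X (Y \<odot> Z) = \<zero> X Z"

record ('o, 'm) rd_cat = "('o, 'm) cla_cat" +
  rev_diff :: "'m \<Rightarrow> 'm" (\<open>\<R>\<index>\<close>)

definition fwd_diff :: "('o, 'm, 's) rd_cat_scheme \<Rightarrow> 'o \<Rightarrow> 'o \<Rightarrow> 'm \<Rightarrow> 'm" (\<open>\<D>\<index>\<close>) where
  "fwd_diff C X Y f =
     \<pi>\<^sub>1\<^bsub>C\<^esub> X Y \<cdot>\<^bsub>C\<^esub> \<R>\<^bsub>C\<^esub> (\<R>\<^bsub>C\<^esub> f) \<cdot>\<^bsub>C\<^esub>
     pmap C X X \<langle>\<iota>\<^bsub>C\<^esub> X, \<zero>\<^bsub>C\<^esub> X Y\<rangle>\<^bsub>C\<^esub> (\<iota>\<^bsub>C\<^esub> X)"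

locale cartesian_reverse_derivative_category = cartesian_left_additive_category C
  for C :: "('o, 'm, 's) rd_cat_scheme" (structure) +
  assumes rev_hom: "f \<in> hom C X Y \<Longrightarrow> \<R> f \<in> hom C (X \<odot> Y) X"
    and RD1_add: "f \<in> hom C X Y \<Longrightarrow> g \<in> hom C X Y \<Longrightarrow> \<R> (f \<boxplus> g) = \<R> f \<boxplus> \<R> g"
    and RD1_zer: "X \<in> obj C \<Longrightarrow> Y \<in> obj C \<Longrightarrow> \<R> (\<zero> X Y) = \<zero> (X \<odot> Y) X"
    and RD2_add: "f \<in> hom C X Y \<Longrightarrow> a \<in> hom C Z X \<Longrightarrow> b \<in> hom C Z Y \<Longrightarrow> c \<in> hom C Z Y \<Longrightarrow>
      \<R> f \<cdot> \<langle>a, b \<boxplus> c\<rangle> = (\<R> f \<cdot> \<langle>a, b\<rangle>) \<boxplus> (\<R> f \<cdot> \<langle>a, c\<rangle>)"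
    and RD2_zer: "f \<in> hom C X Y \<Longrightarrow> a \<in> hom C Z X \<Longrightarrow> \<R> f \<cdot> \<langle>a, \<zero> Z Y\<rangle> = \<zero> Z X"
    and RD3_ident: "X \<in> obj C \<Longrightarrow> \<R> (\<iota> X) = \<pi>\<^sub>1 X X"
    and RD3_pr0: "X \<in> obj C \<Longrightarrow> Y \<in> obj C \<Longrightarrow>
      \<R> (\<pi>\<^sub>0 X Y) = \<langle>\<iota> X, \<zero> X Y\<rangle> \<cdot> \<pi>\<^sub>1 (X \<odot> Y) X"
    and RD3_pr1: "X \<in> obj C \<Longrightarrow> Y \<in> obj C \<Longrightarrow>
      \<R> (\<pi>\<^sub>1 X Y) = \<langle>\<zero> Y X, \<iota> Y\<rangle> \<cdot> \<pi>\<^sub>1 (X \<odot> Y) Y"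
    and RD4_pairing: "f \<in> hom C Z X \<Longrightarrow> g \<in> hom C Z Y \<Longrightarrow>
      \<R> \<langle>f, g\<rangle> = (\<R> f \<cdot> pmap C Z (X \<odot> Y) (\<iota> Z) (\<pi>\<^sub>0 X Y)) \<boxplus>
                (\<R> g \<cdot> pmap C Z (X \<odot> Y) (\<iota> Z) (\<pi>\<^sub>1 X Y))"
    and RD4_bang: "X \<in> obj C \<Longrightarrow> \<R> (! X) = \<zero> (X \<odot> \<star>) X"
    and RD5: "f \<in> hom C X Y \<Longrightarrow> g \<in> hom C Y Z \<Longrightarrow>
      \<R> (g \<cdot> f) = \<R> f \<cdot> pmap C X (Y \<odot> Z) (\<iota> X) (\<R> g) \<cdot> \<langle>\<pi>\<^sub>0 X Z, \<langle>f \<cdot> \<pi>\<^sub>0 X Z, \<pi>\<^sub>1 X Z\<rangle>\<rangle>"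
    and RD6: "f \<in> hom C X Y \<Longrightarrow>
      \<D> (X \<odot> Y) X (\<R> f) \<cdot>
        \<langle>pmap C X (Y \<odot> Y) (\<iota> X) (\<pi>\<^sub>0 Y Y), pmap C X (Y \<odot> Y) (\<zero> X X) (\<pi>\<^sub>1 Y Y)\<rangle> =
      \<R> f \<cdot> pmap C X (Y \<odot> Y) (\<iota> X) (\<pi>\<^sub>1 Y Y)"
    and RD7: "f \<in> hom C X Y \<Longrightarrow>
      \<D> (X \<odot> X) Y (\<D> X Y f) =
      \<D> (X \<odot> X) Y (\<D> X Y f) \<cdot>
        \<langle>pmap C (X \<odot> X) (X \<odot> X) (\<pi>\<^sub>0 X X) (\<pi>\<^sub>0 X X),
         pmap C (X \<odot> X) (X \<odot> X) (\<pi>\<^sub>1 X X) (\<pi>\<^sub>1 X X)\<rangle>"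


section \<open>Open dynamical systems\<close>

text \<open>The domain and codomain boundaries are not stored, as the legs determine them.\<close>

record ('o, 'm) ods =
  apex :: 'o
  lleg :: 'm
  rleg :: 'm
  syst :: 'm

context
  fixes C :: "('o, 'm, 's) rd_cat_scheme" (structure)
begin

definition Lin :: "('o, 'm) cat" where
  "Lin = \<lparr>obj = obj C,
          hom = (\<lambda>X Y. {f \<in> hom C X Y. \<D> X Y f = f \<cdot> \<pi>\<^sub>1 X X}),
          ident = ident C,
          cmp = cmp C\<rparr>"

definition dag :: "'o \<Rightarrow> 'o \<Rightarrow> 'm \<Rightarrow> 'm" where
  "dag X Y f = \<R> f \<cdot> \<langle>\<zero> Y X, \<iota> Y\<rangle>"

text \<open>The functor \<open>D\<close> on objects and on linear maps \<open>\<phi> : X \<rightarrow> Y\<close>, its laxator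
  \<open>\<phi>\<^sub>X\<^sub>,\<^sub>Y\<close> and the element of \<open>D(\<star>)\<close> picked out by its unit comparison.\<close>

definition Dob :: "'o \<Rightarrow> 'm set" where
  "Dob X = hom C X X"

definition Dar :: "'o \<Rightarrow> 'o \<Rightarrow> 'm \<Rightarrow> 'm \<Rightarrow> 'm" where
  "Dar X Y \<phi> v = dag X Y \<phi> \<cdot> v \<cdot> \<phi>"

definition Dlax :: "'o \<Rightarrow> 'o \<Rightarrow> 'm \<Rightarrow> 'm \<Rightarrow> 'm" where
  "Dlax X Y v w =
     (dag (X \<odot> Y) X (\<pi>\<^sub>0 X Y) \<cdot> v \<cdot> \<pi>\<^sub>0 X Y) \<boxplus> (dag (X \<odot> Y) Y (\<pi>\<^sub>1 X Y) \<cdot> w \<cdot> \<pi>\<^sub>1 X Y)"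

definition Dunit :: 'm where
  "Dunit = the_elem (Dob \<star>)"

definition id_dec :: "'o \<Rightarrow> 'm" where
  "id_dec N = Dar N \<star> (! N) Dunit"

definition ods_set :: "'o \<Rightarrow> 'o \<Rightarrow> ('o, 'm) ods set" where
  "ods_set X Y = {s. lleg s \<in> hom Lin (apex s) X \<and> rleg s \<in> hom Lin (apex s) Y \<and>
                     syst s \<in> Dob (apex s)}"

definition ods_iso :: "'o \<Rightarrow> 'o \<Rightarrow> (('o, 'm) ods \<times> ('o, 'm) ods) set" where
  "ods_iso X Y = {(s, t). s \<in> ods_set X Y \<and> t \<in> ods_set X Y \<and>
     (\<exists>n. is_iso Lin (apex s) (apex t) n \<and> lleg t \<cdot> n = lleg s \<and> rleg t \<cdot> n = rleg s \<and>
          Dar (apex s) (apex t) n (syst t) = syst s)}"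

definition ods_class :: "'o \<Rightarrow> 'o \<Rightarrow> ('o, 'm) ods \<Rightarrow> ('o, 'm) ods set" where
  "ods_class X Y s = ods_iso X Y `` {s}"

text \<open>\<open>ods_comp s t P b0 b1\<close> is the composite of \<open>s : X \<rightarrow> Y\<close> followed by \<open>t : Y \<rightarrow> Z\<close> formed with the
  pullback \<open>(P, b0, b1)\<close> of \<open>rleg s\<close> and \<open>lleg t\<close>.\<close>

definition ods_comp ::
  "('o, 'm) ods \<Rightarrow> ('o, 'm) ods \<Rightarrow> 'o \<Rightarrow> 'm \<Rightarrow> 'm \<Rightarrow> ('o, 'm) ods" where
  "ods_comp s t P b0 b1 =
     \<lparr>apex = P,
      lleg = lleg s \<cdot> b0,
      rleg = rleg t \<cdot> b1,
      syst = Dar P (apex s \<odot> apex t) \<langle>b0, b1\<rangle> (Dlax (apex s) (apex t) (syst s) (syst t))\<rparr>"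

definition ods_tensor :: "('o, 'm) ods \<Rightarrow> ('o, 'm) ods \<Rightarrow> ('o, 'm) ods" where
  "ods_tensor s t =
     \<lparr>apex = apex s \<odot> apex t,
      lleg = pmap C (apex s) (apex t) (lleg s) (lleg t),
      rleg = pmap C (apex s) (apex t) (rleg s) (rleg t),
      syst = Dlax (apex s) (apex t) (syst s) (syst t)\<rparr>"

text \<open>The operations on isomorphism classes collect the systems isomorphic to a composite, or a
  monoidal product, of some representatives, for some choice of the pullback. That this is a
  single class, the one of any such composite or product, is part of what has to be proved.\<close>

definition class_comp :: "('o, 'm) ods set \<Rightarrow> ('o, 'm) ods set \<Rightarrow> ('o, 'm) ods set" where
  "class_comp G F = {u. \<exists>X Y Z s t P b0 b1.
     s \<in> F \<and> t \<in> G \<and> s \<in> ods_set X Y \<and> t \<in> ods_set Y Z \<and>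
     is_pullback Lin (apex s) Y (apex t) (rleg s) (lleg t) P b0 b1 \<and>
     u \<in> ods_class X Z (ods_comp s t P b0 b1)}"

definition class_tensor :: "('o, 'm) ods set \<Rightarrow> ('o, 'm) ods set \<Rightarrow> ('o, 'm) ods set" where
  "class_tensor F G = {u. \<exists>X Y W Z s t.
     s \<in> F \<and> t \<in> G \<and> s \<in> ods_set X Y \<and> t \<in> ods_set W Z \<and>
     u \<in> ods_class (X \<odot> W) (Y \<odot> Z) (ods_tensor s t)}"

text \<open>The class of the span \<open>X \<leftarrow> N \<rightarrow> Y\<close> in \<open>Lin\<close> with the identity decoration, and the special
  case where the left leg is the identity.\<close>

definition dec_span :: "'o \<Rightarrow> 'o \<Rightarrow> 'o \<Rightarrow> 'm \<Rightarrow> 'm \<Rightarrow> ('o, 'm) ods set" where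
  "dec_span X Y N l r = ods_class X Y \<lparr>apex = N, lleg = l, rleg = r, syst = id_dec N\<rparr>"

definition dec_map :: "'o \<Rightarrow> 'o \<Rightarrow> 'm \<Rightarrow> ('o, 'm) ods set" where
  "dec_map X Y f = dec_span X Y X (\<iota> X) f"

text \<open>The coherence isomorphisms are those of spans in \<open>Lin\<close>, that is, the canonical maps between
  products seen as spans, with the identity decoration.\<close>

definition Dynam :: "('o, ('o, 'm) ods set) hyp_cat" where
  "Dynam =
     \<lparr>obj = obj C,
      hom = (\<lambda>X Y. ods_set X Y // ods_iso X Y),
      ident = (\<lambda>X. dec_span X X X (\<iota> X) (\<iota> X)),
      cmp = class_comp,
      tob = (\<lambda>X Y. X \<odot> Y),
      tar = class_tensor,
      munit = \<star>,
      assoc = (\<lambda>X Y Z. dec_map ((X \<odot> Y) \<odot> Z) (X \<odot> (Y \<odot> Z))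
         \<langle>\<pi>\<^sub>0 X Y \<cdot> \<pi>\<^sub>0 (X \<odot> Y) Z, \<langle>\<pi>\<^sub>1 X Y \<cdot> \<pi>\<^sub>0 (X \<odot> Y) Z, \<pi>\<^sub>1 (X \<odot> Y) Z\<rangle>\<rangle>),
      lunit = (\<lambda>X. dec_map (\<star> \<odot> X) X (\<pi>\<^sub>1 \<star> X)),
      runit = (\<lambda>X. dec_map (X \<odot> \<star>) X (\<pi>\<^sub>0 X \<star>)),
      braid = (\<lambda>X Y. dec_map (X \<odot> Y) (Y \<odot> X) \<langle>\<pi>\<^sub>1 X Y, \<pi>\<^sub>0 X Y\<rangle>),
      mult = (\<lambda>X. dec_span (X \<odot> X) X X \<langle>\<iota> X, \<iota> X\<rangle> (\<iota> X)),
      munt = (\<lambda>X. dec_span \<star> X X (! X) (\<iota> X)),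
      comult = (\<lambda>X. dec_span X (X \<odot> X) X (\<iota> X) \<langle>\<iota> X, \<iota> X\<rangle>),
      counit = (\<lambda>X. dec_span X \<star> X (\<iota> X) (! X))\<rparr>"

end

end

theory Submission
  imports Defs
begin

text \<open>Write \<open>f\<^sup>* v\<close> for \<open>D(f)(v) = f\<^sup>\<dagger> \<circ> v \<circ> f\<close>, the constant \<open>pull\<close> below. Two facts about reverse
  derivatives carry the theorem. First, the linear maps are closed under composition, pairing and
  projections (\<open>linear_cmp\<close>, \<open>linear_pairing\<close>, \<open>linear_pr\<close>, all resting on the chain rule
  \<open>diff_cmp_at\<close>), so that \<open>Lin(C)\<close> inherits the finite products of \<open>C\<close>; with finite limits it also has
  pullbacks. Second, \<open>f\<^sup>*\<close> is contravariantly functorial in the linear map \<open>f\<close> and preserves sums and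
  zero (\<open>pull_pull\<close>, \<open>pull_add\<close>, \<open>pull_zer\<close>). Hence \<open>D\<close> takes values in commutative monoids, its
  laxator is \<open>(v, w) \<mapsto> \<pi>\<^sub>0\<^sup>* v + \<pi>\<^sub>1\<^sup>* w\<close>, a composite formed with a pullback \<open>(b0, b1)\<close> carries the system
  \<open>b0\<^sup>* v + b1\<^sup>* w\<close>, and the identity decoration is \<open>0\<close>. From here on only these rules matter: the
  claim is that spans in a category with finite limits, decorated by a contravariant functor to
  commutative monoids, form a hypergraph category.

  Composition and monoidal product respect isomorphism of systems by the universal property of
  pullbacks and products. Composition is associative because both ways of bracketing three spans are
  represented by one span: its apex is the pullback of the two pullbacks over the middle apex, its
  system the sum of the three systems pulled back there. The monoidal product is functorial because
  a product of two pullback squares is a pullback square.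

  Every linear \<open>f : X \<rightarrow> Y\<close> gives two spans with zero system: \<open>graph f = (X = X \<rightarrow> Y)\<close>, covariant in
  \<open>f\<close>, and \<open>cograph f = (Y \<leftarrow> X = X)\<close>, contravariant in \<open>f\<close>. Composing any span with a graph on the
  left or a cograph on the right just extends a leg, and the graph of an isomorphism is the cograph of
  its inverse. All structure maps are graphs or cographs, so the laws in which one variance occurs
  become equations between maps of \<open>C\<close>, checked on tuples. The laws that mix the two, the special and
  the Frobenius laws, need in addition the pullbacks \<open>pullback_diag\<close> and \<open>pullback_frobenius\<close> of
  maps built from diagonals.\<close>

section \<open>Typed composition and pullbacks\<close>

context category
begin

text \<open>Hom-sets are disjoint, so a morphism determines its domain and codomain. Typing conditions phrased
  with \<open>src\<close> and \<open>tgt\<close> contain no objects beyond those of the term to be rewritten, and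
  conditional rewriting can discharge them.\<close>

definition arr :: "'m \<Rightarrow> bool" where
  "arr f \<longleftrightarrow> (\<exists>X Y. f \<in> hom C X Y)"

definition src :: "'m \<Rightarrow> 'o" where
  "src f = (THE X. \<exists>Y. f \<in> hom C X Y)"

definition tgt :: "'m \<Rightarrow> 'o" where
  "tgt f = (THE Y. \<exists>X. f \<in> hom C X Y)"

lemma hom_iff: "f \<in> hom C X Y \<longleftrightarrow> arr f \<and> src f = X \<and> tgt f = Y"
proof -
  have *: "src f = X' \<and> tgt f = Y'" if "f \<in> hom C X' Y'" for X' Y'
    using that hom_disjoint unfolding src_def tgt_def by (blast intro!: the_equality)
  then show ?thesis unfolding arr_def by blast
qed

lemma arr_hom: "arr f \<Longrightarrow> f \<in> hom C (src f) (tgt f)"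
  by (simp add: hom_iff)

lemma src_obj [simp]: "arr f \<Longrightarrow> src f \<in> obj C"
  and tgt_obj [simp]: "arr f \<Longrightarrow> tgt f \<in> obj C"
  using hom_obj arr_hom by blast+

lemma ident_typed [simp]:
  assumes "X \<in> obj C"
  shows "arr (\<iota> X)" "src (\<iota> X) = X" "tgt (\<iota> X) = X"
  using ident_hom [OF assms] by (simp_all add: hom_iff)

lemma cmp_typed [simp]:
  assumes "arr f" "arr g" "tgt f = src g"
  shows "arr (g \<cdot> f)" "src (g \<cdot> f) = src f" "tgt (g \<cdot> f) = tgt g"
  using cmp_hom [of f "src f" "src g" g "tgt g"] assms by (simp_all add: hom_iff)

lemma cmp_ident_typed [simp]: "arr f \<Longrightarrow> src f = X \<Longrightarrow> f \<cdot> \<iota> X = f"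
  using cmp_ident arr_hom by blast

lemma ident_cmp_typed [simp]: "arr f \<Longrightarrow> tgt f = Y \<Longrightarrow> \<iota> Y \<cdot> f = f"
  using ident_cmp arr_hom by blast

lemma cmp_assoc_typed [simp]:
  "arr f \<Longrightarrow> arr g \<Longrightarrow> arr h \<Longrightarrow> tgt f = src g \<Longrightarrow> tgt g = src h \<Longrightarrow>
    (h \<cdot> g) \<cdot> f = h \<cdot> (g \<cdot> f)"
  using cmp_assoc by (simp add: hom_iff)

lemma cmp_cong_right:
  assumes "g \<cdot> f = k \<cdot> h"
    and "arr f" "arr g" "arr h" "arr k" "arr s" "tgt f = src g" "tgt h = src k" "tgt s = src f" "tgt s = src h"
  shows "g \<cdot> (f \<cdot> s) = k \<cdot> (h \<cdot> s)"
  using assms by (simp flip: cmp_assoc_typed)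

lemma inverse_unique:
  assumes "is_inverse C X Y f g" "is_inverse C X Y f g'"
  shows "g' = g"
proof -
  have "g' = g' \<cdot> (f \<cdot> g)"
    using assms cmp_ident by (auto simp: is_inverse_def)
  also have "\<dots> = g"
    using assms cmp_assoc [of g Y X f Y g' X] ident_cmp by (auto simp: is_inverse_def)
  finally show ?thesis .
qed

lemma inv_arr_eq: "is_inverse C X Y f g \<Longrightarrow> inv_arr C X Y f = g"
  unfolding inv_arr_def using inverse_unique by blast

lemma pullbackI:
  assumes "f \<in> hom C N Y" "g \<in> hom C M Y" "b0 \<in> hom C P N" "b1 \<in> hom C P M" "f \<cdot> b0 = g \<cdot> b1"
    and lift: "\<And>Q c0 c1. c0 \<in> hom C Q N \<Longrightarrow> c1 \<in> hom C Q M \<Longrightarrow> f \<cdot> c0 = g \<cdot> c1 \<Longrightarrow>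
      \<exists>u. u \<in> hom C Q P \<and> b0 \<cdot> u = c0 \<and> b1 \<cdot> u = c1"
    and cancel: "\<And>Q u u'. u \<in> hom C Q P \<Longrightarrow> u' \<in> hom C Q P \<Longrightarrow>
      b0 \<cdot> u = b0 \<cdot> u' \<Longrightarrow> b1 \<cdot> u = b1 \<cdot> u' \<Longrightarrow> u = u'"
  shows "is_pullback C N Y M f g P b0 b1"
  unfolding is_pullback_def
proof (intro conjI allI impI)
  fix Q c0 c1
  assume c: "c0 \<in> hom C Q N \<and> c1 \<in> hom C Q M \<and> f \<cdot> c0 = g \<cdot> c1"
  then obtain u where "u \<in> hom C Q P" "b0 \<cdot> u = c0" "b1 \<cdot> u = c1"
    using lift by blast
  then show "\<exists>!u. u \<in> hom C Q P \<and> b0 \<cdot> u = c0 \<and> b1 \<cdot> u = c1"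
    using cancel by (intro ex1I [of _ u]) auto
qed (use assms in auto)

lemma pullback_typed:
  assumes "is_pullback C N Y M f g P b0 b1"
  shows "f \<in> hom C N Y" "g \<in> hom C M Y" "b0 \<in> hom C P N" "b1 \<in> hom C P M" "f \<cdot> b0 = g \<cdot> b1"
  using assms unfolding is_pullback_def by auto

lemma pullback_lift:
  assumes "is_pullback C N Y M f g P b0 b1"
    and "c0 \<in> hom C Q N" "c1 \<in> hom C Q M" "f \<cdot> c0 = g \<cdot> c1"
  obtains u where "u \<in> hom C Q P" "b0 \<cdot> u = c0" "b1 \<cdot> u = c1"
proof -
  have "\<exists>!u. u \<in> hom C Q P \<and> b0 \<cdot> u = c0 \<and> b1 \<cdot> u = c1"
    using assms unfolding is_pullback_def by simp
  then show thesis using that by blast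
qed

lemma pullback_cancel:
  assumes pb: "is_pullback C N Y M f g P b0 b1"
    and u: "u \<in> hom C Q P" "u' \<in> hom C Q P" "b0 \<cdot> u = b0 \<cdot> u'" "b1 \<cdot> u = b1 \<cdot> u'"
  shows "u = u'"
proof -
  note t = pullback_typed [OF pb]
  have "f \<cdot> (b0 \<cdot> u') = g \<cdot> (b1 \<cdot> u')"
    using cmp_assoc [OF u(2) t(3,1)] cmp_assoc [OF u(2) t(4,2)] t(5) by simp
  moreover have "b0 \<cdot> u' \<in> hom C Q N" "b1 \<cdot> u' \<in> hom C Q M"
    using cmp_hom u(2) t by blast+
  ultimately have "\<exists>!w. w \<in> hom C Q P \<and> b0 \<cdot> w = b0 \<cdot> u' \<and> b1 \<cdot> w = b1 \<cdot> u'"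
    using pb unfolding is_pullback_def by simp
  then show ?thesis using u by auto
qed

lemma pullback_sym:
  assumes "is_pullback C N Y M f g P b0 b1"
  shows "is_pullback C M Y N g f P b1 b0"
  using pullback_typed [OF assms]
proof (intro pullbackI)
  fix Q c0 c1
  assume "c0 \<in> hom C Q M" "c1 \<in> hom C Q N" "g \<cdot> c0 = f \<cdot> c1"
  then show "\<exists>u. u \<in> hom C Q P \<and> b1 \<cdot> u = c0 \<and> b0 \<cdot> u = c1"
    using pullback_lift [OF assms] by metis
next
  fix Q u u'
  assume "u \<in> hom C Q P" "u' \<in> hom C Q P" "b1 \<cdot> u = b1 \<cdot> u'" "b0 \<cdot> u = b0 \<cdot> u'"
  then show "u = u'"
    using pullback_cancel [OF assms] by blast
qed auto

lemma pullback_ident: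
  assumes "f \<in> hom C N Y"
  shows "is_pullback C N Y Y f (\<iota> Y) N (\<iota> N) f"
  using assms hom_obj [OF assms]
  by (intro pullbackI) (auto simp: hom_iff)

text \<open>The pasting lemma for pullback squares: a lift into the outer rectangle is found by lifting first
  into the one square and then into the other.\<close>

lemma pullback_paste:
  assumes pb: "is_pullback C N Y M f g P b0 b1"
    and pb': "is_pullback C P M R b1 k S s0 s1"
  shows "is_pullback C N Y R f (g \<cdot> k) S (b0 \<cdot> s0) s1"
proof -
  note pbt = pullback_typed [OF pb] and pbt' = pullback_typed [OF pb']
  note t = pbt(1-4) [unfolded hom_iff] pbt'(2-4) [unfolded hom_iff]
  have sq: "f \<cdot> (b0 \<cdot> z) = g \<cdot> (b1 \<cdot> z)" if "arr z" "tgt z = P" for z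
    using cmp_cong_right [OF pbt(5)] that t by simp
  have sq': "b1 \<cdot> (s0 \<cdot> z) = k \<cdot> (s1 \<cdot> z)" if "arr z" "tgt z = S" for z
    using cmp_cong_right [OF pbt'(5)] that t by simp
  show ?thesis
  proof (rule pullbackI)
    show "f \<cdot> (b0 \<cdot> s0) = (g \<cdot> k) \<cdot> s1"
      using t pbt'(5) by (simp add: sq)
  next
    fix Q c0 c1
    assume c: "c0 \<in> hom C Q N" "c1 \<in> hom C Q R" "f \<cdot> c0 = (g \<cdot> k) \<cdot> c1"
    then have "k \<cdot> c1 \<in> hom C Q M" "f \<cdot> c0 = g \<cdot> (k \<cdot> c1)"
      using t by (auto simp: hom_iff)
    then obtain u where u: "u \<in> hom C Q P" "b0 \<cdot> u = c0" "b1 \<cdot> u = k \<cdot> c1"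
      using pullback_lift [OF pb c(1)] by metis
    obtain w where w: "w \<in> hom C Q S" "s0 \<cdot> w = u" "s1 \<cdot> w = c1"
      using pullback_lift [OF pb' u(1) c(2) u(3)] by metis
    show "\<exists>w. w \<in> hom C Q S \<and> (b0 \<cdot> s0) \<cdot> w = c0 \<and> s1 \<cdot> w = c1"
      using w u t by (intro exI [of _ w]) (auto simp: hom_iff)
  next
    fix Q w w'
    assume w: "w \<in> hom C Q S" "w' \<in> hom C Q S" "(b0 \<cdot> s0) \<cdot> w = (b0 \<cdot> s0) \<cdot> w'" "s1 \<cdot> w = s1 \<cdot> w'"
    note wt = w(1,2) [unfolded hom_iff]
    have "b0 \<cdot> (s0 \<cdot> w) = b0 \<cdot> (s0 \<cdot> w')" "b1 \<cdot> (s0 \<cdot> w) = b1 \<cdot> (s0 \<cdot> w')"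
      using w(3,4) wt t by (simp_all add: sq')
    moreover have "s0 \<cdot> w \<in> hom C Q P" "s0 \<cdot> w' \<in> hom C Q P"
      using wt t by (simp_all add: hom_iff)
    ultimately have "s0 \<cdot> w = s0 \<cdot> w'"
      using pullback_cancel [OF pb] by blast
    then show "w = w'" using w pullback_cancel [OF pb'] by blast
  qed (use t in \<open>auto simp: hom_iff\<close>)
qed

text \<open>The category \<open>0 \<rightarrow> 2 \<leftarrow> 1\<close>. Its identities carry the names of their objects; \<open>3\<close> and \<open>4\<close> are the
  two legs.\<close>

definition cospan_shape :: "(nat, nat) cat" where
  "cospan_shape =
     \<lparr>obj = {0, 1, 2},
      hom = (\<lambda>i j. if i = j \<and> i < 3 then {i} else if i = 0 \<and> j = 2 then {3}
                   else if i = 1 \<and> j = 2 then {4} else {}),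
      ident = (\<lambda>i. i),
      cmp = (\<lambda>b a. if b < 3 then a else b)\<rparr>"

lemma pullback_exists:
  assumes lim: "has_finite_limits C" and f: "f \<in> hom C N Y" and g: "g \<in> hom C M Y"
  obtains P b0 b1 where "is_pullback C N Y M f g P b0 b1"
proof -
  define Fo where "Fo = (\<lambda>i :: nat. if i = 0 then N else if i = 1 then M else Y)"
  define Fm where "Fm = (\<lambda>a :: nat. if a = 0 then \<iota> N else if a = 1 then \<iota> M
    else if a = 2 then \<iota> Y else if a = 3 then f else g)"
  note o = hom_obj [OF f] hom_obj [OF g]
  have "category cospan_shape"
    by standard (auto simp: cospan_shape_def split: if_splits)
  moreover have "finite (obj cospan_shape)" "\<forall>i j. finite (hom cospan_shape i j)"
    by (auto simp: cospan_shape_def)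
  moreover have "is_functor C cospan_shape Fo Fm"
    using o f g unfolding is_functor_def
    by (auto simp: cospan_shape_def Fo_def Fm_def hom_iff split: if_splits)
  ultimately obtain P p where L: "is_limit C cospan_shape Fo Fm P p"
    using lim unfolding has_finite_limits_def by blast
  have cone: "is_cone C cospan_shape Fo Fm K q \<longleftrightarrow> K \<in> obj C \<and>
      q 0 \<in> hom C K N \<and> q 1 \<in> hom C K M \<and> q 2 \<in> hom C K Y \<and> f \<cdot> q 0 = q 2 \<and> g \<cdot> q 1 = q 2" for K q
  proof -
    have mem: "a \<in> hom cospan_shape i j \<longleftrightarrow>
        (i, j, a) \<in> {(0, 0, 0), (1, 1, 1), (2, 2, 2), (0, 2, 3), (1, 2, 4)}" for i j a
      by (auto simp: cospan_shape_def)
    have arrows: "(\<forall>i j. \<forall>a\<in>hom cospan_shape i j. A i j a) \<longleftrightarrow>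
        A 0 0 0 \<and> A 1 1 1 \<and> A 2 2 2 \<and> A 0 2 3 \<and> A 1 2 4" for A
      unfolding Ball_def mem by blast
    show ?thesis unfolding is_cone_def arrows
      by (auto simp: cospan_shape_def Fo_def Fm_def hom_iff)
  qed
  have c: "p 0 \<in> hom C P N" "p 1 \<in> hom C P M" "f \<cdot> p 0 = p 2" "g \<cdot> p 1 = p 2"
    using L unfolding is_limit_def cone by auto
  have "is_pullback C N Y M f g P (p 0) (p 1)"
    unfolding is_pullback_def
  proof (intro conjI allI impI)
    fix Q c0 c1
    assume a: "c0 \<in> hom C Q N \<and> c1 \<in> hom C Q M \<and> f \<cdot> c0 = g \<cdot> c1"
    define q where "q = (\<lambda>i :: nat. if i = 0 then c0 else if i = 1 then c1 else f \<cdot> c0)"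
    have "is_cone C cospan_shape Fo Fm Q q"
      unfolding cone using a f g by (auto simp: q_def hom_iff)
    then have "\<exists>!u. u \<in> hom C Q P \<and> (\<forall>i\<in>obj cospan_shape. p i \<cdot> u = q i)"
      using L unfolding is_limit_def by blast
    moreover have "u \<in> hom C Q P \<and> (\<forall>i\<in>obj cospan_shape. p i \<cdot> u = q i) \<longleftrightarrow>
        u \<in> hom C Q P \<and> p 0 \<cdot> u = c0 \<and> p 1 \<cdot> u = c1" for u
    proof -
      \<comment> \<open>The component of a cone at the apex of the cospan is determined by the other two.\<close>
      have "p 2 \<cdot> u = f \<cdot> c0" if "u \<in> hom C Q P" "p 0 \<cdot> u = c0"
        using cmp_assoc [OF that(1) c(1) f] that c by simp
      then show ?thesis by (auto simp: cospan_shape_def q_def)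
    qed
    ultimately show "\<exists>!u. u \<in> hom C Q P \<and> p 0 \<cdot> u = c0 \<and> p 1 \<cdot> u = c1" by simp
  qed (use c f g in auto)
  then show thesis by (rule that)
qed

end

section \<open>Products and sums of morphisms\<close>

context cartesian_category
begin

lemma one_obj_simp [simp]: "\<star> \<in> obj C"
  by (rule one_obj)

lemma pob_obj_simp [simp]: "X \<in> obj C \<Longrightarrow> Y \<in> obj C \<Longrightarrow> X \<odot> Y \<in> obj C"
  by (rule pob_obj)

lemma bang_typed [simp]:
  assumes "X \<in> obj C"
  shows "arr (! X)" "src (! X) = X" "tgt (! X) = \<star>"
  using bang_hom [OF assms] by (simp_all add: hom_iff)

lemma pr_typed [simp]:
  assumes "X \<in> obj C" "Y \<in> obj C"
  shows "arr (\<pi>\<^sub>0 X Y)" "src (\<pi>\<^sub>0 X Y) = X \<odot> Y" "tgt (\<pi>\<^sub>0 X Y) = X"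
    "arr (\<pi>\<^sub>1 X Y)" "src (\<pi>\<^sub>1 X Y) = X \<odot> Y" "tgt (\<pi>\<^sub>1 X Y) = Y"
  using pr0_hom [OF assms] pr1_hom [OF assms] by (simp_all add: hom_iff)

lemma pairing_typed [simp]:
  assumes "arr f" "arr g" "src f = src g"
  shows "arr \<langle>f, g\<rangle>" "src \<langle>f, g\<rangle> = src g" "tgt \<langle>f, g\<rangle> = tgt f \<odot> tgt g"
  using pairing_hom [of f "src g" "tgt f" g "tgt g"] assms by (simp_all add: hom_iff)

lemma bang_unique_typed: "arr f \<Longrightarrow> tgt f = \<star> \<Longrightarrow> f = ! (src f)"
  using bang_unique [of f "src f"] by (simp add: hom_iff)

lemma bang_cmp [simp]: "arr f \<Longrightarrow> tgt f = X \<Longrightarrow> ! X \<cdot> f = ! (src f)"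
  using bang_unique_typed [of "! X \<cdot> f"] by auto

lemma bang_one [simp]: "! \<star> = \<iota> \<star>"
  using bang_unique_typed [of "\<iota> \<star>"] by auto

lemma pr_pairing [simp]:
  assumes "arr f" "arr g" "src f = src g" "tgt f = X" "tgt g = Y"
  shows "\<pi>\<^sub>0 X Y \<cdot> \<langle>f, g\<rangle> = f" "\<pi>\<^sub>1 X Y \<cdot> \<langle>f, g\<rangle> = g"
  using pr0_pairing [of f "src f" X g Y] pr1_pairing [of f "src f" X g Y] assms
  by (simp_all add: hom_iff)

lemma prod_ext:
  assumes "arr h" "arr k" "src h = src k" "tgt h = X \<odot> Y" "tgt k = X \<odot> Y" "X \<in> obj C" "Y \<in> obj C"
    and "\<pi>\<^sub>0 X Y \<cdot> h = \<pi>\<^sub>0 X Y \<cdot> k" "\<pi>\<^sub>1 X Y \<cdot> h = \<pi>\<^sub>1 X Y \<cdot> k"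
  shows "h = k"
proof -
  have "h = \<langle>\<pi>\<^sub>0 X Y \<cdot> h, \<pi>\<^sub>1 X Y \<cdot> h\<rangle>"
    using pairing_unique [of X Y h "src h"] assms(1-7) by (simp add: hom_iff)
  also have "\<dots> = \<langle>\<pi>\<^sub>0 X Y \<cdot> k, \<pi>\<^sub>1 X Y \<cdot> k\<rangle>"
    by (simp only: assms(8,9))
  also have "\<dots> = k"
    using pairing_unique [of X Y k "src k"] assms(1-7) by (simp add: hom_iff)
  finally show ?thesis .
qed

lemma pairing_cmp [simp]:
  assumes "arr f" "arr g" "arr h" "src f = src g" "tgt h = src g"
  shows "\<langle>f, g\<rangle> \<cdot> h = \<langle>f \<cdot> h, g \<cdot> h\<rangle>"
proof -
  have "\<pi>\<^sub>0 (tgt f) (tgt g) \<cdot> (\<langle>f, g\<rangle> \<cdot> h) = f \<cdot> h"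
    "\<pi>\<^sub>1 (tgt f) (tgt g) \<cdot> (\<langle>f, g\<rangle> \<cdot> h) = g \<cdot> h"
    using assms by (simp_all del: cmp_assoc_typed add: cmp_assoc_typed [symmetric, of h "\<langle>f, g\<rangle>"])
  then show ?thesis
    using assms by - (rule prod_ext [of _ _ "tgt f" "tgt g"]; simp)
qed

lemma pairing_pr [simp]:
  "X \<in> obj C \<Longrightarrow> Y \<in> obj C \<Longrightarrow> \<langle>\<pi>\<^sub>0 X Y, \<pi>\<^sub>1 X Y\<rangle> = \<iota> (X \<odot> Y)"
  by - (rule prod_ext [of _ _ X Y]; simp)

lemma pairing_pr_cmp [simp]:
  "arr h \<Longrightarrow> tgt h = X \<odot> Y \<Longrightarrow> X \<in> obj C \<Longrightarrow> Y \<in> obj C \<Longrightarrow>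
    \<langle>\<pi>\<^sub>0 X Y \<cdot> h, \<pi>\<^sub>1 X Y \<cdot> h\<rangle> = h"
  by - (rule prod_ext [of _ _ X Y]; simp)

lemma pairing_inj:
  assumes "arr f" "arr g" "arr f'" "arr g'" "src f = src g" "src f' = src g'" "tgt f = tgt f'" "tgt g = tgt g'"
  shows "\<langle>f, g\<rangle> = \<langle>f', g'\<rangle> \<longleftrightarrow> f = f' \<and> g = g'"
proof
  assume eq: "\<langle>f, g\<rangle> = \<langle>f', g'\<rangle>"
  have "f = \<pi>\<^sub>0 (tgt f') (tgt g') \<cdot> \<langle>f, g\<rangle>" "g = \<pi>\<^sub>1 (tgt f') (tgt g') \<cdot> \<langle>f, g\<rangle>"
    by (rule pr_pairing [symmetric]; use assms in simp)+
  moreover have "\<pi>\<^sub>0 (tgt f') (tgt g') \<cdot> \<langle>f', g'\<rangle> = f'" "\<pi>\<^sub>1 (tgt f') (tgt g') \<cdot> \<langle>f', g'\<rangle> = g'"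
    by (rule pr_pairing; use assms in simp)+
  ultimately show "f = f' \<and> g = g'"
    unfolding eq by metis
qed simp

lemma pmap_typed [simp]:
  assumes "arr f" "arr g" "src f = X" "src g = Y"
  shows "arr (pmap C X Y f g)" "src (pmap C X Y f g) = X \<odot> Y" "tgt (pmap C X Y f g) = tgt f \<odot> tgt g"
  using assms by (auto simp: pmap_def)

lemma pr_pmap [simp]:
  assumes "arr f" "arr g" "src f = X" "src g = Y" "tgt f = A" "tgt g = B"
  shows "\<pi>\<^sub>0 A B \<cdot> pmap C X Y f g = f \<cdot> \<pi>\<^sub>0 X Y" "\<pi>\<^sub>1 A B \<cdot> pmap C X Y f g = g \<cdot> \<pi>\<^sub>1 X Y"
  using assms by (auto simp: pmap_def)

lemma pr_pmap_cmp [simp]: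
  assumes "arr f" "arr g" "src f = X" "src g = Y" "tgt f = A" "tgt g = B" "arr h" "tgt h = X \<odot> Y"
  shows "\<pi>\<^sub>0 A B \<cdot> (pmap C X Y f g \<cdot> h) = f \<cdot> (\<pi>\<^sub>0 X Y \<cdot> h)"
    "\<pi>\<^sub>1 A B \<cdot> (pmap C X Y f g \<cdot> h) = g \<cdot> (\<pi>\<^sub>1 X Y \<cdot> h)"
  using assms by (auto simp: pmap_def)

lemma pmap_pairing [simp]:
  assumes "arr f" "arr g" "src f = X" "src g = Y" "arr a" "arr b" "src a = src b" "tgt a = X" "tgt b = Y"
  shows "pmap C X Y f g \<cdot> \<langle>a, b\<rangle> = \<langle>f \<cdot> a, g \<cdot> b\<rangle>"
  using assms by (auto simp: pmap_def)

lemma pmap_pmap [simp]: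
  assumes "arr f" "arr g" "src f = tgt f'" "src g = tgt g'" "arr f'" "arr g'"
    "src f' = X" "src g' = Y" "tgt f' = A" "tgt g' = B"
  shows "pmap C A B f g \<cdot> pmap C X Y f' g' = pmap C X Y (f \<cdot> f') (g \<cdot> g')"
  using assms by (auto simp: pmap_def)

lemma pmap_ident [simp]: "X \<in> obj C \<Longrightarrow> Y \<in> obj C \<Longrightarrow> pmap C X Y (\<iota> X) (\<iota> Y) = \<iota> (X \<odot> Y)"
  by (simp add: pmap_def)

text \<open>A map out of a product is determined by its effect on tuples, as one sees on the tuple of
  projections. Taking \<open>a\<close>, \<open>b\<close>, \<open>c\<close> opaque turns each coherence equation below into a
  computation with tuples.\<close>

lemma triple_ext:
  assumes h: "arr h" "src h = (X \<odot> Y) \<odot> Z" and k: "arr k" "src k = (X \<odot> Y) \<odot> Z"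
    and o: "X \<in> obj C" "Y \<in> obj C" "Z \<in> obj C"
    and eq: "\<And>a b c. arr a \<Longrightarrow> arr b \<Longrightarrow> arr c \<Longrightarrow>
      src a = src c \<Longrightarrow> src b = src c \<Longrightarrow>
      tgt a = X \<Longrightarrow> tgt b = Y \<Longrightarrow> tgt c = Z \<Longrightarrow>
      h \<cdot> \<langle>\<langle>a, b\<rangle>, c\<rangle> = k \<cdot> \<langle>\<langle>a, b\<rangle>, c\<rangle>"
  shows "h = k"
  using eq [of "\<pi>\<^sub>0 X Y \<cdot> \<pi>\<^sub>0 (X \<odot> Y) Z" "\<pi>\<^sub>1 X Y \<cdot> \<pi>\<^sub>0 (X \<odot> Y) Z" "\<pi>\<^sub>1 (X \<odot> Y) Z"]
    h k o by simp

lemma quadruple_ext: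
  assumes h: "arr h" "src h = ((W \<odot> X) \<odot> Y) \<odot> Z" and k: "arr k" "src k = ((W \<odot> X) \<odot> Y) \<odot> Z"
    and o: "W \<in> obj C" "X \<in> obj C" "Y \<in> obj C" "Z \<in> obj C"
    and eq: "\<And>a b c d. arr a \<Longrightarrow> arr b \<Longrightarrow> arr c \<Longrightarrow> arr d \<Longrightarrow>
      src a = src d \<Longrightarrow> src b = src d \<Longrightarrow> src c = src d \<Longrightarrow>
      tgt a = W \<Longrightarrow> tgt b = X \<Longrightarrow> tgt c = Y \<Longrightarrow> tgt d = Z \<Longrightarrow>
      h \<cdot> \<langle>\<langle>\<langle>a, b\<rangle>, c\<rangle>, d\<rangle> = k \<cdot> \<langle>\<langle>\<langle>a, b\<rangle>, c\<rangle>, d\<rangle>"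
  shows "h = k"
proof (rule triple_ext [of _ "W \<odot> X" Y Z])
  fix u c d
  assume u: "arr u" "arr c" "arr d" "src u = src d" "src c = src d" "tgt u = W \<odot> X" "tgt c = Y" "tgt d = Z"
  then show "h \<cdot> \<langle>\<langle>u, c\<rangle>, d\<rangle> = k \<cdot> \<langle>\<langle>u, c\<rangle>, d\<rangle>"
    using eq [of "\<pi>\<^sub>0 W X \<cdot> u" "\<pi>\<^sub>1 W X \<cdot> u" c d] o by simp
qed (use assms in simp_all)

lemma double_pair_ext:
  assumes h: "arr h" "src h = (W \<odot> X) \<odot> (Y \<odot> Z)" and k: "arr k" "src k = (W \<odot> X) \<odot> (Y \<odot> Z)"
    and o: "W \<in> obj C" "X \<in> obj C" "Y \<in> obj C" "Z \<in> obj C"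
    and eq: "\<And>a b c d. arr a \<Longrightarrow> arr b \<Longrightarrow> arr c \<Longrightarrow> arr d \<Longrightarrow>
      src a = src d \<Longrightarrow> src b = src d \<Longrightarrow> src c = src d \<Longrightarrow>
      tgt a = W \<Longrightarrow> tgt b = X \<Longrightarrow> tgt c = Y \<Longrightarrow> tgt d = Z \<Longrightarrow>
      h \<cdot> \<langle>\<langle>a, b\<rangle>, \<langle>c, d\<rangle>\<rangle> = k \<cdot> \<langle>\<langle>a, b\<rangle>, \<langle>c, d\<rangle>\<rangle>"
  shows "h = k"
proof (rule triple_ext [of _ W X "Y \<odot> Z"])
  fix a b u
  assume u: "arr a" "arr b" "arr u" "src a = src u" "src b = src u" "tgt a = W" "tgt b = X" "tgt u = Y \<odot> Z"
  then show "h \<cdot> \<langle>\<langle>a, b\<rangle>, u\<rangle> = k \<cdot> \<langle>\<langle>a, b\<rangle>, u\<rangle>"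
    using eq [of a b "\<pi>\<^sub>0 Y Z \<cdot> u" "\<pi>\<^sub>1 Y Z \<cdot> u"] o by simp
qed (use assms in simp_all)

definition assoc_map :: "'o \<Rightarrow> 'o \<Rightarrow> 'o \<Rightarrow> 'm" where
  "assoc_map X Y Z = \<langle>\<pi>\<^sub>0 X Y \<cdot> \<pi>\<^sub>0 (X \<odot> Y) Z, \<langle>\<pi>\<^sub>1 X Y \<cdot> \<pi>\<^sub>0 (X \<odot> Y) Z, \<pi>\<^sub>1 (X \<odot> Y) Z\<rangle>\<rangle>"

definition assoc_map_inv :: "'o \<Rightarrow> 'o \<Rightarrow> 'o \<Rightarrow> 'm" where
  "assoc_map_inv X Y Z = \<langle>\<langle>\<pi>\<^sub>0 X (Y \<odot> Z), \<pi>\<^sub>0 Y Z \<cdot> \<pi>\<^sub>1 X (Y \<odot> Z)\<rangle>, \<pi>\<^sub>1 Y Z \<cdot> \<pi>\<^sub>1 X (Y \<odot> Z)\<rangle>"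

definition swap_map :: "'o \<Rightarrow> 'o \<Rightarrow> 'm" where
  "swap_map X Y = \<langle>\<pi>\<^sub>1 X Y, \<pi>\<^sub>0 X Y\<rangle>"

definition mid_swap_map :: "'o \<Rightarrow> 'o \<Rightarrow> 'o \<Rightarrow> 'o \<Rightarrow> 'm" where
  "mid_swap_map W X Y Z =
     \<langle>pmap C (W \<odot> X) (Y \<odot> Z) (\<pi>\<^sub>0 W X) (\<pi>\<^sub>0 Y Z), pmap C (W \<odot> X) (Y \<odot> Z) (\<pi>\<^sub>1 W X) (\<pi>\<^sub>1 Y Z)\<rangle>"

abbreviation diag :: "'o \<Rightarrow> 'm" where
  "diag X \<equiv> \<langle>\<iota> X, \<iota> X\<rangle>"

lemma assoc_map_typed [simp]:
  assumes "X \<in> obj C" "Y \<in> obj C" "Z \<in> obj C"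
  shows "arr (assoc_map X Y Z)" "src (assoc_map X Y Z) = (X \<odot> Y) \<odot> Z" "tgt (assoc_map X Y Z) = X \<odot> Y \<odot> Z"
    "arr (assoc_map_inv X Y Z)" "src (assoc_map_inv X Y Z) = X \<odot> Y \<odot> Z"
    "tgt (assoc_map_inv X Y Z) = (X \<odot> Y) \<odot> Z"
  using assms by (simp_all add: assoc_map_def assoc_map_inv_def)

lemma swap_map_typed [simp]:
  assumes "X \<in> obj C" "Y \<in> obj C"
  shows "arr (swap_map X Y)" "src (swap_map X Y) = X \<odot> Y" "tgt (swap_map X Y) = Y \<odot> X"
  using assms by (simp_all add: swap_map_def)

lemma mid_swap_map_typed [simp]:
  assumes "W \<in> obj C" "X \<in> obj C" "Y \<in> obj C" "Z \<in> obj C"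
  shows "arr (mid_swap_map W X Y Z)" "src (mid_swap_map W X Y Z) = (W \<odot> X) \<odot> (Y \<odot> Z)"
    "tgt (mid_swap_map W X Y Z) = (W \<odot> Y) \<odot> (X \<odot> Z)"
  using assms by (simp_all add: mid_swap_map_def)

lemma assoc_map_pairing [simp]:
  assumes abc: "arr a" "arr b" "arr c" "src a = src c" "src b = src c" "tgt a = X" "tgt b = Y" "tgt c = Z"
  shows "assoc_map X Y Z \<cdot> \<langle>\<langle>a, b\<rangle>, c\<rangle> = \<langle>a, \<langle>b, c\<rangle>\<rangle>"
    "assoc_map_inv X Y Z \<cdot> \<langle>a, \<langle>b, c\<rangle>\<rangle> = \<langle>\<langle>a, b\<rangle>, c\<rangle>"
proof -
  have "X \<in> obj C" "Y \<in> obj C" "Z \<in> obj C" using assms by auto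
  then show "assoc_map X Y Z \<cdot> \<langle>\<langle>a, b\<rangle>, c\<rangle> = \<langle>a, \<langle>b, c\<rangle>\<rangle>"
    "assoc_map_inv X Y Z \<cdot> \<langle>a, \<langle>b, c\<rangle>\<rangle> = \<langle>\<langle>a, b\<rangle>, c\<rangle>"
    using abc by (simp_all add: assoc_map_def assoc_map_inv_def)
qed

lemma swap_map_pairing [simp]:
  assumes "arr a" "arr b" "src a = src b" "tgt a = X" "tgt b = Y"
  shows "swap_map X Y \<cdot> \<langle>a, b\<rangle> = \<langle>b, a\<rangle>"
  using assms by (auto simp: swap_map_def)

lemma mid_swap_map_pairing [simp]:
  assumes abcd: "arr a" "arr b" "arr c" "arr d" "src a = src d" "src b = src d" "src c = src d"
    "tgt a = W" "tgt b = X" "tgt c = Y" "tgt d = Z"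
  shows "mid_swap_map W X Y Z \<cdot> \<langle>\<langle>a, b\<rangle>, \<langle>c, d\<rangle>\<rangle> = \<langle>\<langle>a, c\<rangle>, \<langle>b, d\<rangle>\<rangle>"
proof -
  have "W \<in> obj C" "X \<in> obj C" "Y \<in> obj C" "Z \<in> obj C" using assms by auto
  then show ?thesis
    using abcd by (simp add: mid_swap_map_def)
qed

lemma pentagon_maps:
  assumes [simp]: "W \<in> obj C" "X \<in> obj C" "Y \<in> obj C" "Z \<in> obj C"
  shows "assoc_map W X (Y \<odot> Z) \<cdot> assoc_map (W \<odot> X) Y Z =
    pmap C W ((X \<odot> Y) \<odot> Z) (\<iota> W) (assoc_map X Y Z) \<cdot> assoc_map W (X \<odot> Y) Z \<cdot>
      pmap C ((W \<odot> X) \<odot> Y) Z (assoc_map W X Y) (\<iota> Z)"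
  by (rule quadruple_ext [of _ W X Y Z]) simp_all

lemma hexagon_maps:
  assumes [simp]: "X \<in> obj C" "Y \<in> obj C" "Z \<in> obj C"
  shows "assoc_map Y Z X \<cdot> swap_map X (Y \<odot> Z) \<cdot> assoc_map X Y Z =
    pmap C Y (X \<odot> Z) (\<iota> Y) (swap_map X Z) \<cdot> assoc_map Y X Z \<cdot> pmap C (X \<odot> Y) Z (swap_map X Y) (\<iota> Z)"
  by (rule triple_ext [of _ X Y Z]) simp_all

lemma mid_swap_map_eq:
  assumes [simp]: "W \<in> obj C" "X \<in> obj C" "Y \<in> obj C" "Z \<in> obj C"
  shows "assoc_map_inv W Y (X \<odot> Z) \<cdot>
      (pmap C W (X \<odot> Y \<odot> Z) (\<iota> W)
        (assoc_map Y X Z \<cdot> (pmap C (X \<odot> Y) Z (swap_map X Y) (\<iota> Z) \<cdot> assoc_map_inv X Y Z)) \<cdot>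
      assoc_map W X (Y \<odot> Z)) = mid_swap_map W X Y Z"
  by (rule double_pair_ext [of _ W X Y Z]) simp_all

lemma mid_swap_map_diag:
  assumes "X \<in> obj C" "Y \<in> obj C"
  shows "mid_swap_map X X Y Y \<cdot> pmap C X Y (diag X) (diag Y) = diag (X \<odot> Y)"
  using assms by (simp add: pmap_def)

end

context cartesian_left_additive_category
begin

lemma zer_typed [simp]:
  assumes "X \<in> obj C" "Y \<in> obj C"
  shows "arr (\<zero> X Y)" "src (\<zero> X Y) = X" "tgt (\<zero> X Y) = Y"
  using zer_hom [OF assms] by (simp_all add: hom_iff)

lemma add_typed [simp]:
  assumes "arr f" "arr g" "src f = src g" "tgt f = tgt g"
  shows "arr (f \<boxplus> g)" "src (f \<boxplus> g) = src g" "tgt (f \<boxplus> g) = tgt g"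
  using add_hom [of f "src g" "tgt g" g] assms by (simp_all add: hom_iff)

lemma add_assoc_typed:
  "arr f \<Longrightarrow> arr g \<Longrightarrow> arr h \<Longrightarrow> src f = src g \<Longrightarrow> src g = src h \<Longrightarrow> tgt f = tgt g \<Longrightarrow> tgt g = tgt h \<Longrightarrow>
    (f \<boxplus> g) \<boxplus> h = f \<boxplus> (g \<boxplus> h)"
  using add_assoc [of f "src f" "tgt f" g h] by (simp add: hom_iff)

lemma add_comm_typed:
  "arr f \<Longrightarrow> arr g \<Longrightarrow> src f = src g \<Longrightarrow> tgt f = tgt g \<Longrightarrow> f \<boxplus> g = g \<boxplus> f"
  using add_comm [of f "src f" "tgt f" g] by (simp add: hom_iff)

lemma add_left_comm_typed:
  "arr f \<Longrightarrow> arr g \<Longrightarrow> arr h \<Longrightarrow> src f = src g \<Longrightarrow> src g = src h \<Longrightarrow> tgt f = tgt g \<Longrightarrow> tgt g = tgt h \<Longrightarrow>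
    f \<boxplus> (g \<boxplus> h) = g \<boxplus> (f \<boxplus> h)"
  using add_assoc_typed [of f g h] add_assoc_typed [of g f h] add_comm_typed [of f g] by simp

lemmas add_ac_typed = add_assoc_typed add_comm_typed add_left_comm_typed

lemma zer_add_typed [simp]:
  assumes "arr f" "src f = X" "tgt f = Y"
  shows "\<zero> X Y \<boxplus> f = f" "f \<boxplus> \<zero> X Y = f"
  using zer_add [of f X Y] add_comm_typed [of f "\<zero> X Y"] assms by (auto simp: hom_iff)

lemma add_cmp [simp]:
  "arr f \<Longrightarrow> arr g \<Longrightarrow> arr h \<Longrightarrow> src f = src g \<Longrightarrow> tgt f = tgt g \<Longrightarrow> tgt h = src g \<Longrightarrow>
    (f \<boxplus> g) \<cdot> h = (f \<cdot> h) \<boxplus> (g \<cdot> h)"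
  using LA1_add [of h "src h" "src f" f "tgt f" g] by (simp add: hom_iff)

lemma zer_cmp [simp]:
  "arr h \<Longrightarrow> tgt h = Y \<Longrightarrow> Z \<in> obj C \<Longrightarrow> \<zero> Y Z \<cdot> h = \<zero> (src h) Z"
  using LA1_zer [of h "src h" Y Z] by (simp add: hom_iff)

lemma pr_add [simp]:
  assumes "X \<in> obj C" "Y \<in> obj C" "arr f" "arr g" "src f = src g" "tgt f = X \<odot> Y" "tgt g = X \<odot> Y"
  shows "\<pi>\<^sub>0 X Y \<cdot> (f \<boxplus> g) = (\<pi>\<^sub>0 X Y \<cdot> f) \<boxplus> (\<pi>\<^sub>0 X Y \<cdot> g)"
    "\<pi>\<^sub>1 X Y \<cdot> (f \<boxplus> g) = (\<pi>\<^sub>1 X Y \<cdot> f) \<boxplus> (\<pi>\<^sub>1 X Y \<cdot> g)"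
  using LA2_pr0_add [of X Y f "src f" g] LA2_pr1_add [of X Y f "src f" g] assms
  by (simp_all add: hom_iff)

lemma pr_zer [simp]:
  assumes "X \<in> obj C" "Y \<in> obj C" "Z \<in> obj C"
  shows "\<pi>\<^sub>0 X Y \<cdot> \<zero> Z (X \<odot> Y) = \<zero> Z X" "\<pi>\<^sub>1 X Y \<cdot> \<zero> Z (X \<odot> Y) = \<zero> Z Y"
  using LA2_pr0_zer LA2_pr1_zer assms by auto

lemma zer_one: "X \<in> obj C \<Longrightarrow> \<zero> X \<star> = ! X"
  using bang_unique_typed [of "\<zero> X \<star>"] by simp

end

section \<open>Linear maps\<close>

context cartesian_reverse_derivative_category
begin

lemma rev_typed [simp]:
  assumes "arr f"
  shows "arr (\<R> f)" "src (\<R> f) = src f \<odot> tgt f" "tgt (\<R> f) = src f"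
  using rev_hom [OF arr_hom [OF assms]] by (simp_all add: hom_iff)

lemma rev_cmp_at:
  assumes "arr f" "arr g" "tgt f = src g" "arr a" "arr b" "src a = src b" "tgt a = src f" "tgt b = tgt g"
  shows "\<R> (g \<cdot> f) \<cdot> \<langle>a, b\<rangle> = \<R> f \<cdot> \<langle>a, \<R> g \<cdot> \<langle>f \<cdot> a, b\<rangle>\<rangle>"
  using assms RD5 [of f "src f" "tgt f" g "tgt g"]
  by (simp add: hom_iff pmap_def)

lemma rev_pairing_at:
  assumes "arr f" "arr g" "src f = src g" "arr a" "arr b" "src a = src b" "tgt a = src g"
    "tgt b = tgt f \<odot> tgt g"
  shows "\<R> \<langle>f, g\<rangle> \<cdot> \<langle>a, b\<rangle> =
    (\<R> f \<cdot> \<langle>a, \<pi>\<^sub>0 (tgt f) (tgt g) \<cdot> b\<rangle>) \<boxplus> (\<R> g \<cdot> \<langle>a, \<pi>\<^sub>1 (tgt f) (tgt g) \<cdot> b\<rangle>)"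
  using assms RD4_pairing [of f "src g" "tgt f" g "tgt g"]
  by (simp add: hom_iff pmap_def)

lemma rev_at [simp]:
  assumes "arr a" "arr b" "src a = src b"
  shows "tgt a = X \<Longrightarrow> tgt b = X \<Longrightarrow> \<R> (\<iota> X) \<cdot> \<langle>a, b\<rangle> = b"
    "tgt a = X \<odot> Y \<Longrightarrow> tgt b = X \<Longrightarrow> X \<in> obj C \<Longrightarrow> Y \<in> obj C \<Longrightarrow>
      \<R> (\<pi>\<^sub>0 X Y) \<cdot> \<langle>a, b\<rangle> = \<langle>b, \<zero> (src b) Y\<rangle>"
    "tgt a = X \<odot> Y \<Longrightarrow> tgt b = Y \<Longrightarrow> X \<in> obj C \<Longrightarrow> Y \<in> obj C \<Longrightarrow>
      \<R> (\<pi>\<^sub>1 X Y) \<cdot> \<langle>a, b\<rangle> = \<langle>\<zero> (src b) X, b\<rangle>"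
    "tgt a = X \<Longrightarrow> tgt b = Y \<Longrightarrow> \<R> (\<zero> X Y) \<cdot> \<langle>a, b\<rangle> = \<zero> (src b) X"
  using assms by (auto simp: RD3_ident RD3_pr0 RD3_pr1 RD1_zer)

lemma rev_add_at:
  assumes "arr f" "arr a" "arr b" "arr c" "src a = src b" "src b = src c" "tgt a = src f"
    "tgt b = tgt f" "tgt c = tgt f"
  shows "\<R> f \<cdot> \<langle>a, b \<boxplus> c\<rangle> = (\<R> f \<cdot> \<langle>a, b\<rangle>) \<boxplus> (\<R> f \<cdot> \<langle>a, c\<rangle>)"
  using assms RD2_add [of f "src f" "tgt f" a "src a" b c] by (simp add: hom_iff)

lemma rev_zer_at [simp]:
  assumes "arr f" "arr a" "tgt a = src f" "src a = Z" "tgt f = Y"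
  shows "\<R> f \<cdot> \<langle>a, \<zero> Z Y\<rangle> = \<zero> Z (src f)"
  using assms RD2_zer [of f "src f" "tgt f" a "src a"] by (simp add: hom_iff)

lemma diff_typed [simp]:
  assumes "arr f" "src f = X" "tgt f = Y"
  shows "arr (\<D> X Y f)" "src (\<D> X Y f) = X \<odot> X" "tgt (\<D> X Y f) = Y"
  using assms by (auto simp: fwd_diff_def pmap_def)

lemma diff_at:
  assumes "arr f" "src f = X" "tgt f = Y" "arr a" "arr b" "src a = src b" "tgt a = X" "tgt b = X"
  shows "\<D> X Y f \<cdot> \<langle>a, b\<rangle> = \<pi>\<^sub>1 X Y \<cdot> (\<R> (\<R> f) \<cdot> \<langle>\<langle>a, \<zero> (src b) Y\<rangle>, b\<rangle>)"
  using assms by (auto simp: fwd_diff_def pmap_def)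

text \<open>The chain rule. By RD.5, \<open>R[g \<circ> f] = R[f] \<circ> \<langle>\<pi>\<^sub>0, p\<rangle>\<close> with \<open>p(x, z) = R[g](f x, z)\<close>, and RD.5 and RD.4 applied
  to this composite express its reverse derivative at \<open>u = (a, 0)\<close>. Since \<open>p\<close> vanishes there by
  RD.2, the outer factor contributes \<open>R[R[f]]((a, 0), b)\<close>, whose second component is \<open>D[f](a, b)\<close>. Of the three
  resulting summands only the one from the second projection inside \<open>p\<close> has a component in \<open>Z\<close>, and
  this component is \<open>D[g](f a, D[f](a, b))\<close>.\<close>

lemma diff_cmp_at:
  assumes f: "arr f" "src f = X" "tgt f = Y" and g: "arr g" "src g = Y" "tgt g = Z"
    and ab: "arr a" "arr b" "src a = src b" "tgt a = X" "tgt b = X"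
  shows "\<D> X Z (g \<cdot> f) \<cdot> \<langle>a, b\<rangle> = \<D> Y Z g \<cdot> \<langle>f \<cdot> a, \<D> X Y f \<cdot> \<langle>a, b\<rangle>\<rangle>"
proof -
  have [simp]: "X \<in> obj C" "Y \<in> obj C" "Z \<in> obj C"
    using assms src_obj tgt_obj by metis+
  define p where "p = \<R> g \<cdot> \<langle>f \<cdot> \<pi>\<^sub>0 X Z, \<pi>\<^sub>1 X Z\<rangle>"
  define u where "u = \<langle>a, \<zero> (src b) Z\<rangle>"
  define c where "c = \<R> (\<R> f) \<cdot> \<langle>\<langle>a, \<zero> (src b) Y\<rangle>, b\<rangle>"
  define d where "d = \<pi>\<^sub>1 X Y \<cdot> c"
  define e where "e = \<R> (\<R> g) \<cdot> \<langle>\<langle>f \<cdot> a, \<zero> (src b) Z\<rangle>, d\<rangle>"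
  have p [simp]: "arr p" "src p = X \<odot> Z" "tgt p = Y" "p \<cdot> u = \<zero> (src b) Y"
    using assms by (simp_all add: p_def u_def)
  have u [simp]: "arr u" "src u = src b" "tgt u = X \<odot> Z" "\<pi>\<^sub>0 X Z \<cdot> u = a"
      "\<pi>\<^sub>1 X Z \<cdot> u = \<zero> (src b) Z"
    using ab by (simp_all add: u_def)
  have c [simp]: "arr c" "src c = src b" "tgt c = X \<odot> Y"
    using f ab by (simp_all add: c_def)
  have d [simp]: "arr d" "src d = src b" "tgt d = Y"
    by (simp_all add: d_def)
  have e [simp]: "arr e" "src e = src b" "tgt e = Y \<odot> Z"
    using assms by (simp_all add: e_def)
  have "\<R> p \<cdot> \<langle>u, d\<rangle> = \<R> \<langle>f \<cdot> \<pi>\<^sub>0 X Z, \<pi>\<^sub>1 X Z\<rangle> \<cdot> \<langle>u, e\<rangle>"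
    unfolding p_def e_def using assms by (subst rev_cmp_at) simp_all
  also have "\<dots> = \<langle>\<R> f \<cdot> \<langle>a, \<pi>\<^sub>0 Y Z \<cdot> e\<rangle>, \<zero> (src b) Z\<rangle> \<boxplus> \<langle>\<zero> (src b) X, \<pi>\<^sub>1 Y Z \<cdot> e\<rangle>"
    using assms by (simp add: rev_pairing_at rev_cmp_at)
  finally have p': "\<R> p \<cdot> \<langle>u, d\<rangle> = \<dots>" .
  have "\<R> (g \<cdot> f) = \<R> f \<cdot> \<langle>\<pi>\<^sub>0 X Z, p\<rangle>"
    using RD5 [of f X Y g Z] assms by (simp add: hom_iff pmap_def p_def)
  then have "\<R> (\<R> (g \<cdot> f)) \<cdot> \<langle>u, b\<rangle> = \<R> \<langle>\<pi>\<^sub>0 X Z, p\<rangle> \<cdot> \<langle>u, c\<rangle>"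
    using assms by (simp add: rev_cmp_at c_def)
  also have "\<dots> = \<langle>\<pi>\<^sub>0 X Y \<cdot> c, \<zero> (src b) Z\<rangle> \<boxplus>
      (\<langle>\<R> f \<cdot> \<langle>a, \<pi>\<^sub>0 Y Z \<cdot> e\<rangle>, \<zero> (src b) Z\<rangle> \<boxplus> \<langle>\<zero> (src b) X, \<pi>\<^sub>1 Y Z \<cdot> e\<rangle>)"
    by (simp add: rev_pairing_at p' flip: d_def)
  finally have "\<pi>\<^sub>1 X Z \<cdot> (\<R> (\<R> (g \<cdot> f)) \<cdot> \<langle>u, b\<rangle>) = \<pi>\<^sub>1 Y Z \<cdot> e"
    using f ab by simp
  moreover have "\<D> X Y f \<cdot> \<langle>a, b\<rangle> = d"
    using f ab by (simp add: diff_at d_def c_def)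
  ultimately show ?thesis
    using assms by (simp add: diff_at u_def e_def)
qed

definition linear :: "'m \<Rightarrow> bool" where
  "linear f \<longleftrightarrow> arr f \<and> \<D> (src f) (tgt f) f = f \<cdot> \<pi>\<^sub>1 (src f) (src f)"

lemma Lin_simps [simp]: "obj (Lin C) = obj C" "ident (Lin C) = ident C" "cmp (Lin C) = cmp C"
  by (simp_all add: Lin_def)

lemma Lin_hom_iff: "f \<in> hom (Lin C) X Y \<longleftrightarrow> linear f \<and> src f = X \<and> tgt f = Y"
  by (auto simp: Lin_def linear_def hom_iff)

lemma linear_arr [simp]: "linear f \<Longrightarrow> arr f"
  by (simp add: linear_def)

lemma linearI:
  assumes f: "arr f" "src f = X" "tgt f = Y"
    and "\<And>a b. arr a \<Longrightarrow> arr b \<Longrightarrow> src a = src b \<Longrightarrow> tgt a = X \<Longrightarrow> tgt b = X \<Longrightarrow>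
      \<D> X Y f \<cdot> \<langle>a, b\<rangle> = f \<cdot> b"
  shows "linear f"
proof -
  have "X \<in> obj C" using f by auto
  then have "\<D> X Y f \<cdot> \<langle>\<pi>\<^sub>0 X X, \<pi>\<^sub>1 X X\<rangle> = f \<cdot> \<pi>\<^sub>1 X X"
    by (intro assms(4)) simp_all
  then show ?thesis using f \<open>X \<in> obj C\<close> by (simp add: linear_def)
qed

lemma linear_diff_at:
  assumes "linear f" "src f = X" "tgt f = Y" "arr a" "arr b" "src a = src b" "tgt a = X" "tgt b = X"
  shows "\<D> X Y f \<cdot> \<langle>a, b\<rangle> = f \<cdot> b"
  using assms by (auto simp: linear_def)

lemma linear_ident [simp]: "X \<in> obj C \<Longrightarrow> linear (\<iota> X)"
  by (rule linearI [of _ X X]) (simp_all add: diff_at RD3_ident)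

lemma linear_bang [simp]: "X \<in> obj C \<Longrightarrow> linear (! X)"
  by (rule linearI [of _ X \<star>]) (simp_all add: diff_at RD4_bang zer_one)

lemma linear_pr [simp]:
  assumes "X \<in> obj C" "Y \<in> obj C"
  shows "linear (\<pi>\<^sub>0 X Y)" "linear (\<pi>\<^sub>1 X Y)"
proof -
  show "linear (\<pi>\<^sub>0 X Y)"
    by (rule linearI [of _ "X \<odot> Y" X])
      (use assms in \<open>simp_all add: diff_at RD3_pr0 rev_cmp_at rev_pairing_at del: pairing_cmp\<close>)
  show "linear (\<pi>\<^sub>1 X Y)"
    by (rule linearI [of _ "X \<odot> Y" Y])
      (use assms in \<open>simp_all add: diff_at RD3_pr1 rev_cmp_at rev_pairing_at\<close>)
qed

lemma linear_cmp [simp]: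
  assumes "linear f" "linear g" "tgt f = src g"
  shows "linear (g \<cdot> f)"
  by (rule linearI [of _ "src f" "tgt g"])
    (use assms in \<open>simp_all add: diff_cmp_at [of _ _ "src g"] linear_diff_at\<close>)

text \<open>The projections are linear, so by the chain rule the components of \<open>D[\<langle>f, g\<rangle>]\<close> are the derivatives
  of the components.\<close>

lemma linear_pairing [simp]:
  assumes "linear f" "linear g" "src f = src g"
  shows "linear \<langle>f, g\<rangle>"
proof -
  define X where "X = src g"
  define A where "A = tgt f"
  define B where "B = tgt g"
  have t [simp]: "src f = X" "src g = X" "tgt f = A" "tgt g = B" "arr f" "arr g"
    using assms by (simp_all add: X_def A_def B_def)
  have o [simp]: "X \<in> obj C" "A \<in> obj C" "B \<in> obj C"
    using src_obj [of g] tgt_obj [of f] tgt_obj [of g] by simp_all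
  show ?thesis
  proof (rule linearI [of _ X "A \<odot> B"])
    fix a b
    assume ab [simp]: "arr a" "arr b" "src a = src b" "tgt a = X" "tgt b = X"
    let ?d = "\<D> X (A \<odot> B) \<langle>f, g\<rangle> \<cdot> \<langle>a, b\<rangle>"
    have "\<pi>\<^sub>0 A B \<cdot> ?d = \<D> (A \<odot> B) A (\<pi>\<^sub>0 A B) \<cdot> \<langle>\<langle>f, g\<rangle> \<cdot> a, ?d\<rangle>"
      by (rule linear_diff_at [symmetric]) simp_all
    also have "\<dots> = \<D> X A (\<pi>\<^sub>0 A B \<cdot> \<langle>f, g\<rangle>) \<cdot> \<langle>a, b\<rangle>"
      by (rule diff_cmp_at [symmetric]) simp_all
    also have "\<dots> = f \<cdot> b"
      using assms(1) by (simp add: linear_diff_at)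
    finally have 0: "\<pi>\<^sub>0 A B \<cdot> ?d = f \<cdot> b" .
    have "\<pi>\<^sub>1 A B \<cdot> ?d = \<D> (A \<odot> B) B (\<pi>\<^sub>1 A B) \<cdot> \<langle>\<langle>f, g\<rangle> \<cdot> a, ?d\<rangle>"
      by (rule linear_diff_at [symmetric]) simp_all
    also have "\<dots> = \<D> X B (\<pi>\<^sub>1 A B \<cdot> \<langle>f, g\<rangle>) \<cdot> \<langle>a, b\<rangle>"
      by (rule diff_cmp_at [symmetric]) simp_all
    also have "\<dots> = g \<cdot> b"
      using assms(2) by (simp add: linear_diff_at)
    finally have 1: "\<pi>\<^sub>1 A B \<cdot> ?d = g \<cdot> b" .
    show "?d = \<langle>f, g\<rangle> \<cdot> b"
      by (rule prod_ext [of _ _ A B]; (simp add: 0 1)?)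
  qed simp_all
qed

text \<open>\<open>f 0 = D[f](0, 0)\<close>, and \<open>D[f]\<close> vanishes when its second argument does, by RD.2.\<close>

lemma linear_zer [simp]:
  assumes "linear f" "src f = X" "Z \<in> obj C"
  shows "f \<cdot> \<zero> Z X = \<zero> Z (tgt f)"
proof -
  have o: "X \<in> obj C" using assms by auto
  have "f \<cdot> \<zero> Z X = \<D> X (tgt f) f \<cdot> \<langle>\<zero> Z X, \<zero> Z X\<rangle>"
    using assms o by (simp add: linear_diff_at)
  also have "\<dots> = \<zero> Z (tgt f)"
    using assms o by (simp add: diff_at)
  finally show ?thesis .
qed

end

sublocale cartesian_reverse_derivative_category \<subseteq> L: category "Lin C"
  by standard (auto simp: Lin_hom_iff)

section \<open>Pulling systems back along linear maps\<close>

context cartesian_reverse_derivative_category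
begin

lemma dag_typed [simp]:
  assumes "arr f" "src f = X" "tgt f = Y"
  shows "arr (dag C X Y f)" "src (dag C X Y f) = Y" "tgt (dag C X Y f) = X"
  using assms by (auto simp: dag_def)

lemma dag_at:
  assumes "arr f" "src f = X" "tgt f = Y" "arr a" "tgt a = Y"
  shows "dag C X Y f \<cdot> a = \<R> f \<cdot> \<langle>\<zero> (src a) X, a\<rangle>"
  using assms by (auto simp: dag_def)

definition pull :: "'m \<Rightarrow> 'm \<Rightarrow> 'm" where
  "pull f v = Dar C (src f) (tgt f) f v"

text \<open>The dagger satisfies \<open>f\<^sup>\<dagger> \<circ> a = R[f] \<circ> \<langle>0, a\<rangle>\<close>, so the rules for \<open>pull\<close> are instances of the axioms
  for \<open>R\<close>; in particular RD.2 makes it additive in the system.\<close>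

lemma pull_eq_rev:
  assumes "arr f" "arr v" "src v = tgt f" "tgt v = tgt f"
  shows "pull f v = \<R> f \<cdot> \<langle>\<zero> (src f) (src f), v \<cdot> f\<rangle>"
  using assms by (simp add: pull_def Dar_def dag_at)

lemma pull_typed [simp]:
  assumes "arr f" "arr v" "src v = tgt f" "tgt v = tgt f"
  shows "arr (pull f v)" "src (pull f v) = src f" "tgt (pull f v) = src f"
  using assms by (simp_all add: pull_eq_rev)

lemma pull_ident [simp]:
  assumes "arr v" "src v = X" "tgt v = X"
  shows "pull (\<iota> X) v = v"
proof -
  have "X \<in> obj C" using assms by auto
  then show ?thesis using assms by (simp add: pull_eq_rev)
qed

lemma pull_add [simp]:
  assumes "arr f" "arr v" "arr w" "src v = tgt f" "tgt v = tgt f" "src w = tgt f" "tgt w = tgt f"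
  shows "pull f (v \<boxplus> w) = pull f v \<boxplus> pull f w"
  using assms by (simp add: pull_eq_rev rev_add_at)

lemma pull_zer [simp]: "arr f \<Longrightarrow> tgt f = Y \<Longrightarrow> pull f (\<zero> Y Y) = \<zero> (src f) (src f)"
  by (auto simp: pull_eq_rev)

text \<open>RD.5 gives \<open>(g \<circ> f)\<^sup>\<dagger> \<circ> x = R[f] \<circ> \<langle>0, R[g] \<circ> \<langle>f 0, x\<rangle>\<rangle>\<close>, which is \<open>f\<^sup>\<dagger> \<circ> g\<^sup>\<dagger> \<circ> x\<close> because \<open>f 0 = 0\<close> for
  linear \<open>f\<close>.\<close>

lemma pull_pull [simp]:
  assumes "linear f" "arr g" "tgt f = src g" "arr v" "src v = tgt g" "tgt v = tgt g"
  shows "pull f (pull g v) = pull (g \<cdot> f) v"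
proof -
  have "pull (g \<cdot> f) v = \<R> f \<cdot> \<langle>\<zero> (src f) (src f), \<R> g \<cdot> \<langle>\<zero> (src f) (src g), v \<cdot> (g \<cdot> f)\<rangle>\<rangle>"
    using assms by (simp add: pull_eq_rev rev_cmp_at)
  also have "\<dots> = pull f (pull g v)"
    using assms by (simp add: pull_eq_rev)
  finally show ?thesis by simp
qed

lemma Dlax_eq:
  "X \<in> obj C \<Longrightarrow> Y \<in> obj C \<Longrightarrow> Dlax C X Y v w = pull (\<pi>\<^sub>0 X Y) v \<boxplus> pull (\<pi>\<^sub>1 X Y) w"
  by (simp add: Dlax_def pull_def Dar_def)

text \<open>The only element of \<open>C(\<star>, \<star>)\<close> is its zero, which \<open>D(!)\<close> preserves.\<close>

lemma id_dec_eq: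
  assumes "N \<in> obj C"
  shows "id_dec C N = \<zero> N N"
proof -
  have "hom C \<star> \<star> = {\<zero> \<star> \<star>}"
    using bang_unique_typed zer_one [of \<star>] by (fastforce simp: hom_iff)
  then have "Dunit C = \<zero> \<star> \<star>"
    by (simp add: Dunit_def Dob_def)
  moreover have "pull (! N) (\<zero> \<star> \<star>) = \<zero> N N"
    using assms by simp
  ultimately show ?thesis
    using assms by (simp add: id_dec_def pull_def del: pull_zer)
qed

section \<open>Isomorphism classes of open dynamical systems\<close>

definition lin_inverse :: "'m \<Rightarrow> 'm \<Rightarrow> bool" where
  "lin_inverse n m \<longleftrightarrow> linear n \<and> linear m \<and> src m = tgt n \<and> tgt m = src n \<and>
     m \<cdot> n = \<iota> (src n) \<and> n \<cdot> m = \<iota> (src m)"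

lemma is_iso_Lin: "is_iso (Lin C) X Y n \<longleftrightarrow> src n = X \<and> tgt n = Y \<and> (\<exists>m. lin_inverse n m)"
  by (auto simp: is_iso_def is_inverse_def Lin_hom_iff lin_inverse_def)

text \<open>The conditions on \<open>l\<close>, \<open>r\<close>, \<open>v\<close> to be the legs and the system of an open dynamical system, whose
  apex is then the domain of \<open>l\<close>.\<close>

definition open_system :: "'m \<Rightarrow> 'm \<Rightarrow> 'm \<Rightarrow> bool" where
  "open_system l r v \<longleftrightarrow> linear l \<and> linear r \<and> src r = src l \<and> arr v \<and> src v = src l \<and> tgt v = src l"

lemma ods_set_iff:
  "s \<in> ods_set C X Y \<longleftrightarrow> open_system (lleg s) (rleg s) (syst s) \<and> apex s = src (lleg s) \<and>
     tgt (lleg s) = X \<and> tgt (rleg s) = Y"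
  by (auto simp: ods_set_def Lin_hom_iff Dob_def open_system_def hom_iff)

lemma ods_setD:
  assumes "s \<in> ods_set C X Y"
  shows "linear (lleg s)" "src (lleg s) = apex s" "tgt (lleg s) = X"
    "linear (rleg s)" "src (rleg s) = apex s" "tgt (rleg s) = Y"
    "arr (syst s)" "src (syst s) = apex s" "tgt (syst s) = apex s"
    "apex s \<in> obj C" "X \<in> obj C" "Y \<in> obj C"
  using assms by (auto simp: ods_set_iff open_system_def)

lemma ods_iso_iff:
  "(s, t) \<in> ods_iso C X Y \<longleftrightarrow> s \<in> ods_set C X Y \<and> t \<in> ods_set C X Y \<and>
     (\<exists>n m. lin_inverse n m \<and> src n = apex s \<and> tgt n = apex t \<and>
       lleg t \<cdot> n = lleg s \<and> rleg t \<cdot> n = rleg s \<and> pull n (syst t) = syst s)"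
  by (auto simp: ods_iso_def is_iso_Lin pull_def)

lemma lin_inverse_sym: "lin_inverse n m \<Longrightarrow> lin_inverse m n"
  by (auto simp: lin_inverse_def)

lemma lin_inverse_cancel:
  assumes "lin_inverse n m" "arr x"
  shows "tgt x = src n \<Longrightarrow> m \<cdot> (n \<cdot> x) = x" "tgt x = tgt n \<Longrightarrow> n \<cdot> (m \<cdot> x) = x"
proof -
  have n: "arr n" "arr m" "src m = tgt n" "tgt m = src n" "m \<cdot> n = \<iota> (src n)" "n \<cdot> m = \<iota> (src m)"
    using assms by (simp_all add: lin_inverse_def)
  show "m \<cdot> (n \<cdot> x) = x" if "tgt x = src n"
    using cmp_assoc [of x "src x" "src n" n "tgt n" m "src n"] that n assms(2) by (simp add: hom_iff)
  show "n \<cdot> (m \<cdot> x) = x" if "tgt x = tgt n"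
    using cmp_assoc [of x "src x" "tgt n" m "src n" n "tgt n"] that n assms(2) by (simp add: hom_iff)
qed

lemma lin_inverse_transpose:
  "lin_inverse n m \<Longrightarrow> f \<cdot> n = g \<Longrightarrow> arr f \<Longrightarrow> src f = tgt n \<Longrightarrow> g \<cdot> m = f"
  by (auto simp: lin_inverse_def)

lemma lin_inverse_cmp:
  assumes "lin_inverse n n'" "lin_inverse m m'" "tgt n = src m"
  shows "lin_inverse (m \<cdot> n) (n' \<cdot> m')"
  using assms lin_inverse_cancel(1) [OF assms(2), of n] lin_inverse_cancel(2) [OF assms(1), of m']
  by (simp add: lin_inverse_def)

lemma ods_isoI:
  assumes "s \<in> ods_set C X Y" "t \<in> ods_set C X Y" "lin_inverse n m" "src n = apex s" "tgt n = apex t"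
    "lleg t \<cdot> n = lleg s" "rleg t \<cdot> n = rleg s" "pull n (syst t) = syst s"
  shows "(s, t) \<in> ods_iso C X Y"
  using assms unfolding ods_iso_iff by blast

lemma ods_iso_equiv: "equiv (ods_set C X Y) (ods_iso C X Y)"
proof (rule equivI)
  show "ods_iso C X Y \<subseteq> ods_set C X Y \<times> ods_set C X Y"
    by (auto simp: ods_iso_iff)
  show "refl_on (ods_set C X Y) (ods_iso C X Y)"
  proof (rule refl_onI)
    fix s assume s: "s \<in> ods_set C X Y"
    then have "lin_inverse (\<iota> (apex s)) (\<iota> (apex s))"
      by (simp add: ods_set_iff open_system_def lin_inverse_def)
    then show "(s, s) \<in> ods_iso C X Y"
      using s unfolding ods_iso_iff
      by (intro conjI exI [of _ "\<iota> (apex s)"]) (auto simp: ods_set_iff open_system_def)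
  qed
  show "sym (ods_iso C X Y)"
  proof (rule symI)
    fix s t assume st: "(s, t) \<in> ods_iso C X Y"
    then obtain n m where n: "lin_inverse n m" "src n = apex s" "tgt n = apex t"
      "lleg t \<cdot> n = lleg s" "rleg t \<cdot> n = rleg s" "pull n (syst t) = syst s"
      by (auto simp: ods_iso_iff)
    have t: "open_system (lleg t) (rleg t) (syst t)" "apex t = src (lleg t)"
      using st by (auto simp: ods_iso_iff ods_set_iff)
    have "lleg s \<cdot> m = lleg t" "rleg s \<cdot> m = rleg t" "pull m (syst s) = syst t"
      using n(1,2,3) t unfolding n(4-6) [symmetric]
      by (simp_all add: lin_inverse_def open_system_def)
    moreover have "lin_inverse m n" "src m = apex t" "tgt m = apex s"
      using n by (auto simp: lin_inverse_def)
    ultimately show "(t, s) \<in> ods_iso C X Y"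
      using st by (auto simp: ods_iso_iff)
  qed
  show "trans (ods_iso C X Y)"
  proof (rule transI)
    fix s t u assume st: "(s, t) \<in> ods_iso C X Y" and tu: "(t, u) \<in> ods_iso C X Y"
    obtain n n' where n: "lin_inverse n n'" "src n = apex s" "tgt n = apex t"
      "lleg t \<cdot> n = lleg s" "rleg t \<cdot> n = rleg s" "pull n (syst t) = syst s"
      using st by (auto simp: ods_iso_iff)
    obtain m m' where m: "lin_inverse m m'" "src m = apex t" "tgt m = apex u"
      "lleg u \<cdot> m = lleg t" "rleg u \<cdot> m = rleg t" "pull m (syst u) = syst t"
      using tu by (auto simp: ods_iso_iff)
    have u: "open_system (lleg u) (rleg u) (syst u)" "apex u = src (lleg u)"
      using tu by (auto simp: ods_iso_iff ods_set_iff)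
    have "lleg u \<cdot> (m \<cdot> n) = lleg s" "rleg u \<cdot> (m \<cdot> n) = rleg s" "pull (m \<cdot> n) (syst u) = syst s"
      using n(1,2,3) m(1,2,3) u unfolding n(4-6) [symmetric] m(4-6) [symmetric]
      by (simp_all add: lin_inverse_def open_system_def)
    moreover have "lin_inverse (m \<cdot> n) (n' \<cdot> m')"
      using n m by (rule_tac lin_inverse_cmp) auto
    moreover have "src (m \<cdot> n) = apex s" "tgt (m \<cdot> n) = apex u"
      using n m by (simp_all add: lin_inverse_def)
    ultimately show "(s, u) \<in> ods_iso C X Y"
      using st tu by (auto simp: ods_iso_iff)
  qed
qed

lemma ods_class_eqI: "(s, t) \<in> ods_iso C X Y \<Longrightarrow> ods_class C X Y s = ods_class C X Y t"
  unfolding ods_class_def by (rule equiv_class_eq [OF ods_iso_equiv])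

text \<open>The legs determine apex and boundaries, so isomorphism classes can be handled as functions of the two
  legs and the system.\<close>

definition span_class :: "'m \<Rightarrow> 'm \<Rightarrow> 'm \<Rightarrow> ('o, 'm) ods set" where
  "span_class l r v =
     ods_class C (tgt l) (tgt r) \<lparr>apex = src l, lleg = l, rleg = r, syst = v\<rparr>"

lemma ods_class_eq:
  assumes "s \<in> ods_set C X Y"
  shows "ods_class C X Y s = span_class (lleg s) (rleg s) (syst s)"
  using assms by (cases s) (auto simp: span_class_def ods_set_iff)

lemma span_class_eqI:
  assumes "open_system l r v" "lin_inverse n m" "tgt n = src l"
    and "l \<cdot> n = l'" "r \<cdot> n = r'" "pull n v = v'"
  shows "span_class l' r' v' = span_class l r v"
proof -
  have "(\<lparr>apex = src l', lleg = l', rleg = r', syst = v'\<rparr>, \<lparr>apex = src l, lleg = l, rleg = r, syst = v\<rparr>)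
    \<in> ods_iso C (tgt l) (tgt r)"
    using assms by (intro ods_isoI [of _ _ _ _ n m]) (auto simp: ods_set_iff open_system_def lin_inverse_def)
  moreover have "tgt l' = tgt l" "tgt r' = tgt r"
    using assms by (auto simp: open_system_def lin_inverse_def)
  ultimately show ?thesis
    unfolding span_class_def by (simp add: ods_class_eqI)
qed

lemma Dynam_hom_iff:
  "F \<in> hom (Dynam C) X Y \<longleftrightarrow>
     (\<exists>l r v. F = span_class l r v \<and> open_system l r v \<and> tgt l = X \<and> tgt r = Y)"
proof
  assume "F \<in> hom (Dynam C) X Y"
  then obtain s where "s \<in> ods_set C X Y" "F = ods_class C X Y s"
    by (auto simp: Dynam_def quotient_def ods_class_def)
  then show "\<exists>l r v. F = span_class l r v \<and> open_system l r v \<and> tgt l = X \<and> tgt r = Y"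
    using ods_class_eq by (auto simp: ods_set_iff)
next
  assume "\<exists>l r v. F = span_class l r v \<and> open_system l r v \<and> tgt l = X \<and> tgt r = Y"
  then show "F \<in> hom (Dynam C) X Y"
    by (auto simp: Dynam_def span_class_def ods_class_def ods_set_iff intro!: quotientI)
qed

lemma mem_ods_class:
  assumes "s \<in> ods_class C X Y t"
  shows "(t, s) \<in> ods_iso C X Y" "s \<in> ods_set C X Y"
  using assms by (auto simp: ods_class_def ods_iso_iff)

lemma self_mem_ods_class: "s \<in> ods_set C X Y \<Longrightarrow> s \<in> ods_class C X Y s"
  using ods_iso_equiv by (auto simp: ods_class_def equiv_def refl_on_def)

lemma ods_set_unique: "s \<in> ods_set C X Y \<Longrightarrow> s \<in> ods_set C X' Y' \<Longrightarrow> X' = X \<and> Y' = Y"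
  by (auto simp: ods_set_iff)

section \<open>Composition and monoidal product of classes\<close>

text \<open>\<open>\<pi>\<^sub>i \<circ> \<langle>b0, b1\<rangle> = b\<^sub>i\<close>, so functoriality and additivity of \<open>pull\<close> turn the system
  \<open>D(\<langle>b0, b1\<rangle>)(\<phi>(v, w))\<close> into \<open>b0\<^sup>* v + b1\<^sup>* w\<close>.\<close>

lemma ods_comp_eq:
  assumes "s \<in> ods_set C X Y" "t \<in> ods_set C Y Z"
    and "is_pullback (Lin C) (apex s) Y (apex t) (rleg s) (lleg t) P b0 b1"
  shows "ods_comp C s t P b0 b1 = \<lparr>apex = P, lleg = lleg s \<cdot> b0, rleg = rleg t \<cdot> b1,
    syst = pull b0 (syst s) \<boxplus> pull b1 (syst t)\<rparr>"
proof -
  note b = L.pullback_typed [OF assms(3), unfolded Lin_hom_iff Lin_simps]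
  have "Dar C P (apex s \<odot> apex t) \<langle>b0, b1\<rangle> (Dlax C (apex s) (apex t) (syst s) (syst t)) =
      pull \<langle>b0, b1\<rangle> (Dlax C (apex s) (apex t) (syst s) (syst t))"
    using b by (simp add: pull_def)
  also have "\<dots> = pull b0 (syst s) \<boxplus> pull b1 (syst t)"
    using ods_setD [OF assms(1)] ods_setD [OF assms(2)] b by (simp add: Dlax_eq)
  finally show ?thesis by (simp add: ods_comp_def)
qed

lemma ods_comp_in_ods_set:
  assumes "s \<in> ods_set C X Y" "t \<in> ods_set C Y Z"
    and "is_pullback (Lin C) (apex s) Y (apex t) (rleg s) (lleg t) P b0 b1"
  shows "ods_comp C s t P b0 b1 \<in> ods_set C X Z"
  using ods_setD [OF assms(1)] ods_setD [OF assms(2)]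
    L.pullback_typed [OF assms(3), unfolded Lin_hom_iff Lin_simps]
  by (simp add: ods_comp_eq [OF assms] ods_set_iff open_system_def)

text \<open>Conjugating with the isomorphisms \<open>n\<close> and \<open>m\<close> of the two factors makes each pullback a cone over
  the cospan of the other. The induced maps \<open>u\<close> and \<open>w\<close> are mutually inverse, and \<open>u\<close> is an
  isomorphism of the composites.\<close>

lemma ods_comp_iso:
  assumes ss: "(s, s') \<in> ods_iso C X Y" and tt: "(t, t') \<in> ods_iso C Y Z"
    and pb: "is_pullback (Lin C) (apex s) Y (apex t) (rleg s) (lleg t) P b0 b1"
    and pb': "is_pullback (Lin C) (apex s') Y (apex t') (rleg s') (lleg t') P' b0' b1'"
  shows "(ods_comp C s t P b0 b1, ods_comp C s' t' P' b0' b1') \<in> ods_iso C X Z"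
proof -
  have in_set: "s \<in> ods_set C X Y" "s' \<in> ods_set C X Y" "t \<in> ods_set C Y Z" "t' \<in> ods_set C Y Z"
    using ss tt by (auto simp: ods_iso_iff)
  obtain n n' where n: "lin_inverse n n'" "src n = apex s" "tgt n = apex s'"
    "lleg s' \<cdot> n = lleg s" "rleg s' \<cdot> n = rleg s" "pull n (syst s') = syst s"
    using ss by (auto simp: ods_iso_iff)
  obtain m m' where m: "lin_inverse m m'" "src m = apex t" "tgt m = apex t'"
    "lleg t' \<cdot> m = lleg t" "rleg t' \<cdot> m = rleg t" "pull m (syst t') = syst t"
    using tt by (auto simp: ods_iso_iff)
  note ty = ods_setD [OF in_set(1)] ods_setD [OF in_set(2)] ods_setD [OF in_set(3)] ods_setD [OF in_set(4)]
  note b = L.pullback_typed [OF pb, unfolded Lin_hom_iff Lin_simps]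
  note b' = L.pullback_typed [OF pb', unfolded Lin_hom_iff Lin_simps]
  have nm: "linear n" "linear n'" "linear m" "linear m'" "src n' = apex s'" "tgt n' = apex s"
    "src m' = apex t'" "tgt m' = apex t" "n' \<cdot> n = \<iota> (apex s)" "n \<cdot> n' = \<iota> (apex s')"
    "m' \<cdot> m = \<iota> (apex t)" "m \<cdot> m' = \<iota> (apex t')"
    using n(1-3) m(1-3) by (auto simp: lin_inverse_def)
  have legs: "rleg s \<cdot> n' = rleg s'" "lleg t \<cdot> m' = lleg t'"
    using lin_inverse_transpose [OF n(1) n(5)] lin_inverse_transpose [OF m(1) m(4)] ty n(3) m(3)
    by simp_all
  note types = b(1-4) b'(1-4) n(2,3) m(2,3) nm(1-8)
  have "rleg s' \<cdot> (n \<cdot> b0) = lleg t' \<cdot> (m \<cdot> b1)"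
    using cmp_assoc_typed [of b0 n "rleg s'"] cmp_assoc_typed [of b1 m "lleg t'"] types b(5) n(5) m(4)
    by (simp del: cmp_assoc_typed)
  moreover have "n \<cdot> b0 \<in> hom (Lin C) P (apex s')" "m \<cdot> b1 \<in> hom (Lin C) P (apex t')"
    using types by (simp_all add: Lin_hom_iff)
  ultimately obtain u where u: "linear u" "src u = P" "tgt u = P'" "b0' \<cdot> u = n \<cdot> b0" "b1' \<cdot> u = m \<cdot> b1"
    using L.pullback_lift [OF pb'] unfolding Lin_hom_iff Lin_simps by metis
  have "rleg s \<cdot> (n' \<cdot> b0') = lleg t \<cdot> (m' \<cdot> b1')"
    using cmp_assoc_typed [of b0' n' "rleg s"] cmp_assoc_typed [of b1' m' "lleg t"] types b'(5) legs
    by (simp del: cmp_assoc_typed)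
  moreover have "n' \<cdot> b0' \<in> hom (Lin C) P' (apex s)" "m' \<cdot> b1' \<in> hom (Lin C) P' (apex t)"
    using types by (simp_all add: Lin_hom_iff)
  ultimately obtain w where w: "linear w" "src w = P'" "tgt w = P" "b0 \<cdot> w = n' \<cdot> b0'" "b1 \<cdot> w = m' \<cdot> b1'"
    using L.pullback_lift [OF pb] unfolding Lin_hom_iff Lin_simps by metis
  note bt = b(3,4) b'(3,4) w(1-3) u(1-3) n(2,3) m(2,3) nm(1-8)
  have P: "P \<in> obj C" "P' \<in> obj C"
    using src_obj [of u] src_obj [of w] u w by simp_all
  have "b0 \<cdot> (w \<cdot> u) = n' \<cdot> (b0' \<cdot> u)" "b1 \<cdot> (w \<cdot> u) = m' \<cdot> (b1' \<cdot> u)"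
    using cmp_cong_right [OF w(4)] cmp_cong_right [OF w(5)] bt by simp_all
  then have "b0 \<cdot> (w \<cdot> u) = b0" "b1 \<cdot> (w \<cdot> u) = b1"
    using lin_inverse_cancel(1) [OF n(1)] lin_inverse_cancel(1) [OF m(1)] bt by (simp_all add: u(4,5))
  then have "w \<cdot> u = \<iota> P"
    using L.pullback_cancel [OF pb, of "w \<cdot> u" P "\<iota> P"] bt P by (simp add: Lin_hom_iff)
  moreover have "b0' \<cdot> (u \<cdot> w) = n \<cdot> (b0 \<cdot> w)" "b1' \<cdot> (u \<cdot> w) = m \<cdot> (b1 \<cdot> w)"
    using cmp_cong_right [OF u(4)] cmp_cong_right [OF u(5)] bt by simp_all
  then have "b0' \<cdot> (u \<cdot> w) = b0'" "b1' \<cdot> (u \<cdot> w) = b1'"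
    using lin_inverse_cancel(2) [OF n(1)] lin_inverse_cancel(2) [OF m(1)] bt by (simp_all add: w(4,5))
  then have "u \<cdot> w = \<iota> P'"
    using L.pullback_cancel [OF pb', of "u \<cdot> w" P' "\<iota> P'"] bt P by (simp add: Lin_hom_iff)
  ultimately have "lin_inverse u w"
    using u w by (simp add: lin_inverse_def)
  then show ?thesis
  proof (rule ods_isoI [rotated 2])
    show "ods_comp C s t P b0 b1 \<in> ods_set C X Z" "ods_comp C s' t' P' b0' b1' \<in> ods_set C X Z"
      using ods_comp_in_ods_set in_set pb pb' by blast+
    note eqs = ods_comp_eq [OF in_set(1,3) pb] ods_comp_eq [OF in_set(2,4) pb']
    show "src u = apex (ods_comp C s t P b0 b1)" "tgt u = apex (ods_comp C s' t' P' b0' b1')"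
      using u by (simp_all add: eqs)
    show "lleg (ods_comp C s' t' P' b0' b1') \<cdot> u = lleg (ods_comp C s t P b0 b1)"
      using u b b' ty nm n(2,3) by (simp add: eqs flip: n(4))
    show "rleg (ods_comp C s' t' P' b0' b1') \<cdot> u = rleg (ods_comp C s t P b0 b1)"
      using u b b' ty nm m(2,3) by (simp add: eqs flip: m(5))
    show "pull u (syst (ods_comp C s' t' P' b0' b1')) = syst (ods_comp C s t P b0 b1)"
      using u b b' ty nm n(2,3) m(2,3) by (simp add: eqs flip: n(6) m(6))
  qed
qed

text \<open>Composition of classes ranges over all representatives and all pullbacks. The representatives fix the
  boundary objects, and by the previous lemma all resulting composites are isomorphic.\<close>

lemma class_comp_eq:
  assumes s: "s \<in> ods_set C X Y" and t: "t \<in> ods_set C Y Z"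
    and pb: "is_pullback (Lin C) (apex s) Y (apex t) (rleg s) (lleg t) P b0 b1"
  shows "class_comp C (ods_class C Y Z t) (ods_class C X Y s) = ods_class C X Z (ods_comp C s t P b0 b1)"
proof (intro equalityI subsetI)
  fix u assume "u \<in> ods_class C X Z (ods_comp C s t P b0 b1)"
  then show "u \<in> class_comp C (ods_class C Y Z t) (ods_class C X Y s)"
    unfolding class_comp_def using self_mem_ods_class s t pb by blast
next
  fix u assume "u \<in> class_comp C (ods_class C Y Z t) (ods_class C X Y s)"
  then obtain X' Y' Z' s' t' P' b0' b1' where u: "s' \<in> ods_class C X Y s" "t' \<in> ods_class C Y Z t"
    "s' \<in> ods_set C X' Y'" "t' \<in> ods_set C Y' Z'"
    "is_pullback (Lin C) (apex s') Y' (apex t') (rleg s') (lleg t') P' b0' b1'"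
    "u \<in> ods_class C X' Z' (ods_comp C s' t' P' b0' b1')"
    unfolding class_comp_def by blast
  then have [simp]: "X' = X" "Y' = Y" "Z' = Z"
    using mem_ods_class(2) ods_set_unique by blast+
  have "(ods_comp C s t P b0 b1, ods_comp C s' t' P' b0' b1') \<in> ods_iso C X Z"
    using u pb mem_ods_class(1) by (intro ods_comp_iso) auto
  then show "u \<in> ods_class C X Z (ods_comp C s t P b0 b1)"
    using u(6) ods_class_eqI by simp
qed

lemma linear_pmap [simp]:
  "linear f \<Longrightarrow> linear g \<Longrightarrow> src f = X \<Longrightarrow> src g = Y \<Longrightarrow> linear (pmap C X Y f g)"
  by (auto simp: pmap_def)

lemma lin_inverse_pmap:
  assumes "lin_inverse n n'" "lin_inverse m m'"
  shows "lin_inverse (pmap C (src n) (src m) n m) (pmap C (src n') (src m') n' m')"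
  using assms by (simp add: lin_inverse_def)

lemma ods_tensor_eq:
  assumes "s \<in> ods_set C X Y" "t \<in> ods_set C W Z"
  shows "ods_tensor C s t = \<lparr>apex = apex s \<odot> apex t,
    lleg = pmap C (apex s) (apex t) (lleg s) (lleg t), rleg = pmap C (apex s) (apex t) (rleg s) (rleg t),
    syst = pull (\<pi>\<^sub>0 (apex s) (apex t)) (syst s) \<boxplus> pull (\<pi>\<^sub>1 (apex s) (apex t)) (syst t)\<rparr>"
  using ods_setD [OF assms(1)] ods_setD [OF assms(2)] by (simp add: ods_tensor_def Dlax_eq)

lemma ods_tensor_in_ods_set:
  assumes "s \<in> ods_set C X Y" "t \<in> ods_set C W Z"
  shows "ods_tensor C s t \<in> ods_set C (X \<odot> W) (Y \<odot> Z)"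
  using ods_setD [OF assms(1)] ods_setD [OF assms(2)]
  by (simp add: ods_tensor_eq [OF assms] ods_set_iff open_system_def)

lemma ods_tensor_iso:
  assumes ss: "(s, s') \<in> ods_iso C X Y" and tt: "(t, t') \<in> ods_iso C W Z"
  shows "(ods_tensor C s t, ods_tensor C s' t') \<in> ods_iso C (X \<odot> W) (Y \<odot> Z)"
proof -
  have in_set: "s \<in> ods_set C X Y" "s' \<in> ods_set C X Y" "t \<in> ods_set C W Z" "t' \<in> ods_set C W Z"
    using ss tt by (auto simp: ods_iso_iff)
  obtain n n' where n: "lin_inverse n n'" "src n = apex s" "tgt n = apex s'"
    "lleg s' \<cdot> n = lleg s" "rleg s' \<cdot> n = rleg s" "pull n (syst s') = syst s"
    using ss by (auto simp: ods_iso_iff)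
  obtain m m' where m: "lin_inverse m m'" "src m = apex t" "tgt m = apex t'"
    "lleg t' \<cdot> m = lleg t" "rleg t' \<cdot> m = rleg t" "pull m (syst t') = syst t"
    using tt by (auto simp: ods_iso_iff)
  have nm: "linear n" "linear m"
    using n m by (auto simp: lin_inverse_def)
  note ty = ods_setD [OF in_set(1)] ods_setD [OF in_set(2)] ods_setD [OF in_set(3)] ods_setD [OF in_set(4)]
  note eqs = ods_tensor_eq [OF in_set(1,3)] ods_tensor_eq [OF in_set(2,4)]
  show ?thesis
  proof (rule ods_isoI)
    show "lin_inverse (pmap C (apex s) (apex t) n m) (pmap C (apex s') (apex t') n' m')"
      using lin_inverse_pmap [OF n(1) m(1)] n(1-3) m(1-3) by (auto simp: lin_inverse_def)
    show "lleg (ods_tensor C s' t') \<cdot> pmap C (apex s) (apex t) n m = lleg (ods_tensor C s t)"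
      using n(2,3) m(2,3) nm ty by (simp add: eqs flip: n(4) m(4))
    show "rleg (ods_tensor C s' t') \<cdot> pmap C (apex s) (apex t) n m = rleg (ods_tensor C s t)"
      using n(2,3) m(2,3) nm ty by (simp add: eqs flip: n(5) m(5))
    show "pull (pmap C (apex s) (apex t) n m) (syst (ods_tensor C s' t')) = syst (ods_tensor C s t)"
      using n(2,3) m(2,3) nm ty by (simp add: eqs flip: n(6) m(6))
    show "ods_tensor C s t \<in> ods_set C (X \<odot> W) (Y \<odot> Z)" "ods_tensor C s' t' \<in> ods_set C (X \<odot> W) (Y \<odot> Z)"
      using ods_tensor_in_ods_set in_set by blast+
    show "src (pmap C (apex s) (apex t) n m) = apex (ods_tensor C s t)"
      "tgt (pmap C (apex s) (apex t) n m) = apex (ods_tensor C s' t')"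
      using n(2,3) m(2,3) nm by (simp_all add: eqs)
  qed
qed

lemma class_tensor_eq:
  assumes s: "s \<in> ods_set C X Y" and t: "t \<in> ods_set C W Z"
  shows "class_tensor C (ods_class C X Y s) (ods_class C W Z t) =
    ods_class C (X \<odot> W) (Y \<odot> Z) (ods_tensor C s t)"
proof (intro equalityI subsetI)
  fix u assume "u \<in> ods_class C (X \<odot> W) (Y \<odot> Z) (ods_tensor C s t)"
  then show "u \<in> class_tensor C (ods_class C X Y s) (ods_class C W Z t)"
    unfolding class_tensor_def using self_mem_ods_class s t by blast
next
  fix u assume "u \<in> class_tensor C (ods_class C X Y s) (ods_class C W Z t)"
  then obtain X' Y' W' Z' s' t' where u: "s' \<in> ods_class C X Y s" "t' \<in> ods_class C W Z t"
    "s' \<in> ods_set C X' Y'" "t' \<in> ods_set C W' Z'"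
    "u \<in> ods_class C (X' \<odot> W') (Y' \<odot> Z') (ods_tensor C s' t')"
    unfolding class_tensor_def by blast
  then have [simp]: "X' = X" "Y' = Y" "W' = W" "Z' = Z"
    using mem_ods_class(2) ods_set_unique by blast+
  have "(ods_tensor C s t, ods_tensor C s' t') \<in> ods_iso C (X \<odot> W) (Y \<odot> Z)"
    using u mem_ods_class(1) by (intro ods_tensor_iso) auto
  then show "u \<in> ods_class C (X \<odot> W) (Y \<odot> Z) (ods_tensor C s t)"
    using u(5) ods_class_eqI by simp
qed

section \<open>Calculus of decorated spans\<close>

lemma open_systemD:
  assumes "open_system l r v"
  shows "linear l" "linear r" "src r = src l" "arr v" "src v = src l" "tgt v = src l" "src l \<in> obj C"
  using assms by (auto simp: open_system_def)

lemma open_system_ods_set: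
  "open_system l r v \<Longrightarrow> \<lparr>apex = src l, lleg = l, rleg = r, syst = v\<rparr> \<in> ods_set C (tgt l) (tgt r)"
  by (simp add: ods_set_iff)

lemma span_comp:
  assumes s: "open_system l r v" and t: "open_system l' r' w" and "tgt r = tgt l'"
    and pb: "is_pullback (Lin C) (src l) (tgt r) (src l') r l' P b0 b1"
  shows "class_comp C (span_class l' r' w) (span_class l r v) =
    span_class (l \<cdot> b0) (r' \<cdot> b1) (pull b0 v \<boxplus> pull b1 w)"
proof -
  let ?s = "\<lparr>apex = src l, lleg = l, rleg = r, syst = v\<rparr>"
  let ?t = "\<lparr>apex = src l', lleg = l', rleg = r', syst = w\<rparr>"
  have *: "?s \<in> ods_set C (tgt l) (tgt r)" "?t \<in> ods_set C (tgt r) (tgt r')"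
    using open_system_ods_set [OF s] open_system_ods_set [OF t] assms(3) by simp_all
  have pb': "is_pullback (Lin C) (apex ?s) (tgt r) (apex ?t) (rleg ?s) (lleg ?t) P b0 b1"
    using pb by simp
  have "class_comp C (span_class l' r' w) (span_class l r v) =
      ods_class C (tgt l) (tgt r') (ods_comp C ?s ?t P b0 b1)"
    using class_comp_eq [OF * pb'] assms(3) by (simp add: span_class_def)
  also have "\<dots> = span_class (l \<cdot> b0) (r' \<cdot> b1) (pull b0 v \<boxplus> pull b1 w)"
    by (subst ods_class_eq [OF ods_comp_in_ods_set [OF * pb']]) (simp add: ods_comp_eq [OF * pb'])
  finally show ?thesis .
qed

lemma open_system_comp:
  assumes "open_system l r v" "open_system l' r' w" "tgt r = tgt l'"
    and pb: "is_pullback (Lin C) (src l) (tgt r) (src l') r l' P b0 b1"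
  shows "open_system (l \<cdot> b0) (r' \<cdot> b1) (pull b0 v \<boxplus> pull b1 w)"
  using L.pullback_typed(3,4) [OF pb] assms(1,2) by (simp add: open_system_def Lin_hom_iff)

lemma span_tensor:
  assumes s: "open_system l r v" and t: "open_system l' r' w"
  shows "class_tensor C (span_class l r v) (span_class l' r' w) =
    span_class (pmap C (src l) (src l') l l') (pmap C (src l) (src l') r r')
      (pull (\<pi>\<^sub>0 (src l) (src l')) v \<boxplus> pull (\<pi>\<^sub>1 (src l) (src l')) w)"
proof -
  let ?s = "\<lparr>apex = src l, lleg = l, rleg = r, syst = v\<rparr>"
  let ?t = "\<lparr>apex = src l', lleg = l', rleg = r', syst = w\<rparr>"
  note * = open_system_ods_set [OF s] open_system_ods_set [OF t]
  have "class_tensor C (span_class l r v) (span_class l' r' w) =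
      ods_class C (tgt l \<odot> tgt l') (tgt r \<odot> tgt r') (ods_tensor C ?s ?t)"
    using class_tensor_eq [OF *] by (simp add: span_class_def)
  also have "\<dots> = span_class (pmap C (src l) (src l') l l') (pmap C (src l) (src l') r r')
      (pull (\<pi>\<^sub>0 (src l) (src l')) v \<boxplus> pull (\<pi>\<^sub>1 (src l) (src l')) w)"
    by (subst ods_class_eq [OF ods_tensor_in_ods_set [OF *]]) (simp add: ods_tensor_eq [OF *])
  finally show ?thesis .
qed

lemma open_system_tensor:
  assumes "open_system l r v" "open_system l' r' w"
  shows "open_system (pmap C (src l) (src l') l l') (pmap C (src l) (src l') r r')
    (pull (\<pi>\<^sub>0 (src l) (src l')) v \<boxplus> pull (\<pi>\<^sub>1 (src l) (src l')) w)"
  using open_systemD [OF assms(1)] open_systemD [OF assms(2)] by (simp add: open_system_def)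

text \<open>Covariant and contravariant embeddings of \<open>Lin(C)\<close> into the category of open dynamical systems.\<close>

definition graph :: "'m \<Rightarrow> ('o, 'm) ods set" where
  "graph f = span_class (\<iota> (src f)) f (\<zero> (src f) (src f))"

definition cograph :: "'m \<Rightarrow> ('o, 'm) ods set" where
  "cograph f = span_class f (\<iota> (src f)) (\<zero> (src f) (src f))"

lemma open_system_zer: "linear l \<Longrightarrow> linear r \<Longrightarrow> src r = src l \<Longrightarrow> src l = X \<Longrightarrow> open_system l r (\<zero> X X)"
  by (auto simp: open_system_def)

lemma open_system_graph:
  "linear f \<Longrightarrow> open_system (\<iota> (src f)) f (\<zero> (src f) (src f))"
  "linear f \<Longrightarrow> open_system f (\<iota> (src f)) (\<zero> (src f) (src f))"
  by (auto intro!: open_system_zer)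

lemma span_class_hom:
  "open_system l r v \<Longrightarrow> tgt l = X \<Longrightarrow> tgt r = Y \<Longrightarrow> span_class l r v \<in> hom (Dynam C) X Y"
  by (auto simp: Dynam_hom_iff)

lemma graph_hom: "linear f \<Longrightarrow> src f = X \<Longrightarrow> tgt f = Y \<Longrightarrow> graph f \<in> hom (Dynam C) X Y"
  unfolding graph_def by (rule span_class_hom) (auto intro!: open_system_graph)

lemma cograph_hom: "linear f \<Longrightarrow> src f = X \<Longrightarrow> tgt f = Y \<Longrightarrow> cograph f \<in> hom (Dynam C) Y X"
  unfolding cograph_def by (rule span_class_hom) (auto intro!: open_system_graph)

text \<open>The pullback of a map along an identity is the map itself; the summand \<open>r\<^sup>* 0\<close> of the system vanishes.\<close>

lemma graph_comp:
  assumes s: "open_system l r v" and g: "linear g" "src g = tgt r"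
  shows "class_comp C (graph g) (span_class l r v) = span_class l (g \<cdot> r) v"
proof -
  note t = open_systemD [OF s]
  have "is_pullback (Lin C) (src l) (tgt r) (src (\<iota> (src g))) r (\<iota> (src g)) (src l) (\<iota> (src l)) r"
    using L.pullback_ident [of r "src l" "tgt r"] t g by (simp add: Lin_hom_iff)
  from span_comp [OF s open_system_graph(1) [OF g(1)] _ this] show ?thesis
    using t g by (simp add: graph_def)
qed

lemma comp_cograph:
  assumes s: "open_system l r v" and g: "linear g" "src g = tgt l"
  shows "class_comp C (span_class l r v) (cograph g) = span_class (g \<cdot> l) r v"
proof -
  note t = open_systemD [OF s]
  have "is_pullback (Lin C) (src g) (tgt (\<iota> (src g))) (src l) (\<iota> (src g)) l (src l) l (\<iota> (src l))"
    using L.pullback_sym [OF L.pullback_ident [of l "src l" "tgt l"]] t g by (simp add: Lin_hom_iff)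
  from span_comp [OF open_system_graph(2) [OF g(1)] s _ this] show ?thesis
    using t g by (simp add: cograph_def)
qed

text \<open>The inverse \<open>g'\<close> is itself an isomorphism from the second span to the first.\<close>

lemma graph_eq_cograph:
  assumes "lin_inverse g g'"
  shows "graph g = cograph g'"
proof -
  have t: "linear g" "linear g'" "src g' = tgt g" "tgt g' = src g" "g \<cdot> g' = \<iota> (src g')"
    using assms by (simp_all add: lin_inverse_def)
  show ?thesis
    unfolding graph_def cograph_def
    by (rule span_class_eqI [OF open_system_graph(1) lin_inverse_sym [OF assms], symmetric])
      (use t in simp_all)
qed

lemma comp_graph_iso:
  assumes "open_system l r v" "lin_inverse g g'" "tgt g = tgt l"
  shows "class_comp C (span_class l r v) (graph g) = span_class (g' \<cdot> l) r v"
  using comp_cograph [OF assms(1), of g'] assms graph_eq_cograph [OF assms(2)]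
  by (simp add: lin_inverse_def)

lemma graph_graph:
  assumes "linear f" "linear g" "tgt f = src g"
  shows "class_comp C (graph g) (graph f) = graph (g \<cdot> f)"
  using graph_comp [OF open_system_graph(1) [OF assms(1)] assms(2)] assms by (simp add: graph_def)

lemma cograph_cograph:
  assumes "linear f" "linear g" "tgt f = src g"
  shows "class_comp C (cograph f) (cograph g) = cograph (g \<cdot> f)"
  using comp_cograph [OF open_system_graph(2) [OF assms(1)] assms(2)] assms by (simp add: cograph_def)

lemma graph_cograph:
  assumes "linear f" "linear g" "src f = src g"
  shows "class_comp C (graph g) (cograph f) = span_class f g (\<zero> (src g) (src g))"
  using graph_comp [OF open_system_graph(2) [OF assms(1)] assms(2)] assms by (simp add: cograph_def)

lemma cograph_graph:
  assumes pb: "is_pullback (Lin C) N Y M f g P b0 b1"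
  shows "class_comp C (cograph g) (graph f) = span_class b0 b1 (\<zero> P P)"
proof -
  note t = L.pullback_typed [OF pb, unfolded Lin_hom_iff]
  have "src f \<in> obj C" "P \<in> obj C" using t by auto
  moreover from this have "is_pullback (Lin C) (src (\<iota> (src f))) (tgt f) (src g) f g P b0 b1"
    using pb t by simp
  ultimately show ?thesis
    using span_comp [OF open_system_graph(1) [of f] open_system_graph(2) [of g], of P b0 b1] t
    by (simp add: graph_def cograph_def)
qed

lemma graph_tensor:
  assumes "linear f" "linear g"
  shows "class_tensor C (graph f) (graph g) = graph (pmap C (src f) (src g) f g)"
  using span_tensor [OF open_system_graph(1) [OF assms(1)] open_system_graph(1) [OF assms(2)]] assms
  by (simp add: graph_def)

lemma cograph_tensor:
  assumes "linear f" "linear g"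
  shows "class_tensor C (cograph f) (cograph g) = cograph (pmap C (src f) (src g) f g)"
  using span_tensor [OF open_system_graph(2) [OF assms(1)] open_system_graph(2) [OF assms(2)]] assms
  by (simp add: cograph_def)

lemma cograph_ident: "X \<in> obj C \<Longrightarrow> cograph (\<iota> X) = graph (\<iota> X)"
  by (simp add: graph_def cograph_def)

text \<open>Both universal properties are used coordinatewise.\<close>

lemma pullback_pmap:
  assumes pb: "is_pullback (Lin C) N Y M f g P b0 b1"
    and pb': "is_pullback (Lin C) N' Y' M' f' g' P' b0' b1'"
  shows "is_pullback (Lin C) (N \<odot> N') (Y \<odot> Y') (M \<odot> M') (pmap C N N' f f') (pmap C M M' g g')
    (P \<odot> P') (pmap C P P' b0 b0') (pmap C P P' b1 b1')"
proof -
  note pbt = L.pullback_typed [OF pb, unfolded Lin_hom_iff Lin_simps]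
    and pbt' = L.pullback_typed [OF pb', unfolded Lin_hom_iff Lin_simps]
  note t = pbt(1-4) pbt'(1-4)
  have o [simp]: "N \<in> obj C" "Y \<in> obj C" "M \<in> obj C" "P \<in> obj C"
    "N' \<in> obj C" "Y' \<in> obj C" "M' \<in> obj C" "P' \<in> obj C"
    using t src_obj tgt_obj linear_arr by metis+
  show ?thesis
  proof (rule L.pullbackI, unfold Lin_simps Lin_hom_iff)
    show "pmap C N N' f f' \<cdot> pmap C P P' b0 b0' = pmap C M M' g g' \<cdot> pmap C P P' b1 b1'"
      using t pbt(5) pbt'(5) by simp
  next
    fix Q c0 c1
    assume c: "linear c0 \<and> src c0 = Q \<and> tgt c0 = N \<odot> N'" "linear c1 \<and> src c1 = Q \<and> tgt c1 = M \<odot> M'"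
      "pmap C N N' f f' \<cdot> c0 = pmap C M M' g g' \<cdot> c1"
    have "f \<cdot> (\<pi>\<^sub>0 N N' \<cdot> c0) = \<pi>\<^sub>0 Y Y' \<cdot> (pmap C N N' f f' \<cdot> c0)"
      "f' \<cdot> (\<pi>\<^sub>1 N N' \<cdot> c0) = \<pi>\<^sub>1 Y Y' \<cdot> (pmap C N N' f f' \<cdot> c0)"
      using c(1) t by simp_all
    then have eq: "f \<cdot> (\<pi>\<^sub>0 N N' \<cdot> c0) = g \<cdot> (\<pi>\<^sub>0 M M' \<cdot> c1)" "f' \<cdot> (\<pi>\<^sub>1 N N' \<cdot> c0) = g' \<cdot> (\<pi>\<^sub>1 M M' \<cdot> c1)"
      unfolding c(3) using c(2) t by simp_all
    have h: "\<pi>\<^sub>0 N N' \<cdot> c0 \<in> hom (Lin C) Q N" "\<pi>\<^sub>1 N N' \<cdot> c0 \<in> hom (Lin C) Q N'"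
      "\<pi>\<^sub>0 M M' \<cdot> c1 \<in> hom (Lin C) Q M" "\<pi>\<^sub>1 M M' \<cdot> c1 \<in> hom (Lin C) Q M'"
      using c by (simp_all add: Lin_hom_iff)
    obtain u where u: "linear u" "src u = Q" "tgt u = P" "b0 \<cdot> u = \<pi>\<^sub>0 N N' \<cdot> c0" "b1 \<cdot> u = \<pi>\<^sub>0 M M' \<cdot> c1"
      using L.pullback_lift [OF pb h(1,3)] eq(1) by (auto simp: Lin_hom_iff)
    obtain u' where u': "linear u'" "src u' = Q" "tgt u' = P'" "b0' \<cdot> u' = \<pi>\<^sub>1 N N' \<cdot> c0" "b1' \<cdot> u' = \<pi>\<^sub>1 M M' \<cdot> c1"
      using L.pullback_lift [OF pb' h(2,4)] eq(2) by (auto simp: Lin_hom_iff)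
    have "pmap C P P' b0 b0' \<cdot> \<langle>u, u'\<rangle> = c0" "pmap C P P' b1 b1' \<cdot> \<langle>u, u'\<rangle> = c1"
      using u u' t c(1,2) by simp_all
    then show "\<exists>w. (linear w \<and> src w = Q \<and> tgt w = P \<odot> P') \<and> pmap C P P' b0 b0' \<cdot> w = c0 \<and> pmap C P P' b1 b1' \<cdot> w = c1"
      using u u' by (intro exI [of _ "\<langle>u, u'\<rangle>"]) simp
  next
    fix Q w w'
    assume w: "linear w \<and> src w = Q \<and> tgt w = P \<odot> P'" "linear w' \<and> src w' = Q \<and> tgt w' = P \<odot> P'"
      and eq: "pmap C P P' b0 b0' \<cdot> w = pmap C P P' b0 b0' \<cdot> w'" "pmap C P P' b1 b1' \<cdot> w = pmap C P P' b1 b1' \<cdot> w'"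
    have comp: "b0 \<cdot> (\<pi>\<^sub>0 P P' \<cdot> z) = \<pi>\<^sub>0 N N' \<cdot> (pmap C P P' b0 b0' \<cdot> z)"
      "b1 \<cdot> (\<pi>\<^sub>0 P P' \<cdot> z) = \<pi>\<^sub>0 M M' \<cdot> (pmap C P P' b1 b1' \<cdot> z)"
      "b0' \<cdot> (\<pi>\<^sub>1 P P' \<cdot> z) = \<pi>\<^sub>1 N N' \<cdot> (pmap C P P' b0 b0' \<cdot> z)"
      "b1' \<cdot> (\<pi>\<^sub>1 P P' \<cdot> z) = \<pi>\<^sub>1 M M' \<cdot> (pmap C P P' b1 b1' \<cdot> z)" if "linear z \<and> src z = Q \<and> tgt z = P \<odot> P'" for z
      using that t by simp_all
    have h: "\<pi>\<^sub>0 P P' \<cdot> z \<in> hom (Lin C) Q P" "\<pi>\<^sub>1 P P' \<cdot> z \<in> hom (Lin C) Q P'"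
      if "linear z \<and> src z = Q \<and> tgt z = P \<odot> P'" for z
      using that by (simp_all add: Lin_hom_iff)
    have "\<pi>\<^sub>0 P P' \<cdot> w = \<pi>\<^sub>0 P P' \<cdot> w'"
      by (rule L.pullback_cancel [OF pb h(1) [OF w(1)] h(1) [OF w(2)]])
        (simp_all only: Lin_simps comp [OF w(1)] comp [OF w(2)] eq)
    moreover have "\<pi>\<^sub>1 P P' \<cdot> w = \<pi>\<^sub>1 P P' \<cdot> w'"
      by (rule L.pullback_cancel [OF pb' h(2) [OF w(1)] h(2) [OF w(2)]])
        (simp_all only: Lin_simps comp [OF w(1)] comp [OF w(2)] eq)
    ultimately show "w = w'"
      using w by - (rule prod_ext [of _ _ P P']; simp)
  qed (use t in auto)
qed

end

locale finitely_complete_linear_maps = cartesian_reverse_derivative_category +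
  assumes Lin_limits: "has_finite_limits (Lin C)"
begin

lemma Lin_pullback_exists:
  assumes "linear f" "linear g" "tgt f = tgt g"
  obtains P b0 b1 where "is_pullback (Lin C) (src f) (tgt f) (src g) f g P b0 b1"
  using L.pullback_exists [OF Lin_limits, of f "src f" "tgt f" g "src g"] assms
  by (auto simp: Lin_hom_iff)

lemma span_comp_hom:
  assumes F: "F \<in> hom (Dynam C) X Y" and G: "G \<in> hom (Dynam C) Y Z"
  shows "class_comp C G F \<in> hom (Dynam C) X Z"
proof -
  obtain l r v where F': "F = span_class l r v" "open_system l r v" "tgt l = X" "tgt r = Y"
    using F by (auto simp: Dynam_hom_iff)
  obtain l' r' w where G': "G = span_class l' r' w" "open_system l' r' w" "tgt l' = Y" "tgt r' = Z"
    using G by (auto simp: Dynam_hom_iff)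
  note t = open_systemD [OF F'(2)] open_systemD [OF G'(2)]
  obtain P b0 b1 where pb: "is_pullback (Lin C) (src l) (tgt r) (src l') r l' P b0 b1"
    using Lin_pullback_exists [of r l'] t F' G' by auto
  show ?thesis
    using span_comp [OF F'(2) G'(2) _ pb] open_system_comp [OF F'(2) G'(2) _ pb] F' G'
      L.pullback_typed(3,4) [OF pb] t
    by (auto intro!: span_class_hom simp: Lin_hom_iff)
qed

text \<open>With \<open>P\<close> and \<open>R\<close> the pullbacks for the two inner composites, the pullback \<open>S\<close> of \<open>P\<close> and \<open>R\<close> over
  the apex of \<open>G\<close> serves as the pullback for both outer composites, by pasting. Both composites are
  then literally the same span, and their systems agree since \<open>p1 \<circ> s0 = r0 \<circ> s1\<close>.\<close>

lemma span_comp_assoc: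
  assumes F: "F \<in> hom (Dynam C) W X" and G: "G \<in> hom (Dynam C) X Y" and H: "H \<in> hom (Dynam C) Y Z"
  shows "class_comp C (class_comp C H G) F = class_comp C H (class_comp C G F)"
proof -
  obtain l r v where F': "F = span_class l r v" "open_system l r v" "tgt l = W" "tgt r = X"
    using F by (auto simp: Dynam_hom_iff)
  obtain l' r' v' where G': "G = span_class l' r' v'" "open_system l' r' v'" "tgt l' = X" "tgt r' = Y"
    using G by (auto simp: Dynam_hom_iff)
  obtain l'' r'' v'' where H': "H = span_class l'' r'' v''" "open_system l'' r'' v''" "tgt l'' = Y" "tgt r'' = Z"
    using H by (auto simp: Dynam_hom_iff)
  note t = open_systemD [OF F'(2)] open_systemD [OF G'(2)] open_systemD [OF H'(2)] F'(3,4) G'(3,4) H'(3,4)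
  obtain P p0 p1 where pbP: "is_pullback (Lin C) (src l) (tgt r) (src l') r l' P p0 p1"
    using Lin_pullback_exists [of r l'] t by auto
  obtain R r0 r1 where pbR: "is_pullback (Lin C) (src l') (tgt r') (src l'') r' l'' R r0 r1"
    using Lin_pullback_exists [of r' l''] t by auto
  note tP = L.pullback_typed [OF pbP, unfolded Lin_hom_iff Lin_simps]
  note tR = L.pullback_typed [OF pbR, unfolded Lin_hom_iff Lin_simps]
  obtain S s0 s1 where pbS: "is_pullback (Lin C) P (src l') R p1 r0 S s0 s1"
    using Lin_pullback_exists [of p1 r0] tP tR by auto
  note tS = L.pullback_typed [OF pbS, unfolded Lin_hom_iff Lin_simps]
  note types = t tP(1-4) tR(1-4) tS(1-4)
  have pb1: "is_pullback (Lin C) (src (l \<cdot> p0)) (tgt (r' \<cdot> p1)) (src l'') (r' \<cdot> p1) l'' S s0 (r1 \<cdot> s1)"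
    using L.pullback_sym [OF L.pullback_paste [OF L.pullback_sym [OF pbR] L.pullback_sym [OF pbS]]] types
    by simp
  have pb2: "is_pullback (Lin C) (src l) (tgt r) (src (l' \<cdot> r0)) r (l' \<cdot> r0) S (p0 \<cdot> s0) s1"
    using L.pullback_paste [OF pbP pbS] types by simp
  have GF: "class_comp C G F = span_class (l \<cdot> p0) (r' \<cdot> p1) (pull p0 v \<boxplus> pull p1 v')"
    unfolding F' G' by (rule span_comp [OF F'(2) G'(2) _ pbP]) (simp add: types)
  have oGF: "open_system (l \<cdot> p0) (r' \<cdot> p1) (pull p0 v \<boxplus> pull p1 v')"
    by (rule open_system_comp [OF F'(2) G'(2) _ pbP]) (simp add: types)
  have HG: "class_comp C H G = span_class (l' \<cdot> r0) (r'' \<cdot> r1) (pull r0 v' \<boxplus> pull r1 v'')"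
    unfolding G' H' by (rule span_comp [OF G'(2) H'(2) _ pbR]) (simp add: types)
  have oHG: "open_system (l' \<cdot> r0) (r'' \<cdot> r1) (pull r0 v' \<boxplus> pull r1 v'')"
    by (rule open_system_comp [OF G'(2) H'(2) _ pbR]) (simp add: types)
  have "class_comp C H (class_comp C G F) = span_class ((l \<cdot> p0) \<cdot> s0) (r'' \<cdot> (r1 \<cdot> s1))
      (pull s0 (pull p0 v \<boxplus> pull p1 v') \<boxplus> pull (r1 \<cdot> s1) v'')"
    unfolding GF H' by (rule span_comp [OF oGF H'(2) _ pb1]) (use types in simp)
  moreover have "class_comp C (class_comp C H G) F = span_class (l \<cdot> (p0 \<cdot> s0)) ((r'' \<cdot> r1) \<cdot> s1)
      (pull (p0 \<cdot> s0) v \<boxplus> pull s1 (pull r0 v' \<boxplus> pull r1 v''))"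
    unfolding HG F' by (rule span_comp [OF F'(2) oHG _ pb2]) (use types in simp)
  moreover have "pull s0 (pull p0 v \<boxplus> pull p1 v') \<boxplus> pull (r1 \<cdot> s1) v'' =
      pull (p0 \<cdot> s0) v \<boxplus> pull s1 (pull r0 v' \<boxplus> pull r1 v'')"
    using types tS(5) by (simp add: add_assoc_typed)
  moreover have "(l \<cdot> p0) \<cdot> s0 = l \<cdot> (p0 \<cdot> s0)" "r'' \<cdot> (r1 \<cdot> s1) = (r'' \<cdot> r1) \<cdot> s1"
    using types by simp_all
  ultimately show ?thesis by simp
qed

lemma span_tensor_hom:
  assumes F: "F \<in> hom (Dynam C) X Y" and G: "G \<in> hom (Dynam C) W Z"
  shows "class_tensor C F G \<in> hom (Dynam C) (X \<odot> W) (Y \<odot> Z)"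
proof -
  obtain l r v where F': "F = span_class l r v" "open_system l r v" "tgt l = X" "tgt r = Y"
    using F by (auto simp: Dynam_hom_iff)
  obtain l' r' w where G': "G = span_class l' r' w" "open_system l' r' w" "tgt l' = W" "tgt r' = Z"
    using G by (auto simp: Dynam_hom_iff)
  show ?thesis
    unfolding F'(1) G'(1) span_tensor [OF F'(2) G'(2)]
    using open_systemD [OF F'(2)] open_systemD [OF G'(2)] F' G'
    by (intro span_class_hom open_system_tensor) simp_all
qed

text \<open>Forming the composite on the right with the product of the two pullbacks gives the span on the left;
  the systems are the same four summands in a different order.\<close>

lemma span_tensor_comp:
  assumes F: "F \<in> hom (Dynam C) X Y" and G: "G \<in> hom (Dynam C) Y Z"
    and F2: "F' \<in> hom (Dynam C) X' Y'" and G2: "G' \<in> hom (Dynam C) Y' Z'"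
  shows "class_tensor C (class_comp C G F) (class_comp C G' F') =
    class_comp C (class_tensor C G G') (class_tensor C F F')"
proof -
  obtain l r v where F': "F = span_class l r v" "open_system l r v" "tgt l = X" "tgt r = Y"
    using F by (auto simp: Dynam_hom_iff)
  obtain k q w where G': "G = span_class k q w" "open_system k q w" "tgt k = Y" "tgt q = Z"
    using G by (auto simp: Dynam_hom_iff)
  obtain l' r' v' where F2': "F' = span_class l' r' v'" "open_system l' r' v'" "tgt l' = X'" "tgt r' = Y'"
    using F2 by (auto simp: Dynam_hom_iff)
  obtain k' q' w' where G2': "G' = span_class k' q' w'" "open_system k' q' w'" "tgt k' = Y'" "tgt q' = Z'"
    using G2 by (auto simp: Dynam_hom_iff)
  note t = open_systemD [OF F'(2)] open_systemD [OF G'(2)] open_systemD [OF F2'(2)] open_systemD [OF G2'(2)]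
    F'(3,4) G'(3,4) F2'(3,4) G2'(3,4)
  obtain P b0 b1 where pb: "is_pullback (Lin C) (src l) (tgt r) (src k) r k P b0 b1"
    using Lin_pullback_exists [of r k] t by auto
  obtain P' b0' b1' where pb': "is_pullback (Lin C) (src l') (tgt r') (src k') r' k' P' b0' b1'"
    using Lin_pullback_exists [of r' k'] t by auto
  note b = L.pullback_typed(3,4) [OF pb, unfolded Lin_hom_iff Lin_simps]
    L.pullback_typed(3,4) [OF pb', unfolded Lin_hom_iff Lin_simps]
  have o: "P \<in> obj C" "P' \<in> obj C"
    using b by auto
  have GF: "class_comp C G F = span_class (l \<cdot> b0) (q \<cdot> b1) (pull b0 v \<boxplus> pull b1 w)"
      "open_system (l \<cdot> b0) (q \<cdot> b1) (pull b0 v \<boxplus> pull b1 w)"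
    using span_comp [OF F'(2) G'(2) _ pb] open_system_comp [OF F'(2) G'(2) _ pb] F' G' by simp_all
  have GF': "class_comp C G' F' = span_class (l' \<cdot> b0') (q' \<cdot> b1') (pull b0' v' \<boxplus> pull b1' w')"
      "open_system (l' \<cdot> b0') (q' \<cdot> b1') (pull b0' v' \<boxplus> pull b1' w')"
    using span_comp [OF F2'(2) G2'(2) _ pb'] open_system_comp [OF F2'(2) G2'(2) _ pb'] F2' G2' by simp_all
  have srcs: "src (l \<cdot> b0) = P" "src (l' \<cdot> b0') = P'"
    using t b by simp_all
  have lhs: "class_tensor C (class_comp C G F) (class_comp C G' F') =
    span_class (pmap C P P' (l \<cdot> b0) (l' \<cdot> b0')) (pmap C P P' (q \<cdot> b1) (q' \<cdot> b1'))
      (pull (\<pi>\<^sub>0 P P') (pull b0 v \<boxplus> pull b1 w) \<boxplus> pull (\<pi>\<^sub>1 P P') (pull b0' v' \<boxplus> pull b1' w'))"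
    using span_tensor [OF GF(2) GF'(2)] unfolding GF(1) GF'(1) srcs .
  have FF: "class_tensor C F F' = span_class (pmap C (src l) (src l') l l') (pmap C (src l) (src l') r r')
      (pull (\<pi>\<^sub>0 (src l) (src l')) v \<boxplus> pull (\<pi>\<^sub>1 (src l) (src l')) v')"
    unfolding F'(1) F2'(1) by (rule span_tensor [OF F'(2) F2'(2)])
  have GG: "class_tensor C G G' = span_class (pmap C (src k) (src k') k k') (pmap C (src k) (src k') q q')
      (pull (\<pi>\<^sub>0 (src k) (src k')) w \<boxplus> pull (\<pi>\<^sub>1 (src k) (src k')) w')"
    unfolding G'(1) G2'(1) by (rule span_tensor [OF G'(2) G2'(2)])
  have pp: "is_pullback (Lin C) (src (pmap C (src l) (src l') l l')) (tgt (pmap C (src l) (src l') r r'))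
      (src (pmap C (src k) (src k') k k')) (pmap C (src l) (src l') r r') (pmap C (src k) (src k') k k')
      (P \<odot> P') (pmap C P P' b0 b0') (pmap C P P' b1 b1')"
    using pullback_pmap [OF pb pb'] t by simp
  have rhs: "class_comp C (class_tensor C G G') (class_tensor C F F') =
    span_class (pmap C (src l) (src l') l l' \<cdot> pmap C P P' b0 b0') (pmap C (src k) (src k') q q' \<cdot> pmap C P P' b1 b1')
      (pull (pmap C P P' b0 b0') (pull (\<pi>\<^sub>0 (src l) (src l')) v \<boxplus> pull (\<pi>\<^sub>1 (src l) (src l')) v') \<boxplus>
       pull (pmap C P P' b1 b1') (pull (\<pi>\<^sub>0 (src k) (src k')) w \<boxplus> pull (\<pi>\<^sub>1 (src k) (src k')) w'))"
    unfolding FF GG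
    by (rule span_comp [OF open_system_tensor [OF F'(2) F2'(2)] open_system_tensor [OF G'(2) G2'(2)] _ pp])
      (use t in simp)
  have "pull (\<pi>\<^sub>0 P P') (pull b0 v \<boxplus> pull b1 w) \<boxplus> pull (\<pi>\<^sub>1 P P') (pull b0' v' \<boxplus> pull b1' w') =
      pull (pmap C P P' b0 b0') (pull (\<pi>\<^sub>0 (src l) (src l')) v \<boxplus> pull (\<pi>\<^sub>1 (src l) (src l')) v') \<boxplus>
       pull (pmap C P P' b1 b1') (pull (\<pi>\<^sub>0 (src k) (src k')) w \<boxplus> pull (\<pi>\<^sub>1 (src k) (src k')) w')"
    using t b o by (simp add: add_ac_typed)
  then show ?thesis
    unfolding lhs rhs using t b o by simp
qed

end

section \<open>Structure maps, naturality and Frobenius pullbacks\<close>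

context cartesian_reverse_derivative_category
begin

lemma linear_structure_maps [simp]:
  "X \<in> obj C \<Longrightarrow> Y \<in> obj C \<Longrightarrow> Z \<in> obj C \<Longrightarrow> linear (assoc_map X Y Z)"
  "X \<in> obj C \<Longrightarrow> Y \<in> obj C \<Longrightarrow> Z \<in> obj C \<Longrightarrow> linear (assoc_map_inv X Y Z)"
  "X \<in> obj C \<Longrightarrow> Y \<in> obj C \<Longrightarrow> linear (swap_map X Y)"
  "W \<in> obj C \<Longrightarrow> X \<in> obj C \<Longrightarrow> Y \<in> obj C \<Longrightarrow> Z \<in> obj C \<Longrightarrow> linear (mid_swap_map W X Y Z)"
  by (simp_all add: assoc_map_def assoc_map_inv_def swap_map_def mid_swap_map_def)

lemma lin_inverse_assoc_map:
  assumes [simp]: "X \<in> obj C" "Y \<in> obj C" "Z \<in> obj C"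
  shows "lin_inverse (assoc_map X Y Z) (assoc_map_inv X Y Z)"
  unfolding lin_inverse_def
  by (simp add: assoc_map_def assoc_map_inv_def)

lemma lin_inverse_swap_map:
  assumes [simp]: "X \<in> obj C" "Y \<in> obj C"
  shows "lin_inverse (swap_map X Y) (swap_map Y X)"
  unfolding lin_inverse_def
  by (simp add: swap_map_def)

lemma lin_inverse_mid_swap_map:
  assumes [simp]: "W \<in> obj C" "X \<in> obj C" "Y \<in> obj C" "Z \<in> obj C"
  shows "lin_inverse (mid_swap_map W X Y Z) (mid_swap_map W Y X Z)"
  unfolding lin_inverse_def
  by (simp add: mid_swap_map_def pmap_def)

lemma lin_inverse_unit_maps:
  assumes [simp]: "X \<in> obj C"
  shows "lin_inverse (\<pi>\<^sub>1 \<star> X) \<langle>! X, \<iota> X\<rangle>" "lin_inverse (\<pi>\<^sub>0 X \<star>) \<langle>\<iota> X, ! X\<rangle>"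
proof -
  have "! (\<star> \<odot> X) = \<pi>\<^sub>0 \<star> X" "! (X \<odot> \<star>) = \<pi>\<^sub>1 X \<star>"
    using bang_unique_typed [of "\<pi>\<^sub>0 \<star> X"] bang_unique_typed [of "\<pi>\<^sub>1 X \<star>"] by simp_all
  then show "lin_inverse (\<pi>\<^sub>1 \<star> X) \<langle>! X, \<iota> X\<rangle>" "lin_inverse (\<pi>\<^sub>0 X \<star>) \<langle>\<iota> X, ! X\<rangle>"
    by (simp_all add: lin_inverse_def)
qed

lemma Dynam_simps:
  shows "obj (Dynam C) = obj C" "cmp (Dynam C) = class_comp C"
    "tob (Dynam C) = pob C" "tar (Dynam C) = class_tensor C" "munit (Dynam C) = \<star>"
  by (auto simp: Dynam_def)

lemma dec_span_eq:
  assumes "linear l" "linear r" "src l = N" "src r = N" "tgt l = X" "tgt r = Y"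
  shows "dec_span C X Y N l r = span_class l r (\<zero> N N)"
proof -
  have "N \<in> obj C" using assms by auto
  then show ?thesis using assms by (simp add: dec_span_def span_class_def id_dec_eq)
qed

lemma dec_map_eq: "linear f \<Longrightarrow> src f = X \<Longrightarrow> tgt f = Y \<Longrightarrow> dec_map C X Y f = graph f"
  by (auto simp: dec_map_def graph_def dec_span_eq)

text \<open>Since identity decorations are zero, all structure maps are graphs or cographs.\<close>

lemma Dynam_structure:
  assumes [simp]: "X \<in> obj C"
  shows "ident (Dynam C) X = graph (\<iota> X)"
    "lunit (Dynam C) X = graph (\<pi>\<^sub>1 \<star> X)"
    "runit (Dynam C) X = graph (\<pi>\<^sub>0 X \<star>)"
    "Y \<in> obj C \<Longrightarrow> braid (Dynam C) X Y = graph (swap_map X Y)"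
    "Y \<in> obj C \<Longrightarrow> Z \<in> obj C \<Longrightarrow> assoc (Dynam C) X Y Z = graph (assoc_map X Y Z)"
    "mult (Dynam C) X = cograph (diag X)"
    "munt (Dynam C) X = cograph (! X)"
    "comult (Dynam C) X = graph (diag X)"
    "counit (Dynam C) X = graph (! X)"
  by (simp_all add: Dynam_def graph_def cograph_def dec_span_eq dec_map_eq assoc_map_def swap_map_def)

lemma span_class_hom_unique:
  assumes "F \<in> hom (Dynam C) X Y" "F \<in> hom (Dynam C) X' Y'"
  shows "X = X' \<and> Y = Y'"
proof -
  obtain l r v where F: "F = span_class l r v" "open_system l r v" "tgt l = X" "tgt r = Y"
    using assms(1) by (auto simp: Dynam_hom_iff)
  obtain l' r' v' where F': "F = span_class l' r' v'" "open_system l' r' v'" "tgt l' = X'" "tgt r' = Y'"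
    using assms(2) by (auto simp: Dynam_hom_iff)
  have "\<lparr>apex = src l, lleg = l, rleg = r, syst = v\<rparr> \<in> F"
    using self_mem_ods_class [OF open_system_ods_set [OF F(2)]] F(1) by (simp add: span_class_def)
  then have "\<lparr>apex = src l, lleg = l, rleg = r, syst = v\<rparr> \<in> ods_set C X' Y'"
    using F' mem_ods_class(2) by (auto simp: span_class_def)
  then show ?thesis
    using F(3,4) by (simp add: ods_set_iff)
qed

lemma span_comp_ident:
  assumes "F \<in> hom (Dynam C) X Y"
  shows "class_comp C F (graph (\<iota> X)) = F" "class_comp C (graph (\<iota> Y)) F = F"
proof -
  obtain l r v where F: "F = span_class l r v" "open_system l r v" "tgt l = X" "tgt r = Y"
    using assms by (auto simp: Dynam_hom_iff)
  note t = open_systemD [OF F(2)]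
  have o: "X \<in> obj C" "Y \<in> obj C" using t F by auto
  show "class_comp C F (graph (\<iota> X)) = F"
    using comp_cograph [OF F(2), of "\<iota> X"] F o t by (simp add: cograph_ident)
  show "class_comp C (graph (\<iota> Y)) F = F"
    using graph_comp [OF F(2), of "\<iota> Y"] F o t by simp
qed

lemma Dynam_hom_obj: "F \<in> hom (Dynam C) X Y \<Longrightarrow> X \<in> obj C \<and> Y \<in> obj C"
  by (auto simp: Dynam_hom_iff open_system_def)

lemma is_inverse_graph:
  assumes "lin_inverse n m"
  shows "is_inverse (Dynam C) (src n) (tgt n) (graph n) (graph m)"
proof -
  have t: "linear n" "linear m" "src m = tgt n" "tgt m = src n" "m \<cdot> n = \<iota> (src n)" "n \<cdot> m = \<iota> (tgt n)"
    using assms by (simp_all add: lin_inverse_def)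
  then show ?thesis
    by (simp add: is_inverse_def Dynam_simps Dynam_structure graph_graph graph_hom)
qed

lemma is_iso_graph: "lin_inverse n m \<Longrightarrow> src n = X \<Longrightarrow> tgt n = Y \<Longrightarrow> is_iso (Dynam C) X Y (graph n)"
  using is_inverse_graph unfolding is_iso_def by blast

text \<open>A naturality criterion. The map \<open>a\<close> is invertible, so composing with \<open>graph a\<close> on the right extends
  the left leg by the inverse of \<open>a\<close>; then \<open>n\<close> is an isomorphism between the two composites.\<close>

lemma graph_square:
  assumes F: "open_system l r v" and G: "open_system l' r' v'"
    and a: "lin_inverse a a'" "src a = tgt l" "tgt a = tgt l'"
    and b: "linear b" "src b = tgt r"
    and n: "lin_inverse n n'" "src n = src l" "tgt n = src l'"
    and eq: "a \<cdot> l = l' \<cdot> n" "b \<cdot> r = r' \<cdot> n" "pull n v' = v"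
  shows "class_comp C (graph b) (span_class l r v) = class_comp C (span_class l' r' v') (graph a)"
proof -
  note t = open_systemD [OF F] open_systemD [OF G]
  have a': "linear a" "linear a'" "src a' = tgt l'" "tgt a' = tgt l" "a' \<cdot> a = \<iota> (tgt l)"
    using a by (simp_all add: lin_inverse_def)
  have n': "linear n"
    using n by (simp add: lin_inverse_def)
  have "(a' \<cdot> l') \<cdot> n = a' \<cdot> (a \<cdot> l)"
    using t a' n' n eq(1) by simp
  also have "\<dots> = l"
    using lin_inverse_cancel(1) [OF a(1), of l] t a by simp
  finally have leg: "(a' \<cdot> l') \<cdot> n = l" .
  have "open_system (a' \<cdot> l') r' v'"
    using t a' by (simp add: open_system_def)
  then have "span_class l (b \<cdot> r) v = span_class (a' \<cdot> l') r' v'"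
    by (rule span_class_eqI [OF _ n(1) _ leg]) (use t a' n' n eq in simp_all)
  then show ?thesis
    using graph_comp [OF F b] comp_graph_iso [OF G a(1,3)] by simp
qed

lemma span_assoc_natural:
  assumes F: "F \<in> hom (Dynam C) X X'" and G: "G \<in> hom (Dynam C) Y Y'" and H: "H \<in> hom (Dynam C) Z Z'"
  shows "class_comp C (graph (assoc_map X' Y' Z')) (class_tensor C (class_tensor C F G) H) =
    class_comp C (class_tensor C F (class_tensor C G H)) (graph (assoc_map X Y Z))"
proof -
  obtain l r v where F': "F = span_class l r v" "open_system l r v" "tgt l = X" "tgt r = X'"
    using F by (auto simp: Dynam_hom_iff)
  obtain l' r' v' where G': "G = span_class l' r' v'" "open_system l' r' v'" "tgt l' = Y" "tgt r' = Y'"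
    using G by (auto simp: Dynam_hom_iff)
  obtain l'' r'' v'' where H': "H = span_class l'' r'' v''" "open_system l'' r'' v''" "tgt l'' = Z" "tgt r'' = Z'"
    using H by (auto simp: Dynam_hom_iff)
  note t = open_systemD [OF F'(2)] open_systemD [OF G'(2)] open_systemD [OF H'(2)] F'(3,4) G'(3,4) H'(3,4)
    Dynam_hom_obj [OF F] Dynam_hom_obj [OF G] Dynam_hom_obj [OF H]
  have natural: "assoc_map A' B' D' \<cdot> pmap C (A \<odot> B) D (pmap C A B p q) s =
      pmap C A (B \<odot> D) p (pmap C B D q s) \<cdot> assoc_map A B D"
    if "arr p" "arr q" "arr s" "src p = A" "src q = B" "src s = D" "tgt p = A'" "tgt q = B'" "tgt s = D'"
    for p q s A B D A' B' D'
  proof -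
    have "A \<in> obj C" "B \<in> obj C" "D \<in> obj C" "A' \<in> obj C" "B' \<in> obj C" "D' \<in> obj C"
      using that by auto
    then show ?thesis
      by - (rule triple_ext [of _ A B D]; use that in simp)
  qed
  show ?thesis
    unfolding F'(1) G'(1) H'(1) span_tensor [OF F'(2) G'(2)] span_tensor [OF G'(2) H'(2)]
      span_tensor [OF open_system_tensor [OF F'(2) G'(2)] H'(2)]
      span_tensor [OF F'(2) open_system_tensor [OF G'(2) H'(2)]]
  proof (rule graph_square)
    show "lin_inverse (assoc_map X Y Z) (assoc_map_inv X Y Z)"
      "lin_inverse (assoc_map (src l) (src l') (src l'')) (assoc_map_inv (src l) (src l') (src l''))"
      using t by (simp_all add: lin_inverse_assoc_map)
    let ?N = "src l" and ?M = "src l'" and ?K = "src l''"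
    show "assoc_map X Y Z \<cdot> pmap C (src (pmap C ?N ?M l l')) ?K (pmap C ?N ?M l l') l'' =
        pmap C ?N (src (pmap C ?M ?K l' l'')) l (pmap C ?M ?K l' l'') \<cdot> assoc_map ?N ?M ?K"
      using natural [of l l' l''] t by simp
    show "assoc_map X' Y' Z' \<cdot> pmap C (src (pmap C ?N ?M l l')) ?K (pmap C ?N ?M r r') r'' =
        pmap C ?N (src (pmap C ?M ?K l' l'')) r (pmap C ?M ?K r' r'') \<cdot> assoc_map ?N ?M ?K"
      using natural [of r r' r''] t by simp
    have pr: "\<pi>\<^sub>0 ?N (?M \<odot> ?K) \<cdot> assoc_map ?N ?M ?K = \<pi>\<^sub>0 ?N ?M \<cdot> \<pi>\<^sub>0 (?N \<odot> ?M) ?K"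
      "\<pi>\<^sub>0 ?M ?K \<cdot> (\<pi>\<^sub>1 ?N (?M \<odot> ?K) \<cdot> assoc_map ?N ?M ?K) = \<pi>\<^sub>1 ?N ?M \<cdot> \<pi>\<^sub>0 (?N \<odot> ?M) ?K"
      "\<pi>\<^sub>1 ?M ?K \<cdot> (\<pi>\<^sub>1 ?N (?M \<odot> ?K) \<cdot> assoc_map ?N ?M ?K) = \<pi>\<^sub>1 (?N \<odot> ?M) ?K"
      using t by (simp_all add: assoc_map_def)
    show "pull (assoc_map ?N ?M ?K)
        (pull (\<pi>\<^sub>0 ?N (src (pmap C ?M ?K l' l''))) v \<boxplus> pull (\<pi>\<^sub>1 ?N (src (pmap C ?M ?K l' l'')))
          (pull (\<pi>\<^sub>0 ?M ?K) v' \<boxplus> pull (\<pi>\<^sub>1 ?M ?K) v'')) =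
      pull (\<pi>\<^sub>0 (src (pmap C ?N ?M l l')) ?K) (pull (\<pi>\<^sub>0 ?N ?M) v \<boxplus> pull (\<pi>\<^sub>1 ?N ?M) v') \<boxplus>
        pull (\<pi>\<^sub>1 (src (pmap C ?N ?M l l')) ?K) v''"
      using t by (simp add: add_assoc_typed pr)
  qed (use open_system_tensor [OF open_system_tensor [OF F'(2) G'(2)] H'(2)]
        open_system_tensor [OF F'(2) open_system_tensor [OF G'(2) H'(2)]] t in simp_all)
qed

lemma span_unit_natural:
  assumes F: "F \<in> hom (Dynam C) X Y"
  shows "class_comp C (graph (\<pi>\<^sub>1 \<star> Y)) (class_tensor C (graph (\<iota> \<star>)) F) = class_comp C F (graph (\<pi>\<^sub>1 \<star> X))"
    "class_comp C (graph (\<pi>\<^sub>0 Y \<star>)) (class_tensor C F (graph (\<iota> \<star>))) = class_comp C F (graph (\<pi>\<^sub>0 X \<star>))"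
proof -
  obtain l r v where F': "F = span_class l r v" "open_system l r v" "tgt l = X" "tgt r = Y"
    using F by (auto simp: Dynam_hom_iff)
  note t = open_systemD [OF F'(2)] F'(3,4) Dynam_hom_obj [OF F]
  have i: "graph (\<iota> \<star>) = span_class (\<iota> \<star>) (\<iota> \<star>) (\<zero> \<star> \<star>)" "open_system (\<iota> \<star>) (\<iota> \<star>) (\<zero> \<star> \<star>)"
    using open_system_graph(1) [of "\<iota> \<star>"] by (simp_all add: graph_def)
  show "class_comp C (graph (\<pi>\<^sub>1 \<star> Y)) (class_tensor C (graph (\<iota> \<star>)) F) = class_comp C F (graph (\<pi>\<^sub>1 \<star> X))"
    unfolding i(1) F'(1) span_tensor [OF i(2) F'(2)]
  proof (rule graph_square)
    show "lin_inverse (\<pi>\<^sub>1 \<star> X) \<langle>! X, \<iota> X\<rangle>" "lin_inverse (\<pi>\<^sub>1 \<star> (src l)) \<langle>! (src l), \<iota> (src l)\<rangle>"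
      using t by (simp_all add: lin_inverse_unit_maps)
  qed (use open_system_tensor [OF i(2) F'(2)] F'(2) t in simp_all)
  show "class_comp C (graph (\<pi>\<^sub>0 Y \<star>)) (class_tensor C F (graph (\<iota> \<star>))) = class_comp C F (graph (\<pi>\<^sub>0 X \<star>))"
    unfolding i(1) F'(1) span_tensor [OF F'(2) i(2)]
  proof (rule graph_square)
    show "lin_inverse (\<pi>\<^sub>0 X \<star>) \<langle>\<iota> X, ! X\<rangle>" "lin_inverse (\<pi>\<^sub>0 (src l) \<star>) \<langle>\<iota> (src l), ! (src l)\<rangle>"
      using t by (simp_all add: lin_inverse_unit_maps)
  qed (use open_system_tensor [OF F'(2) i(2)] F'(2) t in simp_all)
qed

lemma span_braid_natural:
  assumes F: "F \<in> hom (Dynam C) X X'" and G: "G \<in> hom (Dynam C) Y Y'"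
  shows "class_comp C (graph (swap_map X' Y')) (class_tensor C F G) =
    class_comp C (class_tensor C G F) (graph (swap_map X Y))"
proof -
  obtain l r v where F': "F = span_class l r v" "open_system l r v" "tgt l = X" "tgt r = X'"
    using F by (auto simp: Dynam_hom_iff)
  obtain l' r' v' where G': "G = span_class l' r' v'" "open_system l' r' v'" "tgt l' = Y" "tgt r' = Y'"
    using G by (auto simp: Dynam_hom_iff)
  note t = open_systemD [OF F'(2)] open_systemD [OF G'(2)] F'(3,4) G'(3,4)
    Dynam_hom_obj [OF F] Dynam_hom_obj [OF G]
  show ?thesis
    unfolding F'(1) G'(1) span_tensor [OF F'(2) G'(2)] span_tensor [OF G'(2) F'(2)]
  proof (rule graph_square)
    show "lin_inverse (swap_map X Y) (swap_map Y X)"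
      "lin_inverse (swap_map (src l) (src l')) (swap_map (src l') (src l))"
      using t by (simp_all add: lin_inverse_swap_map)
    show "open_system (pmap C (src l) (src l') l l') (pmap C (src l) (src l') r r')
       (pull (\<pi>\<^sub>0 (src l) (src l')) v \<boxplus> pull (\<pi>\<^sub>1 (src l) (src l')) v')"
      "open_system (pmap C (src l') (src l) l' l) (pmap C (src l') (src l) r' r)
       (pull (\<pi>\<^sub>0 (src l') (src l)) v' \<boxplus> pull (\<pi>\<^sub>1 (src l') (src l)) v)"
      using open_system_tensor F'(2) G'(2) by blast+
  qed (use t in \<open>simp_all add: swap_map_def pmap_def add_comm_typed\<close>)
qed

lemma cograph_comp_graph_iso:
  assumes "linear f" "lin_inverse g g'" "tgt g = tgt f"
  shows "class_comp C (cograph f) (graph g) = cograph (g' \<cdot> f)"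
  using assms cograph_cograph [of f g'] by (simp add: graph_eq_cograph [OF assms(2)] lin_inverse_def)

lemma cograph_tensor_ident:
  assumes "linear f" "X \<in> obj C"
  shows "class_tensor C (cograph f) (graph (\<iota> X)) = cograph (pmap C (src f) X f (\<iota> X))"
    "class_tensor C (graph (\<iota> X)) (cograph f) = cograph (pmap C X (src f) (\<iota> X) f)"
  using cograph_tensor [of f "\<iota> X"] cograph_tensor [of "\<iota> X" f] assms by (simp_all add: cograph_ident)

text \<open>That the kernel pair of the diagonal is trivial says that the diagonal is a monomorphism.\<close>

lemma pullback_diag:
  assumes [simp]: "X \<in> obj C"
  shows "is_pullback (Lin C) X (X \<odot> X) X (diag X) (diag X) X (\<iota> X) (\<iota> X)"
  by (rule L.pullbackI) (auto simp: Lin_hom_iff pairing_inj)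

lemma diag_cancel:
  assumes "u \<in> hom (Lin C) Q X" "u' \<in> hom (Lin C) Q X" "cmp (Lin C) (diag X) u = cmp (Lin C) (diag X) u'"
  shows "u = u'"
proof -
  have "X \<in> obj C" using assms(1) by (auto simp: Lin_hom_iff)
  then show ?thesis using assms by (auto simp: Lin_hom_iff pairing_inj)
qed

text \<open>If \<open>((a, a), b) = ((d, e), e)\<close>, then \<open>a\<close>, \<open>b\<close>, \<open>d\<close> and \<open>e\<close> all coincide; thus the pullback consists of the
  diagonal in both factors. The second square is its mirror image.\<close>

lemma pullback_frobenius:
  assumes [simp]: "X \<in> obj C"
  shows "is_pullback (Lin C) (X \<odot> X) ((X \<odot> X) \<odot> X) (X \<odot> X)
      (pmap C X X (diag X) (\<iota> X)) (assoc_map_inv X X X \<cdot> pmap C X X (\<iota> X) (diag X)) X (diag X) (diag X)"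
    "is_pullback (Lin C) (X \<odot> X) (X \<odot> X \<odot> X) (X \<odot> X)
      (pmap C X X (\<iota> X) (diag X)) (assoc_map X X X \<cdot> pmap C X X (diag X) (\<iota> X)) X (diag X) (diag X)"
proof -
  have split: "\<exists>a b. c = \<langle>a, b\<rangle> \<and> linear a \<and> linear b \<and> src a = Q \<and> src b = Q \<and> tgt a = X \<and> tgt b = X"
    if "c \<in> hom (Lin C) Q (X \<odot> X)" for c Q
    using that by (intro exI [of _ "\<pi>\<^sub>0 X X \<cdot> c"] exI [of _ "\<pi>\<^sub>1 X X \<cdot> c"]) (simp add: Lin_hom_iff)
  show "is_pullback (Lin C) (X \<odot> X) ((X \<odot> X) \<odot> X) (X \<odot> X)
      (pmap C X X (diag X) (\<iota> X)) (assoc_map_inv X X X \<cdot> pmap C X X (\<iota> X) (diag X)) X (diag X) (diag X)"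
  proof (rule L.pullbackI)
    fix Q c0 c1
    assume c: "c0 \<in> hom (Lin C) Q (X \<odot> X)" "c1 \<in> hom (Lin C) Q (X \<odot> X)"
      and eq: "cmp (Lin C) (pmap C X X (diag X) (\<iota> X)) c0 =
        cmp (Lin C) (assoc_map_inv X X X \<cdot> pmap C X X (\<iota> X) (diag X)) c1"
    obtain a b where a: "c0 = \<langle>a, b\<rangle>" "linear a" "linear b" "src a = Q" "src b = Q" "tgt a = X" "tgt b = X"
      using split [OF c(1)] by blast
    obtain d e where d: "c1 = \<langle>d, e\<rangle>" "linear d" "linear e" "src d = Q" "src e = Q" "tgt d = X" "tgt e = X"
      using split [OF c(2)] by blast
    have "b = a" "d = a" "e = a"
      using eq a(2-) d(2-) unfolding a(1) d(1) by (auto simp: pairing_inj)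
    then show "\<exists>u. u \<in> hom (Lin C) Q X \<and> cmp (Lin C) (diag X) u = c0 \<and> cmp (Lin C) (diag X) u = c1"
      using a d by (intro exI [of _ a]) (simp add: Lin_hom_iff)
  qed (auto simp: Lin_hom_iff intro: diag_cancel)
  show "is_pullback (Lin C) (X \<odot> X) (X \<odot> X \<odot> X) (X \<odot> X)
      (pmap C X X (\<iota> X) (diag X)) (assoc_map X X X \<cdot> pmap C X X (diag X) (\<iota> X)) X (diag X) (diag X)"
  proof (rule L.pullbackI)
    fix Q c0 c1
    assume c: "c0 \<in> hom (Lin C) Q (X \<odot> X)" "c1 \<in> hom (Lin C) Q (X \<odot> X)"
      and eq: "cmp (Lin C) (pmap C X X (\<iota> X) (diag X)) c0 =
        cmp (Lin C) (assoc_map X X X \<cdot> pmap C X X (diag X) (\<iota> X)) c1"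
    obtain a b where a: "c0 = \<langle>a, b\<rangle>" "linear a" "linear b" "src a = Q" "src b = Q" "tgt a = X" "tgt b = X"
      using split [OF c(1)] by blast
    obtain d e where d: "c1 = \<langle>d, e\<rangle>" "linear d" "linear e" "src d = Q" "src e = Q" "tgt d = X" "tgt e = X"
      using split [OF c(2)] by blast
    have "b = a" "d = a" "e = a"
      using eq a(2-) d(2-) unfolding a(1) d(1) by (auto simp: pairing_inj)
    then show "\<exists>u. u \<in> hom (Lin C) Q X \<and> cmp (Lin C) (diag X) u = c0 \<and> cmp (Lin C) (diag X) u = c1"
      using a d by (intro exI [of _ a]) (simp add: Lin_hom_iff)
  qed (auto simp: Lin_hom_iff intro: diag_cancel)
qed

end

section \<open>The hypergraph category of open dynamical systems\<close>

context finitely_complete_linear_maps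
begin

lemma Dynam_category: "category (Dynam C)"
proof
  show "X \<in> obj (Dynam C) \<and> Y \<in> obj (Dynam C)" if "f \<in> hom (Dynam C) X Y" for f X Y
    using Dynam_hom_obj [OF that] by (simp add: Dynam_simps)
  show "X = X' \<and> Y = Y'" if "f \<in> hom (Dynam C) X Y" "f \<in> hom (Dynam C) X' Y'" for f X Y X' Y'
    using that by (rule span_class_hom_unique)
  show "ident (Dynam C) X \<in> hom (Dynam C) X X" if "X \<in> obj (Dynam C)" for X
    using that by (simp add: Dynam_simps Dynam_structure graph_hom)
  show "cmp (Dynam C) f (ident (Dynam C) X) = f" if "f \<in> hom (Dynam C) X Y" for f X Y
    using span_comp_ident(1) [OF that] Dynam_hom_obj [OF that] by (simp add: Dynam_simps Dynam_structure)
  show "cmp (Dynam C) (ident (Dynam C) Y) f = f" if "f \<in> hom (Dynam C) X Y" for f X Y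
    using span_comp_ident(2) [OF that] Dynam_hom_obj [OF that] by (simp add: Dynam_simps Dynam_structure)
qed (use span_comp_hom span_comp_assoc in \<open>auto simp: Dynam_simps\<close>)

lemma inv_arr_graph:
  assumes "lin_inverse n m" "src n = X" "tgt n = Y"
  shows "inv_arr (Dynam C) X Y (graph n) = graph m"
  using category.inv_arr_eq [OF Dynam_category is_inverse_graph [OF assms(1)]] assms(2,3) by simp

text \<open>Passing to graphs preserves composition and monoidal products, so the laws that involve structure maps
  alone hold because they hold for the canonical maps between products in \<open>C\<close>.\<close>

lemma Dynam_symmetric_monoidal: "symmetric_monoidal_category (Dynam C)"
proof (intro symmetric_monoidal_category.intro Dynam_category symmetric_monoidal_category_axioms.intro,
    unfold Dynam_simps)
  note S = Dynam_structure graph_graph graph_tensor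
  show "\<star> \<in> obj C" by simp
  show "X \<odot> Y \<in> obj C" if "X \<in> obj C" "Y \<in> obj C" for X Y
    using that by simp
  show "class_tensor C f g \<in> hom (Dynam C) (X \<odot> W) (Y \<odot> Z)"
    if "f \<in> hom (Dynam C) X Y" "g \<in> hom (Dynam C) W Z" for f g X Y W Z
    using that by (rule span_tensor_hom)
  show "class_tensor C (ident (Dynam C) X) (ident (Dynam C) Y) = ident (Dynam C) (X \<odot> Y)"
    if "X \<in> obj C" "Y \<in> obj C" for X Y
    using that by (simp add: S)
  show "class_tensor C (class_comp C g f) (class_comp C g' f') =
      class_comp C (class_tensor C g g') (class_tensor C f f')"
    if "f \<in> hom (Dynam C) X Y" "g \<in> hom (Dynam C) Y Z" "f' \<in> hom (Dynam C) X' Y'" "g' \<in> hom (Dynam C) Y' Z'"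
    for f g f' g' X Y Z X' Y' Z'
    using that by (rule span_tensor_comp)
  show "is_iso (Dynam C) ((X \<odot> Y) \<odot> Z) (X \<odot> Y \<odot> Z) (assoc (Dynam C) X Y Z)"
    if "X \<in> obj C" "Y \<in> obj C" "Z \<in> obj C" for X Y Z
    using that is_iso_graph [OF lin_inverse_assoc_map] by (simp add: S)
  show "class_comp C (assoc (Dynam C) X' Y' Z') (class_tensor C (class_tensor C f g) h) =
      class_comp C (class_tensor C f (class_tensor C g h)) (assoc (Dynam C) X Y Z)"
    if "f \<in> hom (Dynam C) X X'" "g \<in> hom (Dynam C) Y Y'" "h \<in> hom (Dynam C) Z Z'" for f g h X X' Y Y' Z Z'
    using span_assoc_natural [OF that] that [THEN Dynam_hom_obj] by (simp add: S)
  show "is_iso (Dynam C) (\<star> \<odot> X) X (lunit (Dynam C) X)" "is_iso (Dynam C) (X \<odot> \<star>) X (runit (Dynam C) X)"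
    if "X \<in> obj C" for X
    using that is_iso_graph [OF lin_inverse_unit_maps(1)] is_iso_graph [OF lin_inverse_unit_maps(2)]
    by (simp_all add: S)
  show "class_comp C (lunit (Dynam C) Y) (class_tensor C (ident (Dynam C) \<star>) f) = class_comp C f (lunit (Dynam C) X)"
    "class_comp C (runit (Dynam C) Y) (class_tensor C f (ident (Dynam C) \<star>)) = class_comp C f (runit (Dynam C) X)"
    if "f \<in> hom (Dynam C) X Y" for f X Y
    using span_unit_natural [OF that] Dynam_hom_obj [OF that] by (simp_all add: S)
  show "class_comp C (assoc (Dynam C) W X (Y \<odot> Z)) (assoc (Dynam C) (W \<odot> X) Y Z) =
      class_comp C (class_comp C (class_tensor C (ident (Dynam C) W) (assoc (Dynam C) X Y Z))
        (assoc (Dynam C) W (X \<odot> Y) Z)) (class_tensor C (assoc (Dynam C) W X Y) (ident (Dynam C) Z))"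
    if "W \<in> obj C" "X \<in> obj C" "Y \<in> obj C" "Z \<in> obj C" for W X Y Z
    using that pentagon_maps [OF that] by (simp add: S)
  show "class_comp C (class_tensor C (ident (Dynam C) X) (lunit (Dynam C) Y)) (assoc (Dynam C) X \<star> Y) =
      class_tensor C (runit (Dynam C) X) (ident (Dynam C) Y)" if "X \<in> obj C" "Y \<in> obj C" for X Y
    using that by (simp add: S assoc_map_def pmap_def)
  show "braid (Dynam C) X Y \<in> hom (Dynam C) (X \<odot> Y) (Y \<odot> X)" if "X \<in> obj C" "Y \<in> obj C" for X Y
    using that by (simp add: S graph_hom)
  show "class_comp C (braid (Dynam C) X' Y') (class_tensor C f g) =
      class_comp C (class_tensor C g f) (braid (Dynam C) X Y)"
    if "f \<in> hom (Dynam C) X X'" "g \<in> hom (Dynam C) Y Y'" for f g X X' Y Y'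
    using span_braid_natural [OF that] that [THEN Dynam_hom_obj] by (simp add: S)
  show "class_comp C (braid (Dynam C) Y X) (braid (Dynam C) X Y) = ident (Dynam C) (X \<odot> Y)"
    if "X \<in> obj C" "Y \<in> obj C" for X Y
    using that lin_inverse_swap_map [OF that] by (simp add: S lin_inverse_def)
  show "class_comp C (class_comp C (assoc (Dynam C) Y Z X) (braid (Dynam C) X (Y \<odot> Z))) (assoc (Dynam C) X Y Z) =
      class_comp C (class_comp C (class_tensor C (ident (Dynam C) Y) (braid (Dynam C) X Z)) (assoc (Dynam C) Y X Z))
        (class_tensor C (braid (Dynam C) X Y) (ident (Dynam C) Z))"
    if "X \<in> obj C" "Y \<in> obj C" "Z \<in> obj C" for X Y Z
    using that hexagon_maps [OF that] by (simp add: S)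
qed

lemma assoc_inv_Dynam:
  "X \<in> obj C \<Longrightarrow> Y \<in> obj C \<Longrightarrow> Z \<in> obj C \<Longrightarrow> assoc_inv (Dynam C) X Y Z = graph (assoc_map_inv X Y Z)"
  by (simp add: assoc_inv_def Dynam_simps Dynam_structure inv_arr_graph lin_inverse_assoc_map)

lemma mid_swap_Dynam:
  assumes "W \<in> obj C" "X \<in> obj C" "Y \<in> obj C" "Z \<in> obj C"
  shows "mid_swap (Dynam C) W X Y Z = graph (mid_swap_map W X Y Z)"
  using assms mid_swap_map_eq [OF assms]
  by (simp add: mid_swap_def assoc_inv_Dynam Dynam_simps Dynam_structure graph_graph graph_tensor)

lemma inv_arr_unit:
  "inv_arr (Dynam C) (\<star> \<odot> \<star>) \<star> (graph (\<pi>\<^sub>1 \<star> \<star>)) = graph (diag \<star>)"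
  using inv_arr_graph [OF lin_inverse_unit_maps(1) [OF one_obj]] by simp

text \<open>The multiplication and unit are the cographs, the comultiplication and counit the graphs, of the diagonal
  and of the map to the terminal object. Where a coherence isomorphism has the wrong variance,
  it is replaced by the cograph of its inverse.\<close>

lemma Dynam_hypergraph: "hypergraph_category (Dynam C)"
proof (intro hypergraph_category.intro Dynam_symmetric_monoidal hypergraph_category_axioms.intro,
    unfold Dynam_simps)
  note S = Dynam_structure graph_graph graph_tensor cograph_cograph cograph_tensor cograph_tensor_ident
  fix X
  assume X [simp]: "X \<in> obj C"
  show "mult (Dynam C) X \<in> hom (Dynam C) (X \<odot> X) X" "munt (Dynam C) X \<in> hom (Dynam C) \<star> X"
    "comult (Dynam C) X \<in> hom (Dynam C) X (X \<odot> X)" "counit (Dynam C) X \<in> hom (Dynam C) X \<star>"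
    by (simp_all add: S graph_hom cograph_hom)
  show "class_comp C (mult (Dynam C) X) (class_tensor C (mult (Dynam C) X) (ident (Dynam C) X)) =
      class_comp C (class_comp C (mult (Dynam C) X) (class_tensor C (ident (Dynam C) X) (mult (Dynam C) X)))
        (assoc (Dynam C) X X X)"
    by (simp add: S cograph_comp_graph_iso [OF _ lin_inverse_assoc_map])
  show "class_comp C (mult (Dynam C) X) (class_tensor C (munt (Dynam C) X) (ident (Dynam C) X)) = lunit (Dynam C) X"
    by (simp add: S graph_eq_cograph [OF lin_inverse_unit_maps(1)])
  show "class_comp C (mult (Dynam C) X) (class_tensor C (ident (Dynam C) X) (munt (Dynam C) X)) = runit (Dynam C) X"
    by (simp add: S graph_eq_cograph [OF lin_inverse_unit_maps(2)])
  show "class_comp C (mult (Dynam C) X) (braid (Dynam C) X X) = mult (Dynam C) X"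
    by (simp add: S cograph_comp_graph_iso [OF _ lin_inverse_swap_map])
  show "class_comp C (class_comp C (assoc (Dynam C) X X X) (class_tensor C (comult (Dynam C) X) (ident (Dynam C) X)))
      (comult (Dynam C) X) =
      class_comp C (class_tensor C (ident (Dynam C) X) (comult (Dynam C) X)) (comult (Dynam C) X)"
    by (simp add: S)
  show "class_comp C (class_comp C (lunit (Dynam C) X) (class_tensor C (counit (Dynam C) X) (ident (Dynam C) X)))
      (comult (Dynam C) X) = ident (Dynam C) X"
    by (simp add: S)
  show "class_comp C (class_comp C (runit (Dynam C) X) (class_tensor C (ident (Dynam C) X) (counit (Dynam C) X)))
      (comult (Dynam C) X) = ident (Dynam C) X"
    by (simp add: S)
  show "class_comp C (braid (Dynam C) X X) (comult (Dynam C) X) = comult (Dynam C) X"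
    by (simp add: S)
  show "class_comp C (class_comp C (class_tensor C (ident (Dynam C) X) (mult (Dynam C) X)) (assoc (Dynam C) X X X))
      (class_tensor C (comult (Dynam C) X) (ident (Dynam C) X)) =
      class_comp C (comult (Dynam C) X) (mult (Dynam C) X)"
    by (simp add: S cograph_comp_graph_iso [OF _ lin_inverse_assoc_map]
        cograph_graph [OF pullback_frobenius(1)] graph_cograph del: pmap_pairing)
  show "class_comp C (class_comp C (class_tensor C (mult (Dynam C) X) (ident (Dynam C) X)) (assoc_inv (Dynam C) X X X))
      (class_tensor C (ident (Dynam C) X) (comult (Dynam C) X)) =
      class_comp C (comult (Dynam C) X) (mult (Dynam C) X)"
    by (simp add: S assoc_inv_Dynam cograph_comp_graph_iso [OF _ lin_inverse_sym [OF lin_inverse_assoc_map]]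
        cograph_graph [OF pullback_frobenius(2)] graph_cograph)
  show "class_comp C (mult (Dynam C) X) (comult (Dynam C) X) = ident (Dynam C) X"
    using cograph_graph [OF pullback_diag [OF X]] by (simp add: S graph_def)
next
  fix X Y
  assume [simp]: "X \<in> obj C" "Y \<in> obj C"
  note S = Dynam_structure graph_graph graph_tensor cograph_cograph cograph_tensor mid_swap_Dynam inv_arr_unit
  show "mult (Dynam C) (X \<odot> Y) = class_comp C (class_tensor C (mult (Dynam C) X) (mult (Dynam C) Y))
      (mid_swap (Dynam C) X Y X Y)"
    by (simp add: S cograph_comp_graph_iso [OF _ lin_inverse_mid_swap_map] mid_swap_map_diag)
  show "munt (Dynam C) (X \<odot> Y) = class_comp C (class_tensor C (munt (Dynam C) X) (munt (Dynam C) Y))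
      (inv_arr (Dynam C) (\<star> \<odot> \<star>) \<star> (lunit (Dynam C) \<star>))"
    using cograph_comp_graph_iso [OF _ lin_inverse_sym [OF lin_inverse_unit_maps(1) [OF one_obj]],
        of "pmap C X Y (! X) (! Y)"]
    by (simp add: S)
  show "comult (Dynam C) (X \<odot> Y) = class_comp C (mid_swap (Dynam C) X X Y Y)
      (class_tensor C (comult (Dynam C) X) (comult (Dynam C) Y))"
    by (simp add: S mid_swap_map_diag)
  show "counit (Dynam C) (X \<odot> Y) = class_comp C (lunit (Dynam C) \<star>)
      (class_tensor C (counit (Dynam C) X) (counit (Dynam C) Y))"
    by (simp add: S)
next
  show "mult (Dynam C) \<star> = lunit (Dynam C) \<star>"
    using graph_eq_cograph [OF lin_inverse_unit_maps(1) [OF one_obj]] by (simp add: Dynam_structure)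
  show "munt (Dynam C) \<star> = ident (Dynam C) \<star>" "counit (Dynam C) \<star> = ident (Dynam C) \<star>"
    by (simp_all add: Dynam_structure cograph_ident)
  show "comult (Dynam C) \<star> = inv_arr (Dynam C) (\<star> \<odot> \<star>) \<star> (lunit (Dynam C) \<star>)"
    by (simp add: Dynam_structure inv_arr_unit)
qed

end

theorem corollary3p4p1:
  fixes C :: "('o, 'm) rd_cat"
  assumes "cartesian_reverse_derivative_category C"
    and "has_finite_limits (Lin C)"
  shows "hypergraph_category (Dynam C) \<and>
    (\<forall>X Y. equiv (ods_set C X Y) (ods_iso C X Y)) \<and>
    (\<forall>X Y Z s t P b0 b1.
       s \<in> ods_set C X Y \<and> t \<in> ods_set C Y Z \<and>
       is_pullback (Lin C) (apex s) Y (apex t) (rleg s) (lleg t) P b0 b1 \<longrightarrow>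
       ods_comp C s t P b0 b1 \<in> ods_set C X Z \<and>
       cmp (Dynam C) (ods_class C Y Z t) (ods_class C X Y s) =
         ods_class C X Z (ods_comp C s t P b0 b1)) \<and>
    (\<forall>X Y W Z s t.
       s \<in> ods_set C X Y \<and> t \<in> ods_set C W Z \<longrightarrow>
       ods_tensor C s t \<in> ods_set C (X \<odot>\<^bsub>C\<^esub> W) (Y \<odot>\<^bsub>C\<^esub> Z) \<and>
       tar (Dynam C) (ods_class C X Y s) (ods_class C W Z t) =
         ods_class C (X \<odot>\<^bsub>C\<^esub> W) (Y \<odot>\<^bsub>C\<^esub> Z) (ods_tensor C s t))"
proof -
  interpret finitely_complete_linear_maps C
    by (rule finitely_complete_linear_maps.intro [OF assms(1)])
      (rule finitely_complete_linear_maps_axioms.intro [OF assms(2)])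
  show ?thesis
    using Dynam_hypergraph ods_iso_equiv
    by (auto simp: Dynam_simps class_comp_eq class_tensor_eq intro: ods_comp_in_ods_set ods_tensor_in_ods_set)
qed

end
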